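(* Let $n\ge2$ be an integer, let $\alpha_1,\dots,\alpha_{n-1}$ and $\beta_0$ be complex constants, and let $$E(z)=\sum_{i=0}^{\mathbf{k}-1}\beta_{\mathbf{k}-i}e^{\mu_{\mathbf{k}-i}z}+\sum_{j=0}^{\mathbf{l}-1}\gamma_{\mathbf{l}-j}e^{-\nu_{\mathbf{l}-j}z}$$ be an exponential polynomial satisfying the assumptions listed in the context. Suppose that the equation $$f^{(n)}+\alpha_{n-1}f^{(n-1)}+\cdots+\alpha_1f'-(E+\beta_0)f=0$$ has a nonzero solution $f$ such that $\lambda(f)<1$. Then there are two integers $\mathbf{m},\mathbf{n}\ge0$ and complex constants $a_0\ne0$, $c$, $c_i$, $\varsigma_i$ ($0\le i\le\mathbf{m}$), $d_j$, $\tau_j$ ($0\le j\le\mathbf{n}$) such that $\varsigma_0=\tau_0=0$ and $$f(z)=a_0e^{cz}\exp\left(\sum_{i=0}^{\mathbf{m}}c_ie^{\frac{\mu_{\mathbf{k}}-\varsigma_i}{n}z}+\sum_{j=0}^{\mathbf{n}}d_je^{-\frac{\nu_{\mathbf{l}}-\tau_j}{n}z}\right).$$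
   Context: $\lambda(f)$ denotes the exponent of convergence of the zeros of the entire function $f$ (solutions of the equation are entire). Assumptions on $E$ ($\mathbf{k},\mathbf{l}\ge1$ integers): $\beta_{\mathbf{k}},\dots,\beta_1$ are nonzero constants; $\mu_{\mathbf{k}},\dots,\mu_1$ are distinct complex numbers with arguments in $(-\pi/2,\pi/2)$; $\gamma_{\mathbf{l}},\dots,\gamma_1$ are constants that are either all zero or all nonzero; $\nu_{\mathbf{l}},\dots,\nu_1$ are distinct complex numbers with arguments in $(-\pi/2,\pi/2)$. Moreover (this can be arranged by a rotation of the variable) $|e^{\mu_{\mathbf{k}}z}|>|e^{\mu_{\mathbf{k}-1}z}|\ge\cdots\ge|e^{\mu_1z}|$ on the positive real axis and $|e^{-\nu_{\mathbf{l}}z}|>|e^{-\nu_{\mathbf{l}-1}z}|\ge\cdots\ge|e^{-\nu_1z}|$ on the negative real axis. *)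

theory Defs
  imports "HOL-Complex_Analysis.Complex_Analysis"
begin

text \<open>
  The infimum of all \<open>s > 0\<close> for which \<open>\<Sum> |a|\<^sup>-\<^sup>s\<close> converges, where \<open>a\<close> runs through the zeros
  \<open>a \<noteq> 0\<close> of \<open>f\<close>, each repeated according to its multiplicity; it is \<open>\<infinity>\<close> if there is no such \<open>s\<close>.
  Intended for entire \<open>f\<close> that are not identically zero, where \<open>zorder f a\<close> is the
  multiplicity of the zero \<open>a\<close>.
\<close>

definition exponent_of_convergence :: "(complex \<Rightarrow> complex) \<Rightarrow> ereal" where
  "exponent_of_convergence f =
     Inf {ereal s | s. s > 0 \<and>
       (\<lambda>a. of_int (zorder f a) * norm a powr (-s)) summable_on {a. f a = 0 \<and> a \<noteq> 0}}"

text \<open>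
  The parameter sequences are indexed from 1; values outside \<open>1, \<dots>, k\<close> resp. \<open>1, \<dots>, l\<close>
  are not used.
\<close>

definition exp_polynomial ::
  "nat \<Rightarrow> (nat \<Rightarrow> complex) \<Rightarrow> (nat \<Rightarrow> complex) \<Rightarrow>
   nat \<Rightarrow> (nat \<Rightarrow> complex) \<Rightarrow> (nat \<Rightarrow> complex) \<Rightarrow> complex \<Rightarrow> complex" where
  "exp_polynomial k \<beta> \<mu> l \<gamma> \<nu> z =
     (\<Sum>i=0..k-1. \<beta> (k-i) * exp (\<mu> (k-i) * z)) +
     (\<Sum>j=0..l-1. \<gamma> (l-j) * exp (- \<nu> (l-j) * z))"

text \<open>
  The condition \<open>w \<noteq> 0\<close> is needed because of the convention \<open>Arg 0 = 0\<close>.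
\<close>

definition arg_in_right_sector :: "complex \<Rightarrow> bool" where
  "arg_in_right_sector w \<longleftrightarrow> w \<noteq> 0 \<and> Arg w \<in> {-pi/2<..<pi/2}"

end

theory Submission
  imports Defs "HOL-Real_Asymp.Real_Asymp"
begin

text \<open>
  Since \<open>\<lambda>(f) < 1\<close>, write \<open>f = \<kappa> e\<^sup>h\<close> with a canonical product \<open>\<kappa>\<close> of genus 0, and let \<open>v = h'\<close>. A Gronwall
  estimate for the equation together with the Borel--Caratheodory inequality bounds \<open>v\<close> by the
  \<open>n\<close>-th root of the coefficient \<open>W = E + \<beta>\<^sub>0\<close>; in particular \<open>v\<close> is of exponential type. The logarithmic
  derivatives of \<open>\<kappa>\<close> are small on suitable circles, so by the maximum principle \<open>v\<^sup>n\<close> and \<open>W\<close> agree to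
  leading order in every sector where one exponential of \<open>W\<close> dominates. Expanding the
  \<open>n\<close>-th root, \<open>v\<close> differs from a finite exponential sum by a bounded function in a small sector around
  a direction \<open>d\<close> close to the positive axis, and likewise around \<open>-d\<close>. If \<open>d\<close> is generic, the
  two sums can be separated into growing and decaying terms, and Phragmen--Lindelof in the two
  complementary sectors, which have opening less than \<open>\<pi>\<close>, shows that \<open>v\<close> itself is an exponential
  sum. Then the defect \<open>e\<^sup>-\<^sup>h P(e\<^sup>h) - W\<close>, where \<open>P\<close> is the differential operator of the equation, is an
  exponential sum as well; being small around \<open>d\<close>, it is exponentially small there, hence so is \<open>\<kappa>'\<close>.
  As \<open>\<kappa>'\<close> has zero exponential type, it vanishes, and integrating \<open>v\<close> gives the result.
\<close>

subsection \<open>Canonical products of genus 0\<close>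

text \<open>The factorisation gives no growth bound for \<open>h\<close>, and \<open>f\<close> is
  not known to have finite order, so all growth must be read off the equation. The n-th root comes
  from a rescaling: if |W| is at most \<open>\<Lambda> ^ n\<close> on a disc, dividing the i-th
  derivative by \<open>\<Lambda> ^ i\<close> turns the companion system into one of size
  \<open>\<Lambda>\<close>. The unknown size of \<open>f\<close> cancels, because only differences
  of Re h enter Borel-Caratheodory.

  The zeros of \<open>\<kappa>\<close> are the second obstacle, since its logarithmic derivatives
  are unbounded near them. Hence the quantity that is estimated, \<open>coef 0 - W\<close>, is
  entire, and it is estimated on circles avoiding the zeros.

  Bounded errors suffice: \<open>v\<close> is matched only up to O(1) in two narrow sectors, a
  finite expansion of the root achieves this, and Liouville turns boundedness into a constant. All
  frequencies live in a countable group \<open>G\<close> fixed beforehand, so one direction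
  \<open>d\<close> can be chosen in which no nonzero frequency that ever arises is neutral and no
  two have equal growth rate.\<close>

text \<open>
  The \<open>b n\<close> are the reciprocals of the zeros; \<open>b n = 0\<close> is allowed, so that finitely many zeros
  need no separate treatment.
\<close>

definition canonical_product :: "(nat \<Rightarrow> complex) \<Rightarrow> complex \<Rightarrow> complex" where
  "canonical_product b z = (\<Prod>n. 1 - b n * z)"

context
  fixes b :: "nat \<Rightarrow> complex"
  assumes summable_b: "summable (\<lambda>n. norm (b n))"
begin

lemma canonical_product_has_prod: "(\<lambda>n. 1 - b n * z) has_prod canonical_product b z"
proof -
  have "summable (\<lambda>n. norm (b n) * norm z)"
    by (rule summable_mult2) (rule summable_b)
  hence "summable (\<lambda>n. norm ((1 - b n * z) - 1))"
    by (simp add: norm_mult)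
  hence "convergent_prod (\<lambda>n. 1 - b n * z)"
    using abs_convergent_prod_conv_summable abs_convergent_prod_imp_convergent_prod by blast
  thus ?thesis
    unfolding canonical_product_def by (rule convergent_prod_has_prod)
qed

lemma canonical_product_eq_0_iff: "canonical_product b z = 0 \<longleftrightarrow> (\<exists>n. b n * z = 1)"
proof -
  have "canonical_product b z = 0 \<longleftrightarrow> (\<exists>n. 0 = 1 - b n * z)"
    using has_prod_eq_0_iff[OF canonical_product_has_prod[of z]] by (simp add: image_iff)
  thus ?thesis
    by (metis eq_iff_diff_eq_0)
qed

lemma canonical_product_LIMSEQ: "(\<lambda>N. \<Prod>n<N. 1 - b n * z) \<longlonglongrightarrow> canonical_product b z"
  using has_prod_imp_tendsto'[OF canonical_product_has_prod[of z]] .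

lemma canonical_product_uniform_limit:
  "uniform_limit (cball 0 R) (\<lambda>N z. \<Prod>n<N. 1 - b n * z) (canonical_product b) sequentially"
proof -
  have "uniformly_convergent_on (cball 0 R) (\<lambda>N z. \<Prod>n<N. 1 - b n * z)"
  proof (rule uniformly_convergent_on_prod')
    show "uniformly_convergent_on (cball 0 R) (\<lambda>N z. \<Sum>n<N. norm ((1 - b n * z) - 1))"
    proof (rule Weierstrass_m_test'_ev)
      show "\<forall>\<^sub>F n in sequentially. \<forall>z\<in>cball 0 R. norm (norm ((1 - b n * z) - 1)) \<le> norm (b n) * R"
        by (intro always_eventually) (auto simp: norm_mult intro!: mult_left_mono)
      show "summable (\<lambda>n. norm (b n) * R)"
        by (rule summable_mult2) (rule summable_b)
    qed
  qed (auto intro!: continuous_intros)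
  then obtain g where g: "uniform_limit (cball 0 R) (\<lambda>N z. \<Prod>n<N. 1 - b n * z) g sequentially"
    by (auto simp: uniformly_convergent_on_def)
  have "g z = canonical_product b z" if "z \<in> cball 0 R" for z
    using tendsto_uniform_limitI[OF g that] canonical_product_LIMSEQ[of z] LIMSEQ_unique by blast
  thus ?thesis
    using g by (metis (no_types, lifting) uniform_limit_cong')
qed

lemma canonical_product_holomorphic: "canonical_product b holomorphic_on A"
proof (rule holomorphic_on_subset)
  show "canonical_product b holomorphic_on UNIV"
  proof (rule holomorphic_uniform_sequence)
    fix z :: complex
    have "uniform_limit (cball z 1) (\<lambda>N z. \<Prod>n<N. 1 - b n * z) (canonical_product b) sequentially"
      by (rule uniform_limit_on_subset[OF canonical_product_uniform_limit[of "norm z + 1"]])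
        (simp add: cball_subset_cball_iff)
    thus "\<exists>d>0. cball z d \<subseteq> UNIV \<and>
        uniform_limit (cball z d) (\<lambda>N z. \<Prod>n<N. 1 - b n * z) (canonical_product b) sequentially"
      by (intro exI[of _ 1]) auto
  qed (auto intro!: holomorphic_intros)
qed auto

lemma norm_canonical_product_le: "norm (canonical_product b z) \<le> exp (norm z * (\<Sum>n. norm (b n)))"
proof (rule LIMSEQ_le_const2)
  show "(\<lambda>N. norm (\<Prod>n<N. 1 - b n * z)) \<longlonglongrightarrow> norm (canonical_product b z)"
    by (rule tendsto_norm[OF canonical_product_LIMSEQ])
  have "norm (\<Prod>n<N. 1 - b n * z) \<le> exp (norm z * (\<Sum>n. norm (b n)))" for N
  proof -
    have "norm (\<Prod>n<N. 1 - b n * z) = (\<Prod>n<N. norm (1 - b n * z))"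
      by (simp add: prod_norm)
    also have "\<dots> \<le> (\<Prod>n<N. exp (norm (b n) * norm z))"
    proof (intro prod_mono conjI)
      fix n
      have "norm (1 - b n * z) \<le> 1 + norm (b n) * norm z"
        using norm_triangle_ineq4[of 1 "b n * z"] by (simp add: norm_mult)
      also have "\<dots> \<le> exp (norm (b n) * norm z)"
        by (rule exp_ge_add_one_self)
      finally show "norm (1 - b n * z) \<le> exp (norm (b n) * norm z)" .
    qed auto
    also have "\<dots> = exp (norm z * (\<Sum>n<N. norm (b n)))"
      by (simp add: exp_sum sum_distrib_left mult.commute)
    also have "\<dots> \<le> exp (norm z * (\<Sum>n. norm (b n)))"
      by (auto intro!: mult_left_mono sum_le_suminf summable_b)
    finally show ?thesis .
  qed
  thus "\<exists>N. \<forall>n\<ge>N. norm (\<Prod>i<n. 1 - b i * z) \<le> exp (norm z * (\<Sum>n. norm (b n)))"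
    by blast
qed

lemma norm_canonical_product_ge:
  assumes "\<And>n. norm (b n * z) \<le> 1 / 2"
  shows "norm (canonical_product b z) \<ge> exp (- (2 * norm z * (\<Sum>n. norm (b n))))"
proof (rule LIMSEQ_le_const)
  show "(\<lambda>N. norm (\<Prod>n<N. 1 - b n * z)) \<longlonglongrightarrow> norm (canonical_product b z)"
    by (rule tendsto_norm[OF canonical_product_LIMSEQ])
  have "norm (\<Prod>n<N. 1 - b n * z) \<ge> exp (- (2 * norm z * (\<Sum>n. norm (b n))))" for N
  proof -
    have "exp (- (2 * norm z * (\<Sum>n. norm (b n)))) \<le> exp (- (2 * norm z * (\<Sum>n<N. norm (b n))))"
      by (auto intro!: mult_left_mono sum_le_suminf summable_b)
    also have "\<dots> = (\<Prod>n<N. exp (- (2 * (norm (b n) * norm z))))"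
      by (simp add: exp_sum[symmetric] sum_distrib_left sum_negf mult_ac)
    also have "\<dots> \<le> (\<Prod>n<N. norm (1 - b n * z))"
    proof (intro prod_mono conjI)
      fix n
      define x where "x = norm (b n) * norm z"
      have x: "0 \<le> x" "x \<le> 1 / 2"
        using assms[of n] by (auto simp: x_def norm_mult)
      \<comment> \<open>The product exceeds 1 by \<open>x * (1 - 2 * x)\<close>, which is
        nonnegative on [0, 1/2]. This yields \<open>1 - x \<ge> exp (- (2 * x))\<close> there, the
        source of the factor 2 in the exponent.\<close>
      have "1 \<le> (1 - x) * (1 + 2 * x)"
        using x mult_left_mono[of "2 * x" 1 x] by (simp add: algebra_simps)
      also have "\<dots> \<le> (1 - x) * exp (2 * x)"
        using x by (intro mult_left_mono exp_ge_add_one_self) auto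
      finally have "exp (- (2 * x)) \<le> 1 - x"
        by (simp add: exp_minus field_simps)
      also have "\<dots> \<le> norm (1 - b n * z)"
        using norm_triangle_ineq2[of 1 "b n * z"] by (simp add: x_def norm_mult)
      finally show "exp (- (2 * (norm (b n) * norm z))) \<le> norm (1 - b n * z)"
        by (simp add: x_def)
    qed auto
    also have "\<dots> = norm (\<Prod>n<N. 1 - b n * z)"
      by (simp add: prod_norm)
    finally show ?thesis .
  qed
  thus "\<exists>N. \<forall>n\<ge>N. exp (- (2 * norm z * (\<Sum>n. norm (b n)))) \<le> norm (\<Prod>i<n. 1 - b i * z)"
    by blast
qed

lemma summable_remove: "summable (\<lambda>n. norm (if n \<in> K then 0 else b n))"
  by (rule summable_comparison_test'[OF summable_b]) auto

end

text \<open>Removed factors get coefficient 0 instead of being skipped, so the index set stays the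
  same and no reindexing arises.\<close>

lemma canonical_product_split:
  assumes b: "summable (\<lambda>n. norm (b n))" and K: "finite K"
  shows "canonical_product b z =
    (\<Prod>n\<in>K. 1 - b n * z) * canonical_product (\<lambda>n. if n \<in> K then 0 else b n) z"
proof -
  let ?c = "\<lambda>n. if n \<in> K then 0 else b n"
  have 1: "(\<lambda>n. if n \<in> K then 1 - b n * z else 1) has_prod (\<Prod>n\<in>K. 1 - b n * z)"
    by (rule has_prod_If_finite_set[OF K])
  have "(\<lambda>n. (if n \<in> K then 1 - b n * z else 1) * (1 - ?c n * z)) has_prod
      ((\<Prod>n\<in>K. 1 - b n * z) * canonical_product ?c z)"
    by (rule has_prod_mult[OF 1 canonical_product_has_prod[OF summable_remove[OF b]]])
  also have "(\<lambda>n. (if n \<in> K then 1 - b n * z else 1) * (1 - ?c n * z)) = (\<lambda>n. 1 - b n * z)"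
    by auto
  finally show ?thesis
    using canonical_product_has_prod[OF b] has_prod_unique2 by blast
qed

lemma zorder_linear_factor:
  fixes a c :: complex
  assumes "c * a = 1"
  shows "zorder (\<lambda>w. 1 - c * w) a = 1"
proof (rule zorder_eqI)
  show "(\<lambda>_. - c) holomorphic_on UNIV"
    by (intro holomorphic_intros)
  show "1 - c * w = - c * (w - a) powi 1" for w
    using assms by (simp add: algebra_simps)
qed (use assms in auto)

lemma finite_canonical_zeros:
  fixes b :: "nat \<Rightarrow> complex"
  assumes b: "summable (\<lambda>n. norm (b n))" and e: "e > 0"
  shows "finite {n. norm (b n) \<ge> e}"
proof -
  have "eventually (\<lambda>n. norm (b n) < e) sequentially"
    using order_tendstoD(2)[OF summable_LIMSEQ_zero[OF b] e] .
  then obtain N where "\<And>n. n \<ge> N \<Longrightarrow> norm (b n) < e"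
    by (auto simp: eventually_sequentially)
  hence "{n. norm (b n) \<ge> e} \<subseteq> {..<N}"
    by (force simp: not_le[symmetric])
  thus ?thesis
    by (rule finite_subset) auto
qed

text \<open>As \<open>b n\<close> tends to 0, only finitely many factors vanish at \<open>a\<close>.
  Each of them has a simple zero there and the product of the others is nonzero at \<open>a\<close>,
  so the order just counts indices.\<close>

lemma zorder_canonical_product:
  fixes b :: "nat \<Rightarrow> complex"
  assumes b: "summable (\<lambda>n. norm (b n))"
  shows "zorder (canonical_product b) a = int (card {n. b n * a = 1})"
proof -
  define K where "K = {n. b n * a = 1}"
  have K: "finite K"
  proof (cases "a = 0")
    case False
    have "norm (b n) \<ge> inverse (norm a)" if "n \<in> K" for n
    proof -
      have "norm (b n) * norm a = 1"
        using that by (auto simp: K_def simp flip: norm_mult)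
      thus ?thesis
        using False by (simp add: field_simps)
    qed
    hence "K \<subseteq> {n. norm (b n) \<ge> inverse (norm a)}"
      by auto
    moreover have "finite {n. norm (b n) \<ge> inverse (norm a)}"
      using False by (intro finite_canonical_zeros[OF b]) auto
    ultimately show ?thesis
      by (rule finite_subset)
  qed (auto simp: K_def)
  let ?c = "\<lambda>n. if n \<in> K then 0 else b n"
  have c: "summable (\<lambda>n. norm (?c n))"
    by (rule summable_remove[OF b])
  have eq: "canonical_product b = (\<lambda>z. (\<Prod>n\<in>K. 1 - b n * z) * canonical_product ?c z)"
    using canonical_product_split[OF b K] by auto
  have c_nz: "canonical_product ?c a \<noteq> 0"
    by (subst canonical_product_eq_0_iff[OF c]) (auto simp: K_def)
  have c_an: "canonical_product ?c analytic_on {a}"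
    using canonical_product_holomorphic[OF c, of UNIV] by (simp add: holomorphic_on_imp_analytic_at)
  have p_an: "(\<lambda>z. (\<Prod>n\<in>K. 1 - b n * z)) analytic_on {a}"
    by (intro analytic_intros)
  have lin: "eventually (\<lambda>z. 1 - b n * z \<noteq> 0) (at a)" if "n \<in> K" for n
  proof -
    have "eventually (\<lambda>z. z \<noteq> a) (at a)"
      by (simp add: eventually_neq_at_within)
    thus ?thesis
    proof (rule eventually_mono)
      fix z assume "z \<noteq> a"
      moreover have "b n * a = 1" "b n \<noteq> 0"
        using that by (auto simp: K_def)
      ultimately have "b n * z \<noteq> 1"
        by (metis mult_left_cancel)
      thus "1 - b n * z \<noteq> 0"
        by simp
    qed
  qed
  have "eventually (\<lambda>z. \<forall>n\<in>K. 1 - b n * z \<noteq> 0) (at a)"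
    using lin K by (simp add: eventually_ball_finite)
  hence evp: "eventually (\<lambda>z. (\<Prod>n\<in>K. 1 - b n * z) \<noteq> 0) (at a)"
    by (rule eventually_mono) (use K in auto)
  moreover have "eventually (\<lambda>z. canonical_product ?c z \<noteq> 0) (at a)"
    using analytic_at_imp_isCont[OF c_an] c_nz
    unfolding isCont_def by (rule tendsto_imp_eventually_ne)
  ultimately have ev: "eventually (\<lambda>z. (\<Prod>n\<in>K. 1 - b n * z) * canonical_product ?c z \<noteq> 0) (at a)"
    by eventually_elim simp
  have "zorder (canonical_product b) a =
      zorder (\<lambda>z. \<Prod>n\<in>K. 1 - b n * z) a + zorder (canonical_product ?c) a"
    unfolding eq by (rule zorder_times_analytic[OF p_an c_an ev])
  also have "zorder (canonical_product ?c) a = 0"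
    by (rule zorder_eq_0I[OF c_an c_nz])
  also have "zorder (\<lambda>z. \<Prod>n\<in>K. 1 - b n * z) a = (\<Sum>n\<in>K. zorder (\<lambda>z. 1 - b n * z) a)"
    by (intro zorder_prod_analytic evp analytic_intros)
  also have "\<dots> = (\<Sum>n\<in>K. 1)"
    by (intro sum.cong refl zorder_linear_factor) (auto simp: K_def)
  finally show ?thesis
    by (simp add: K_def)
qed

text \<open>A tail with small sum of |b n| has small exponential type, and the finitely many
  remaining linear factors grow more slowly than any exponential.\<close>

lemma canonical_product_zero_type:
  fixes b :: "nat \<Rightarrow> complex"
  assumes b: "summable (\<lambda>n. norm (b n))" and \<delta>: "\<delta> > 0"
  obtains C where "C > 0" "\<And>z. norm (canonical_product b z) \<le> C * exp (\<delta> * norm z)"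
proof -
  obtain N where N: "(\<Sum>n. norm (b (n + N))) < \<delta> / 2"
  proof -
    have "(\<lambda>N. \<Sum>n. norm (b (n + N))) \<longlonglongrightarrow> 0"
      using suminf_exist_split2[OF b] .
    hence "eventually (\<lambda>N. (\<Sum>n. norm (b (n + N))) < \<delta> / 2) sequentially"
      using \<delta> by (intro order_tendstoD(2)) auto
    thus ?thesis
      using that by (auto simp: eventually_sequentially)
  qed
  let ?c = "\<lambda>n. if n \<in> {..<N} then 0 else b n"
  have c: "summable (\<lambda>n. norm (?c n))"
    by (rule summable_remove[OF b])
  have sc: "(\<Sum>n. norm (?c n)) = (\<Sum>n. norm (b (n + N)))"
    by (subst suminf_split_initial_segment[OF c, of N]) auto
  define B where "B = Max (insert 1 ((\<lambda>n. norm (b n)) ` {..<N}))"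
  have B: "B \<ge> 1" "\<And>n. n < N \<Longrightarrow> norm (b n) \<le> B"
    by (auto simp: B_def)
  \<comment> \<open>The share of each of the \<open>N\<close> split factors, for a total of at most
    \<open>\<delta> / 2\<close>; \<open>Suc N\<close> keeps the quotient meaningful for
    \<open>N = 0\<close>.\<close>
  define \<epsilon> where "\<epsilon> = \<delta> / (2 * real (Suc N))"
  have \<epsilon>: "\<epsilon> > 0"
    using \<delta> by (simp add: \<epsilon>_def)
  define D where "D = max 1 (B / \<epsilon>)"
  have lin: "norm (1 - b n * z) \<le> D * exp (\<epsilon> * norm z)" if "n < N" for n z
  proof -
    have "norm (1 - b n * z) \<le> 1 + norm (b n) * norm z"
      using norm_triangle_ineq4[of 1 "b n * z"] by (simp add: norm_mult)
    also have "\<dots> \<le> 1 + B * norm z"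
      using B(2)[OF that] by (auto intro!: mult_right_mono)
    also have "\<dots> = 1 + (B / \<epsilon>) * (\<epsilon> * norm z)"
      using \<epsilon> by simp
    also have "\<dots> \<le> D + D * (\<epsilon> * norm z)"
      using \<epsilon> by (intro add_mono mult_right_mono) (auto simp: D_def)
    also have "\<dots> = D * (1 + \<epsilon> * norm z)"
      by (simp add: algebra_simps)
    also have "\<dots> \<le> D * exp (\<epsilon> * norm z)"
      by (intro mult_left_mono exp_ge_add_one_self) (auto simp: D_def)
    finally show ?thesis .
  qed
  have "norm (canonical_product b z) \<le> D ^ N * exp (\<delta> * norm z)" for z
  proof -
    have "norm (canonical_product b z) = (\<Prod>n<N. norm (1 - b n * z)) * norm (canonical_product ?c z)"
      by (subst canonical_product_split[OF b, of "{..<N}"]) (auto simp: norm_mult prod_norm)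
    also have "\<dots> \<le> (\<Prod>n<N. D * exp (\<epsilon> * norm z)) * exp (norm z * (\<Sum>n. norm (?c n)))"
      by (intro mult_mono prod_mono norm_canonical_product_le[OF c] prod_nonneg conjI)
        (use lin in \<open>auto simp: D_def\<close>)
    also have "\<dots> = D ^ N * exp (real N * \<epsilon> * norm z + norm z * (\<Sum>n. norm (?c n)))"
      by (simp add: power_mult_distrib exp_add exp_of_nat_mult mult.assoc)
    also have "\<dots> \<le> D ^ N * exp (\<delta> * norm z)"
    proof -
      have "real N * \<epsilon> \<le> \<delta> / 2"
        using \<delta> by (simp add: \<epsilon>_def field_simps)
      hence "real N * \<epsilon> * norm z \<le> \<delta> / 2 * norm z"
        by (intro mult_right_mono) auto
      moreover have "norm z * (\<Sum>n. norm (?c n)) \<le> norm z * (\<delta> / 2)"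
        using N unfolding sc by (intro mult_left_mono) auto
      ultimately have "real N * \<epsilon> * norm z + norm z * (\<Sum>n. norm (?c n)) \<le> \<delta> * norm z"
        by (simp add: mult_ac)
      thus ?thesis
        by (intro mult_left_mono) (auto simp: D_def)
    qed
    finally show ?thesis .
  qed
  moreover have "D ^ N > 0"
    by (auto simp: D_def)
  ultimately show ?thesis
    using that by blast
qed

section \<open>Factorisation when the exponent of convergence is less than 1\<close>

lemma summable_norm_of_powr:
  fixes b :: "nat \<Rightarrow> complex"
  assumes s: "0 < s" "s < 1" and sb: "summable (\<lambda>i. norm (b i) powr s)"
  shows "summable (\<lambda>i. norm (b i))"
proof (rule summable_comparison_test_ev[OF _ sb])
  have "eventually (\<lambda>i. norm (b i) powr s < 1) sequentially"
    using order_tendstoD(2)[OF summable_LIMSEQ_zero[OF sb], of 1] by simp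
  thus "eventually (\<lambda>i. norm (norm (b i)) \<le> norm (b i) powr s) sequentially"
  proof (rule eventually_mono)
    fix i assume "norm (b i) powr s < 1"
    hence "norm (b i) < 1"
      using s ge_one_powr_ge_zero[of "norm (b i)" s] by linarith
    hence "norm (b i) powr 1 \<le> norm (b i) powr s"
      using s by (intro powr_mono') auto
    thus "norm (norm (b i)) \<le> norm (b i) powr s"
      by simp
  qed
qed

lemma entire_zorder_pos_iff:
  assumes "f holomorphic_on UNIV" "\<exists>z. f z \<noteq> 0"
  shows "zorder f a > 0 \<longleftrightarrow> f a = 0" and "zorder f a \<ge> 0"
  using zorder_exist_zero[OF assms(1) open_UNIV connected_UNIV UNIV_I, of a] assms(2)
  by (auto split: if_splits)

text \<open>The product is built to have the zeros of \<open>f\<close> with the same multiplicities;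
  the zero-free quotient is then \<open>exp h\<close>. The exponent \<open>s\<close> stays in the
  conclusion because later estimates use \<open>s < 1\<close> quantitatively, beyond absolute
  convergence of the product.\<close>

lemma hadamard_factorization_genus_0:
  fixes f :: "complex \<Rightarrow> complex"
  assumes f: "f holomorphic_on UNIV" and nz: "\<exists>z. f z \<noteq> 0"
    and \<lambda>: "exponent_of_convergence f < 1"
  obtains s b m h where "0 < s" "s < 1" "summable (\<lambda>n. norm (b n) powr s)"
    "h holomorphic_on UNIV" "\<And>z. f z = z ^ m * canonical_product b z * exp (h z)"
proof -
  define Z where "Z = {a. f a = 0 \<and> a \<noteq> 0}"
  obtain s where s: "0 < s" "s < 1"
    and sm: "(\<lambda>a. of_int (zorder f a) * norm a powr (-s)) summable_on Z"
    using \<lambda> unfolding exponent_of_convergence_def Inf_less_iff Z_def by auto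
  \<comment> \<open>One pair for each zero and each of its copies, which turns the multiplicity
    weights of the convergent sum into plain repetition.\<close>
  define J where "J = Sigma Z (\<lambda>a. {..<nat (zorder f a)})"
  have zo: "zorder f a > 0 \<longleftrightarrow> f a = 0" "zorder f a \<ge> 0" for a
    using entire_zorder_pos_iff[OF f nz] by auto
  have smJ: "(\<lambda>j. norm (fst j) powr (-s)) summable_on J"
    unfolding J_def
  proof (rule summable_on_SigmaI[OF _ sm])
    show "((\<lambda>y. norm (fst (x, y)) powr - s) has_sum of_int (zorder f x) * norm x powr - s)
        {..<nat (zorder f x)}" if "x \<in> Z" for x
      using has_sum_finite[of "{..<nat (zorder f x)}" "\<lambda>y. norm x powr - s"] zo(2)[of x] by simp
  qed auto
  have "countable Z"
  proof -
    have "countable {z\<in>UNIV. f z = 0}" if "\<not> f constant_on UNIV"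
      by (rule holomorphic_countable_zeros[OF f open_UNIV connected_UNIV _ that])
        simp
    moreover have "Z = {}" if "f constant_on UNIV"
      using that nz by (auto simp: Z_def constant_on_def)
    moreover have "Z \<subseteq> {z\<in>UNIV. f z = 0}"
      by (auto simp: Z_def)
    ultimately show ?thesis
      using countable_subset by (cases "f constant_on UNIV") (simp, blast)
  qed
  hence cJ: "countable J"
    by (auto simp: J_def)
  define e where "e = to_nat_on J"
  have inj: "inj_on e J"
    unfolding e_def by (rule inj_on_to_nat_on[OF cJ])
  define b where "b n = (if n \<in> e ` J then inverse (fst (from_nat_into J n)) else 0)" for n
  have b_e: "b (e j) = inverse (fst j)" if "j \<in> J" for j
    using that cJ by (auto simp: b_def e_def)
  have "(\<lambda>n. norm (b n) powr s) summable_on e ` J"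
  proof (subst summable_on_reindex[OF inj], rule summable_on_cong[THEN iffD2, OF _ smJ])
    show "((\<lambda>n. norm (b n) powr s) \<circ> e) j = norm (fst j) powr - s" if "j \<in> J" for j
      using b_e[OF that] by (simp add: norm_inverse powr_minus inverse_powr)
  qed
  also have "?this \<longleftrightarrow> (\<lambda>n. norm (b n) powr s) summable_on UNIV"
    by (rule summable_on_cong_neutral) (auto simp: b_def s)
  finally have sb: "summable (\<lambda>n. norm (b n) powr s)"
    by (rule summable_on_imp_summable)
  have sb1: "summable (\<lambda>n. norm (b n))"
    by (rule summable_norm_of_powr[OF s sb])
  have b1: "b n * a = 1 \<longleftrightarrow> n \<in> e ` ({a} \<times> {..<nat (zorder f a)})" if a: "a \<noteq> 0" for n a
  proof
    assume n: "b n * a = 1"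
    hence "b n \<noteq> 0"
      by auto
    then obtain j where j: "j \<in> J" "n = e j"
      by (auto simp: b_def split: if_splits)
    have "fst j \<noteq> 0"
      using j(1) by (auto simp: J_def Z_def)
    hence "fst j = a"
      using n b_e[OF j(1)] j(2) by (simp add: field_simps)
    thus "n \<in> e ` ({a} \<times> {..<nat (zorder f a)})"
      using j by (auto simp: J_def)
  next
    assume "n \<in> e ` ({a} \<times> {..<nat (zorder f a)})"
    then obtain i where i: "n = e (a, i)" "i < nat (zorder f a)"
      by auto
    hence "(a, i) \<in> J"
      using a zo(1)[of a] by (auto simp: J_def Z_def)
    thus "b n * a = 1"
      using b_e i a by auto
  qed
  define m where "m = nat (zorder f 0)"
  define g where "g = (\<lambda>z. z ^ m * canonical_product b z)"
  note cph = canonical_product_holomorphic[OF sb1]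
  have cpa: "canonical_product b analytic_on {a}" for a
    using cph[of UNIV] by (simp add: holomorphic_on_imp_analytic_at)
  have cp0: "canonical_product b 0 \<noteq> 0"
    by (simp add: canonical_product_eq_0_iff[OF sb1])
  have cpne: "\<exists>z. canonical_product b z \<noteq> 0"
    using cp0 by blast
  have cp_ev: "eventually (\<lambda>z. canonical_product b z \<noteq> 0) (at a)" for a
    using non_zero_neighbour_alt[OF cph open_UNIV connected_UNIV UNIV_I UNIV_I cp0, of a] by simp
  have zo_cp: "zorder (canonical_product b) a = zorder f a" if "a \<noteq> 0" for a
  proof -
    have "e ` ({a} \<times> {..<nat (zorder f a)}) = {n. b n * a = 1}"
      using b1[OF that] by auto
    moreover have "inj_on e ({a} \<times> {..<nat (zorder f a)})"
      by (rule inj_on_subset[OF inj]) (use that zo(1)[of a] in \<open>auto simp: J_def Z_def\<close>)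
    ultimately have "card {n. b n * a = 1} = nat (zorder f a)"
      using card_image by fastforce
    thus ?thesis
      using zo(2)[of a] by (simp add: zorder_canonical_product[OF sb1])
  qed
  have zo_g: "zorder g a = zorder f a" for a
  proof -
    have ev: "eventually (\<lambda>z. z ^ m * canonical_product b z \<noteq> 0) (at a)"
    proof -
      have "eventually (\<lambda>z::complex. z \<noteq> 0) (at a)"
        by (rule eventually_neq_at_within)
      thus ?thesis
        using cp_ev[of a] by eventually_elim simp
    qed
    have "zorder g a = zorder (\<lambda>z. z ^ m) a + zorder (canonical_product b) a"
      unfolding g_def by (rule zorder_times_analytic[OF _ cpa ev]) (intro analytic_intros)
    also have "\<dots> = zorder f a"
    proof (cases "a = 0")
      case True
      have "zorder (\<lambda>z::complex. z ^ m) 0 = int m"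
        by (rule zorder_eqI[of UNIV _ "\<lambda>_. 1"]) auto
      moreover have "zorder (canonical_product b) 0 = 0"
        by (rule zorder_eq_0I[OF cpa cp0])
      ultimately show ?thesis
        using True zo(2)[of 0] by (simp add: m_def)
    next
      case False
      have "zorder (\<lambda>z::complex. z ^ m) a = 0"
        by (rule zorder_eq_0I) (use False in \<open>auto intro!: analytic_intros\<close>)
      thus ?thesis
        using zo_cp[OF False] by simp
    qed
    finally show ?thesis .
  qed
  have g_hol: "g holomorphic_on UNIV"
    unfolding g_def by (intro holomorphic_intros cph)
  have g_nz: "\<exists>z. g z \<noteq> 0"
  proof -
    have "eventually (\<lambda>z::complex. z \<noteq> 0 \<and> canonical_product b z \<noteq> 0) (at 0)"
      using cp_ev[of 0] by (intro eventually_conj) (auto simp: eventually_neq_at_within)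
    from eventually_happens'[OF _ this] show ?thesis
      by (auto simp: g_def)
  qed
  have zero_g: "g z = 0 \<longleftrightarrow> f z = 0" for z
    using zo(1)[of z] entire_zorder_pos_iff(1)[OF g_hol g_nz, of z] zo_g[of z] by simp
  obtain q where q0: "q holomorphic_on UNIV" "\<And>z. z \<in> UNIV \<Longrightarrow> q z \<noteq> 0"
      "\<And>z. z \<in> UNIV \<Longrightarrow> f z = q z * g z"
  proof (rule holomorphic_zorder_factorization[OF f open_UNIV connected_UNIV g_hol])
    show "g z = 0 \<longleftrightarrow> f z = 0" "zorder g z = zorder f z" for z
      by (simp_all add: zero_g zo_g)
  qed (rule that; blast)
  have q: "q holomorphic_on UNIV" "\<And>z. q z \<noteq> 0" "\<And>z. f z = q z * g z"
    using q0 by simp_all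
  obtain h where h: "h holomorphic_on UNIV" "\<And>z. q z = exp (h z)"
  proof (rule contractible_imp_holomorphic_log[OF q(1) contractible_UNIV])
    show "q z \<noteq> 0" for z
      by (rule q(2))
  qed (rule that; simp)
  show thesis
    by (rule that[OF s sb h(1), of m]) (simp add: q(3) h(2) g_def mult_ac)
qed

section \<open>Higher derivatives of products of affine factors\<close>

text \<open>Leibniz's rule stops after two terms, as an affine factor has no second derivative. For
  \<open>j = 0\<close> the truncated \<open>j - 1\<close> does no harm, its coefficient being
  0.\<close>

lemma higher_deriv_affine_mult:
  fixes g :: "complex \<Rightarrow> complex"
  assumes "g holomorphic_on UNIV"
  shows "(deriv ^^ j) (\<lambda>w. (p + q * w) * g w) z =
    (p + q * z) * (deriv ^^ j) g z + of_nat j * q * (deriv ^^ (j - 1)) g z"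
proof (induction j arbitrary: z)
  case (Suc j)
  have d: "((deriv ^^ i) g has_field_derivative (deriv ^^ Suc i) g z) (at z)" for i
    using has_field_derivative_higher_deriv[OF assms open_UNIV UNIV_I] .
  have IH: "(deriv ^^ j) (\<lambda>w. (p + q * w) * g w) =
      (\<lambda>z. (p + q * z) * (deriv ^^ j) g z + of_nat j * q * (deriv ^^ (j - 1)) g z)"
    using Suc.IH by auto
  have "((\<lambda>z. (p + q * z) * (deriv ^^ j) g z + of_nat j * q * (deriv ^^ (j - 1)) g z)
      has_field_derivative ((p + q * z) * (deriv ^^ Suc j) g z + q * (deriv ^^ j) g z +
        of_nat j * q * (deriv ^^ Suc (j - 1)) g z)) (at z)"
    by (rule derivative_eq_intros d refl | simp)+
  hence "(deriv ^^ Suc j) (\<lambda>w. (p + q * w) * g w) z = (p + q * z) * (deriv ^^ Suc j) g z +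
      q * (deriv ^^ j) g z + of_nat j * q * (deriv ^^ Suc (j - 1)) g z"
    unfolding funpow.simps o_def IH by (rule DERIV_imp_deriv)
  also have "\<dots> = (p + q * z) * (deriv ^^ Suc j) g z + of_nat (Suc j) * q * (deriv ^^ (Suc j - 1)) g z"
    by (cases j) (simp_all add: algebra_simps)
  finally show ?case .
qed auto

text \<open>The first two terms of the binomial expansion, shaped like the two terms that Leibniz's
  rule leaves for an affine factor.\<close>

lemma power_add_ge_two_terms:
  fixes r x :: real
  assumes "r \<ge> 0" "x \<ge> 0"
  shows "r ^ j + of_nat j * x * r ^ (j - 1) \<le> (r + x) ^ j"
proof (induction j)
  case (Suc j)
  have "r ^ Suc j + of_nat (Suc j) * x * r ^ (Suc j - 1) \<le>
      (r + x) * (r ^ j + of_nat j * x * r ^ (j - 1))"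
    using assms by (cases j) (auto simp: algebra_simps intro!: mult_nonneg_nonneg)
  also have "\<dots> \<le> (r + x) * (r + x) ^ j"
    using assms by (intro mult_left_mono Suc.IH) auto
  finally show ?case
    by simp
qed auto

text \<open>
  The bound \<open>|g\<^sup>(\<^sup>j\<^sup>)| \<le> \<rho>\<^sup>j |g|\<close> is stable under multiplication by a linear factor \<open>L\<close>
  if \<open>|L'/L|\<close> is added to \<open>\<rho>\<close>, hence holds for products with \<open>\<rho>\<close> the sum of
  the \<open>|L'/L|\<close> of all factors.
\<close>

lemma norm_higher_deriv_affine_mult_le:
  fixes g :: "complex \<Rightarrow> complex"
  assumes g: "g holomorphic_on UNIV" and r: "r \<ge> 0" and L: "p + q * z \<noteq> 0"
    and bd: "\<And>j. norm ((deriv ^^ j) g z) \<le> r ^ j * norm (g z)"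
  shows "norm ((deriv ^^ j) (\<lambda>w. (p + q * w) * g w) z) \<le>
    (r + norm q / norm (p + q * z)) ^ j * norm ((p + q * z) * g z)"
proof -
  define x where "x = norm q / norm (p + q * z)"
  have "norm ((deriv ^^ j) (\<lambda>w. (p + q * w) * g w) z) \<le>
      norm (p + q * z) * norm ((deriv ^^ j) g z) + of_nat j * norm q * norm ((deriv ^^ (j - 1)) g z)"
    unfolding higher_deriv_affine_mult[OF g]
    by (rule order_trans[OF norm_triangle_ineq]) (simp add: norm_mult)
  also have "\<dots> \<le> norm (p + q * z) * (r ^ j * norm (g z)) + of_nat j * norm q * (r ^ (j - 1) * norm (g z))"
    by (intro add_mono mult_left_mono bd) auto
  also have "\<dots> = norm ((p + q * z) * g z) * (r ^ j + of_nat j * x * r ^ (j - 1))"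
  proof -
    have "norm q = norm (p + q * z) * x"
      using L by (simp add: x_def)
    thus ?thesis
      by (simp only: norm_mult) (simp add: algebra_simps)
  qed
  also have "\<dots> \<le> norm ((p + q * z) * g z) * (r + x) ^ j"
    by (intro mult_left_mono power_add_ge_two_terms r) (auto simp: x_def)
  finally show ?thesis
    by (simp add: x_def mult.commute)
qed

lemma norm_higher_deriv_power_le:
  fixes z :: complex
  assumes "z \<noteq> 0"
  shows "norm ((deriv ^^ j) (\<lambda>w. w ^ m) z) \<le> (real m / norm z) ^ j * norm (z ^ m)"
proof (induction m arbitrary: j)
  case 0
  show ?case by (cases j) auto
next
  case (Suc m)
  have "norm ((deriv ^^ j) (\<lambda>w. (0 + 1 * w) * w ^ m) z) \<le>
      (real m / norm z + norm (1::complex) / norm (0 + 1 * z)) ^ j * norm ((0 + 1 * z) * z ^ m)"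
    by (rule norm_higher_deriv_affine_mult_le) (use assms Suc.IH in \<open>auto intro!: holomorphic_intros\<close>)
  thus ?case
    by (simp add: add_divide_distrib add.commute)
qed

text \<open>Partial products are treated by adding one affine factor at a time; locally uniform
  convergence carries the bound, derivatives included, to the limit.\<close>

lemma norm_higher_deriv_canonical_product_le:
  fixes b :: "nat \<Rightarrow> complex" and z :: complex
  assumes b: "summable (\<lambda>n. norm (b n))" and z: "z \<noteq> 0" and nz: "\<And>n. b n * z \<noteq> 1"
    and sm: "summable (\<lambda>n. norm (b n) / norm (1 - b n * z))"
  shows "norm ((deriv ^^ j) (\<lambda>w. w ^ m * canonical_product b w) z) \<le>
    (real m / norm z + (\<Sum>n. norm (b n) / norm (1 - b n * z))) ^ j *
      norm (z ^ m * canonical_product b z)"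
proof -
  define \<rho> where "\<rho> = real m / norm z + (\<Sum>n. norm (b n) / norm (1 - b n * z))"
  define P where "P N w = w ^ m * (\<Prod>n<N. 1 - b n * w)" for N w
  have P_hol: "P N holomorphic_on A" for N A
    unfolding P_def by (intro holomorphic_intros)
  have P_bd: "norm ((deriv ^^ j) (P N) z) \<le>
      (real m / norm z + (\<Sum>n<N. norm (b n) / norm (1 - b n * z))) ^ j * norm (P N z)" for N j
  proof (induction N arbitrary: j)
    case 0
    thus ?case
      using norm_higher_deriv_power_le[OF z, of j m] by (simp add: P_def)
  next
    case (Suc N)
    have eq: "P (Suc N) = (\<lambda>w. (1 + (- b N) * w) * P N w)"
      by (auto simp: P_def mult_ac)
    have "norm ((deriv ^^ j) (\<lambda>w. (1 + (- b N) * w) * P N w) z) \<le>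
      (real m / norm z + (\<Sum>n<N. norm (b n) / norm (1 - b n * z)) +
        norm (- b N) / norm (1 + (- b N) * z)) ^ j * norm ((1 + (- b N) * z) * P N z)"
      by (rule norm_higher_deriv_affine_mult_le[OF P_hol _ _ Suc.IH])
        (use nz[of N] in \<open>auto intro!: add_nonneg_nonneg sum_nonneg\<close>)
    thus ?case
      unfolding eq by (simp add: add.assoc)
  qed
  have bd: "norm ((deriv ^^ j) (P N) z) \<le> \<rho> ^ j * norm (P N z)" for N
  proof (rule order_trans[OF P_bd], intro mult_right_mono power_mono)
    show "real m / norm z + (\<Sum>n<N. norm (b n) / norm (1 - b n * z)) \<le> \<rho>"
      unfolding \<rho>_def by (intro add_left_mono sum_le_suminf sm) auto
  qed (auto intro!: add_nonneg_nonneg sum_nonneg)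
  define R where "R = norm z + 1"
  have lim: "uniform_limit (ball 0 R) P (\<lambda>w. w ^ m * canonical_product b w) sequentially"
  proof -
    have "uniform_limit (cball 0 R) (\<lambda>N w. w ^ m * (\<Prod>n<N. 1 - b n * w))
        (\<lambda>w. w ^ m * canonical_product b w) sequentially"
    proof (rule uniform_lim_mult[OF uniform_limit_const canonical_product_uniform_limit[OF b]])
      show "bounded ((\<lambda>w::complex. w ^ m) ` cball 0 R)"
        by (intro compact_imp_bounded compact_continuous_image continuous_intros) auto
      show "bounded (canonical_product b ` cball 0 R)"
        by (intro compact_imp_bounded compact_continuous_image
            holomorphic_on_imp_continuous_on canonical_product_holomorphic[OF b]) auto
    qed
    thus ?thesis
      unfolding P_def[abs_def] by (rule uniform_limit_on_subset) auto
  qed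
  have zR: "z \<in> ball 0 R"
    by (auto simp: R_def)
  have "(\<lambda>N. (deriv ^^ j) (P N) z) \<longlonglongrightarrow> (deriv ^^ j) (\<lambda>w. w ^ m * canonical_product b w) z"
    by (rule higher_deriv_complex_uniform_limit[OF lim])
      (use zR in \<open>auto intro!: always_eventually P_hol\<close>)
  moreover have "(\<lambda>N. P N z) \<longlonglongrightarrow> z ^ m * canonical_product b z"
    by (rule tendsto_uniform_limitI[OF lim zR])
  ultimately have "norm ((deriv ^^ j) (\<lambda>w. w ^ m * canonical_product b w) z) \<le>
      \<rho> ^ j * norm (z ^ m * canonical_product b z)"
    by (intro tendsto_le[OF sequentially_bot tendsto_mult_left[OF tendsto_norm] tendsto_norm])
      (auto intro!: always_eventually bd)
  thus ?thesis
    by (simp add: \<rho>_def)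
qed

subsection \<open>Functions of exponential type in sectors\<close>

lemma abs_Arg_le_arctan:
  assumes "u \<noteq> 0" "\<eta> > 0" "Re u \<ge> \<eta> * \<bar>Im u\<bar>"
  shows "Re u > 0" and "\<bar>Arg u\<bar> \<le> arctan (1 / \<eta>)"
proof -
  show pos: "Re u > 0"
  proof (rule ccontr)
    assume "\<not> Re u > 0"
    moreover have "\<eta> * \<bar>Im u\<bar> \<ge> 0"
      using assms by simp
    ultimately have "Re u = 0" "\<eta> * \<bar>Im u\<bar> = 0"
      using assms by linarith+
    thus False
      using assms by (auto simp: complex_eq_iff)
  qed
  have "Arg u = arctan (Im u / Re u)"
    using pos by (rule arg_conv_arctan)
  also have "\<bar>\<dots>\<bar> \<le> arctan (1 / \<eta>)"
  proof -
    have "\<bar>Im u / Re u\<bar> \<le> 1 / \<eta>"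
      using pos assms by (simp add: field_simps)
    hence "Im u / Re u \<le> 1 / \<eta>" "- (1 / \<eta>) \<le> Im u / Re u"
      unfolding abs_le_iff by linarith+
    hence "arctan (Im u / Re u) \<le> arctan (1 / \<eta>)" "arctan (- (1 / \<eta>)) \<le> arctan (Im u / Re u)"
      by (auto intro!: arctan_monotone')
    thus ?thesis
      by (simp add: arctan_minus abs_le_iff)
  qed
  finally show "\<bar>Arg u\<bar> \<le> arctan (1 / \<eta>)" .
qed

text \<open>
  Phragmen--Lindelof for exponential type in a sector of opening less than \<open>\<pi>\<close>: the auxiliary
  factor \<open>exp (- \<delta> (- \<i> w)\<^sup>a)\<close> with \<open>a > 1\<close> beats \<open>exp (C |w|)\<close>.
\<close>

lemma phragmen_lindelof_upper_sector:
  fixes g :: "complex \<Rightarrow> complex"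
  assumes g: "g holomorphic_on UNIV" and type: "\<And>w. norm (g w) \<le> C * exp (C * norm w)"
    and \<eta>: "\<eta> > 0" and R: "R > 0" and B: "B > 0"
    and inner: "\<And>w. norm w \<le> R \<Longrightarrow> norm (g w) \<le> B"
    and rays: "\<And>w. Im w = \<eta> * \<bar>Re w\<bar> \<Longrightarrow> norm w \<ge> R \<Longrightarrow> norm (g w) \<le> B"
    and w0: "Im w0 \<ge> \<eta> * \<bar>Re w0\<bar>"
  shows "norm (g w0) \<le> B"
proof (cases "Im w0 = \<eta> * \<bar>Re w0\<bar> \<or> norm w0 \<le> R")
  case True
  thus ?thesis
    using rays[of w0] inner[of w0] by linarith
next
  case False
  define \<phi> where "\<phi> = arctan (1 / \<eta>)"
  have \<phi>: "0 < \<phi>" "\<phi> < pi / 2"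
    using \<eta> arctan_ubound by (auto simp: \<phi>_def)
  \<comment> \<open>The mean of 1 and \<open>pi / (2 * \<phi>)\<close>: being above 1 it makes |w|^a
    beat |w|, and being below \<open>pi / (2 * \<phi>)\<close> it keeps Re (u w) positive up to the
    boundary rays of the sector.\<close>
  define a where "a = (1 + pi / (2 * \<phi>)) / 2"
  have a: "a > 1"
    using \<phi> by (simp add: a_def field_simps)
  have a\<phi>: "a * \<phi> = (\<phi> + pi / 2) / 2"
    using \<phi> by (simp add: a_def field_simps)
  define c where "c = cos (a * \<phi>)"
  have c: "c > 0"
    unfolding c_def a\<phi> using \<phi> by (intro cos_gt_zero_pi) auto
  \<comment> \<open>Multiplication by -i turns the sector into the one of half-opening
    \<open>\<phi>\<close> around the positive real axis, where the principal logarithm is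
    available.\<close>
  define u where "u w = exp (of_real a * Ln (- \<i> * w))" for w
  define T where "T = {w. Im w \<ge> \<eta> * \<bar>Re w\<bar> \<and> w \<noteq> 0}"
  have T_pos: "Im w > 0" "Re (u w) \<ge> c * norm w powr a" if "w \<in> T" for w
  proof -
    have w: "- \<i> * w \<noteq> 0" "Re (- \<i> * w) \<ge> \<eta> * \<bar>Im (- \<i> * w)\<bar>"
      using that by (auto simp: T_def)
    show "Im w > 0"
      using abs_Arg_le_arctan(1)[OF w(1) \<eta> w(2)] by simp
    define \<theta> where "\<theta> = Arg (- \<i> * w)"
    have \<theta>: "\<bar>\<theta>\<bar> \<le> \<phi>"
      using abs_Arg_le_arctan(2)[OF w(1) \<eta> w(2)] by (simp add: \<theta>_def \<phi>_def)
    have "Re (u w) = exp (a * ln (norm w)) * cos (a * \<theta>)"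
      using w(1) by (simp add: u_def Re_exp Arg_eq_Im_Ln[symmetric] \<theta>_def norm_mult)
    also have "exp (a * ln (norm w)) = norm w powr a"
      using w(1) by (simp add: powr_def)
    also have "cos (a * \<theta>) = cos (a * \<bar>\<theta>\<bar>)"
      by (simp add: abs_if)
    also have "norm w powr a * cos (a * \<bar>\<theta>\<bar>) \<ge> norm w powr a * c"
    proof (rule mult_left_mono)
      have "a * \<bar>\<theta>\<bar> \<le> a * \<phi>"
        using a \<theta> by (intro mult_left_mono) auto
      moreover have "a * \<phi> \<le> pi"
        unfolding a\<phi> using \<phi> by simp
      ultimately show "c \<le> cos (a * \<bar>\<theta>\<bar>)"
        unfolding c_def using a by (intro cos_monotone_0_pi_le) auto
    qed auto
    finally show "Re (u w) \<ge> c * norm w powr a"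
      by (simp add: mult.commute)
  qed
  have u_hol: "u holomorphic_on {w. Im w > 0}"
    unfolding u_def by (intro holomorphic_intros) (auto simp: complex_nonpos_Reals_iff)
  have w0T: "w0 \<in> T"
    using False w0 R by (auto simp: T_def)
  have key: "norm (g w0) * exp (- \<delta> * Re (u w0)) \<le> B" if \<delta>: "\<delta> > 0" for \<delta>
  proof -
    have "((\<lambda>\<rho>::real. C * exp (C * \<rho> - \<delta> * c * \<rho> powr a)) \<longlongrightarrow> 0) at_top"
    proof -
      define K where "K = \<delta> * c"
      have K: "K > 0"
        using \<delta> c by (simp add: K_def)
      have "0 \<le> C * exp (C * norm (0::complex))"
        using type[of 0] norm_ge_zero by (rule order_trans[rotated])
      hence "C = 0 \<or> C > 0"
        by auto
      hence "((\<lambda>\<rho>::real. C * exp (C * \<rho> - K * \<rho> powr a)) \<longlongrightarrow> 0) at_top"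
      proof
        assume "C > 0"
        thus ?thesis
          using a K by real_asymp
      qed simp
      thus ?thesis
        by (simp add: K_def)
    qed
    hence "eventually (\<lambda>\<rho>. C * exp (C * \<rho> - \<delta> * c * \<rho> powr a) < B) at_top"
      using B by (rule order_tendstoD)
    moreover have "eventually (\<lambda>\<rho>. \<rho> > norm w0) at_top"
      by (rule eventually_gt_at_top)
    ultimately have "eventually (\<lambda>\<rho>. C * exp (C * \<rho> - \<delta> * c * \<rho> powr a) < B \<and> \<rho> > norm w0) at_top"
      by (rule eventually_conj)
    then obtain \<rho> where \<rho>: "C * exp (C * \<rho> - \<delta> * c * \<rho> powr a) < B" "\<rho> > norm w0"
      using eventually_happens'[OF trivial_limit_at_top_linorder] by blast
    define S where "S = {w. Im w > \<eta> * \<bar>Re w\<bar>} \<inter> {w. R < norm w} \<inter> {w. norm w < \<rho>}"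
    define S' where "S' = {w. Im w \<ge> \<eta> * \<bar>Re w\<bar>} \<inter> {w. R \<le> norm w} \<inter> {w. norm w \<le> \<rho>}"
    have "open S"
      unfolding S_def by (intro open_Int open_Collect_less continuous_intros)
    have "closed S'"
      unfolding S'_def by (intro closed_Int closed_Collect_le continuous_intros)
    moreover have "S \<subseteq> S'"
      by (auto simp: S_def S'_def)
    ultimately have cl: "closure S \<subseteq> S'"
      by (rule closure_minimal[rotated])
    have S'T: "S' \<subseteq> T"
      using R by (auto simp: S'_def T_def)
    have S'up: "S' \<subseteq> {w. Im w > 0}"
      using S'T T_pos(1) by auto
    define F where "F w = g w * exp (- of_real \<delta> * u w)" for w
    have F_hol: "F holomorphic_on {w. Im w > 0}"
      unfolding F_def by (intro holomorphic_intros holomorphic_on_subset[OF g] u_hol) auto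
    have F_norm: "norm (F w) = norm (g w) * exp (- \<delta> * Re (u w))" for w
      by (simp add: F_def norm_mult norm_exp_eq_Re)
    have F_le: "norm (F w) \<le> norm (g w) * exp (- \<delta> * (c * norm w powr a))" if "w \<in> T" for w
      unfolding F_norm using T_pos(2)[OF that] \<delta> by (auto intro!: mult_left_mono)
    have F_le_g: "norm (F w) \<le> norm (g w)" if "w \<in> T" for w
    proof -
      have "norm (g w) * exp (- \<delta> * (c * norm w powr a)) \<le> norm (g w) * 1"
        using \<delta> c by (intro mult_left_mono) auto
      thus ?thesis
        using F_le[OF that] by simp
    qed
    have "norm (F w0) \<le> B"
    proof (rule maximum_modulus_frontier[of F S])
      show "F holomorphic_on interior S"
        using F_hol S'up \<open>S \<subseteq> S'\<close> interior_subset by (meson holomorphic_on_subset order_trans)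
      show "continuous_on (closure S) F"
        using F_hol S'up cl by (meson holomorphic_on_imp_continuous_on continuous_on_subset order_trans)
      show "bounded S"
        by (rule bounded_subset[of "ball 0 \<rho>"]) (auto simp: S_def)
      show "w0 \<in> S"
        using False w0 \<rho>(2) by (auto simp: S_def)
      fix w assume "w \<in> frontier S"
      hence w: "w \<in> S'" "w \<notin> S"
        using cl \<open>open S\<close> by (auto simp: frontier_def interior_open)
      hence wT: "w \<in> T"
        using S'T by auto
      consider "Im w = \<eta> * \<bar>Re w\<bar>" "norm w \<ge> R" | "norm w = R" | "norm w = \<rho>"
        using w by (auto simp: S_def S'_def)
      thus "norm (F w) \<le> B"
      proof cases
        case 1
        thus ?thesis
          using F_le_g[OF wT] rays[of w] by simp
      next
        case 2
        thus ?thesis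
          using F_le_g[OF wT] inner[of w] by simp
      next
        case 3
        have "norm (F w) \<le> (C * exp (C * norm w)) * exp (- \<delta> * (c * norm w powr a))"
          using F_le[OF wT] type[of w] by (meson exp_ge_zero mult_right_mono order_trans)
        also have "\<dots> = C * exp (C * \<rho> - \<delta> * c * \<rho> powr a)"
          using 3 by (simp add: exp_diff exp_minus divide_inverse mult_ac)
        finally show ?thesis
          using \<rho>(1) by simp
      qed
    qed
    thus ?thesis
      by (simp add: F_norm)
  qed
  \<comment> \<open>The bound \<open>B\<close> does not depend on \<open>\<delta>\<close>, so the
    auxiliary factor disappears in the limit at the fixed point \<open>w0\<close>.\<close>
  have "((\<lambda>\<delta>. norm (g w0) * exp (- \<delta> * Re (u w0))) \<longlongrightarrow> norm (g w0) * exp (- 0 * Re (u w0))) (at_right 0)"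
    by (intro tendsto_intros)
  hence "((\<lambda>\<delta>. norm (g w0) * exp (- \<delta> * Re (u w0))) \<longlongrightarrow> norm (g w0)) (at_right 0)"
    by simp
  thus ?thesis
    by (rule tendsto_upperbound) (use key in \<open>auto intro!: eventually_at_rightI[of 0 1]\<close>)
qed

text \<open>The filter of truncated open sectors around the ray in direction \<open>d\<close>.\<close>

definition conic :: "complex \<Rightarrow> complex filter" where
  "conic d = inf at_infinity (filtercomap sgn (nhds d))"

lemma conic_le_at_infinity: "conic d \<le> at_infinity"
  by (simp add: conic_def)

lemma tendsto_sgn_conic: "(sgn \<longlongrightarrow> d) (conic d)"
  unfolding conic_def by (rule tendsto_mono[OF inf_le2]) (rule filterlim_filtercomap)

lemma filterlim_norm_conic: "filterlim norm at_top (conic d)"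
  by (rule filterlim_mono[OF filterlim_at_infinity_imp_norm_at_top[OF filterlim_ident] order_refl
        conic_le_at_infinity])

lemma tendsto_exp_decay_conic:
  fixes K q :: real
  assumes "q > 0"
  shows "((\<lambda>z. K * exp (- q * norm z)) \<longlongrightarrow> 0) (conic d)"
proof (rule filterlim_compose[OF _ filterlim_norm_conic])
  show "((\<lambda>x::real. K * exp (- q * x)) \<longlongrightarrow> 0) at_top"
    using assms by real_asymp
qed

lemma eventually_norm_conic: "eventually (\<lambda>z. norm z > R) (conic d)"
  using filterlim_norm_conic by (simp add: filterlim_at_top_dense)

text \<open>The ray through \<open>d\<close> lies eventually in every truncated sector. This shows
  that the filter is proper and allows limits to be tested along a single ray.\<close>

lemma filterlim_ray_conic:
  assumes "norm d = 1"
  shows "filterlim (\<lambda>t. of_real t * d) (conic d) at_top"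
  unfolding conic_def filterlim_inf filterlim_filtercomap_iff
proof
  show "filterlim (\<lambda>t. of_real t * d) at_infinity at_top"
    unfolding filterlim_at_infinity[OF order_refl]
  proof (intro allI impI)
    fix r :: real
    show "\<forall>\<^sub>F t in at_top. r \<le> norm (of_real t * d)"
      by (rule eventually_mono[OF eventually_ge_at_top[of r]]) (simp add: norm_mult assms)
  qed
  show "((sgn \<circ> (\<lambda>t. of_real t * d)) \<longlongrightarrow> d) at_top"
  proof (rule tendsto_eventually)
    show "\<forall>\<^sub>F t in at_top. (sgn \<circ> (\<lambda>t. of_real t * d)) t = d"
      by (rule eventually_mono[OF eventually_gt_at_top[of 0]]) (simp add: sgn_eq norm_mult assms)
  qed
qed

lemma conic_neq_bot:
  assumes "norm d = 1"
  shows "conic d \<noteq> bot"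
proof
  assume "conic d = bot"
  hence "eventually (\<lambda>_. False) (conic d)"
    by simp
  hence "eventually (\<lambda>_::real. False) at_top"
    using filterlim_ray_conic[OF assms] unfolding filterlim_iff by blast
  thus False
    by simp
qed

lemma eventually_conic:
  "eventually P (conic d) \<longleftrightarrow>
    (\<exists>\<epsilon>>0. \<exists>R>0. \<forall>z. norm z \<ge> R \<and> norm (sgn z - d) \<le> \<epsilon> \<longrightarrow> P z)"
proof
  assume "eventually P (conic d)"
  then obtain Q T where Q: "eventually Q at_infinity" and T: "eventually T (nhds d)"
    and imp: "\<And>z. Q z \<Longrightarrow> T (sgn z) \<Longrightarrow> P z"
    unfolding conic_def eventually_inf eventually_filtercomap by blast
  obtain R where R: "R > 0" "\<And>z. norm z \<ge> R \<Longrightarrow> Q z"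
    using Q by (auto simp: eventually_at_infinity_pos)
  obtain e where e: "e > 0" "\<And>y. dist y d < e \<Longrightarrow> T y"
    using T by (auto simp: eventually_nhds_metric)
  show "\<exists>\<epsilon>>0. \<exists>R>0. \<forall>z. norm z \<ge> R \<and> norm (sgn z - d) \<le> \<epsilon> \<longrightarrow> P z"
    by (rule exI[of _ "e / 2"], rule conjI, use e in simp, rule exI[of _ R])
      (use e R imp in \<open>auto simp: dist_norm\<close>)
next
  assume "\<exists>\<epsilon>>0. \<exists>R>0. \<forall>z. norm z \<ge> R \<and> norm (sgn z - d) \<le> \<epsilon> \<longrightarrow> P z"
  then obtain \<epsilon> R where *: "\<epsilon> > 0" "R > 0" "\<And>z. norm z \<ge> R \<Longrightarrow> norm (sgn z - d) \<le> \<epsilon> \<Longrightarrow> P z"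
    by blast
  have "eventually (\<lambda>z. dist (sgn z) d < \<epsilon>) (conic d)"
    using tendstoD[OF tendsto_sgn_conic *(1)] .
  with eventually_norm_conic[of R d] show "eventually P (conic d)"
    by eventually_elim (auto intro!: *(3) simp: dist_norm)
qed

lemma norm_sgn_diff_le:
  fixes z w :: complex
  assumes "z \<noteq> 0" "w \<noteq> 0"
  shows "norm (sgn w - sgn z) \<le> 2 * norm (w - z) / norm z"
proof -
  have "(sgn w - sgn z) * of_real (norm z) = (w - z) + sgn w * of_real (norm z - norm w)"
    using assms by (simp add: sgn_eq field_simps)
  hence "norm (sgn w - sgn z) * norm z = norm ((w - z) + sgn w * of_real (norm z - norm w))"
    by (metis norm_mult norm_of_real abs_norm_cancel)
  also have "\<dots> \<le> norm (w - z) + norm (sgn w) * \<bar>norm z - norm w\<bar>"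
    by (rule order_trans[OF norm_triangle_ineq]) (simp add: norm_mult flip: of_real_diff)
  also have "\<dots> \<le> norm (w - z) + norm (w - z)"
    using assms norm_triangle_ineq3[of z w] by (simp add: norm_sgn norm_minus_commute)
  finally show ?thesis
    using assms by (simp add: field_simps)
qed

text \<open>A thinner sector leaves room for discs whose radius is proportional to |z|, as the
  estimates on growing discs require.\<close>

lemma eventually_conic_cball:
  assumes "eventually P (conic d)"
  obtains \<eta> where "\<eta> > 0" "\<eta> < 1"
    "eventually (\<lambda>z. \<forall>w. norm (w - z) \<le> \<eta> * norm z \<longrightarrow> P w) (conic d)"
proof -
  obtain \<epsilon> R where *: "\<epsilon> > 0" "R > 0" "\<And>z. norm z \<ge> R \<Longrightarrow> norm (sgn z - d) \<le> \<epsilon> \<Longrightarrow> P z"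
    using assms unfolding eventually_conic by blast
  \<comment> \<open>The bound 1/2 keeps |w| at least half of |z|. Directions change by at most
    \<open>2 * \<eta>\<close>, so \<open>\<epsilon> / 4\<close> uses up only half of the
    opening.\<close>
  define \<eta> where "\<eta> = min (1 / 2) (\<epsilon> / 4)"
  have \<eta>: "\<eta> > 0" "\<eta> \<le> 1 / 2" "\<eta> \<le> \<epsilon> / 4"
    using * by (auto simp: \<eta>_def)
  have "eventually (\<lambda>z. \<forall>w. norm (w - z) \<le> \<eta> * norm z \<longrightarrow> P w) (conic d)"
    unfolding eventually_conic
  proof (rule exI[of _ "\<epsilon> / 2"], rule conjI, use * in simp, rule exI[of _ "2 * R"], safe)
    fix z w assume z: "norm z \<ge> 2 * R" "norm (sgn z - d) \<le> \<epsilon> / 2" and w: "norm (w - z) \<le> \<eta> * norm z"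
    have "\<eta> * norm z \<le> 1 / 2 * norm z"
      using \<eta> by (intro mult_right_mono) auto
    moreover have "norm z - norm w \<le> norm (w - z)"
      by (metis norm_minus_commute norm_triangle_ineq2)
    ultimately have wR: "norm w \<ge> R"
      using z w by simp
    have nz: "z \<noteq> 0" "w \<noteq> 0"
      using z wR * by auto
    have "norm (sgn w - sgn z) \<le> 2 * norm (w - z) / norm z"
      by (rule norm_sgn_diff_le[OF nz])
    also have "\<dots> \<le> 2 * \<eta>"
      using w nz by (simp add: field_simps)
    finally have "norm (sgn w - sgn z) \<le> \<epsilon> / 2"
      using \<eta> by simp
    hence "norm (sgn w - d) \<le> \<epsilon>"
      using z norm_triangle_ineq[of "sgn w - sgn z" "sgn z - d"] by simp
    thus "P w"
      using * wR by blast
  qed (use * in auto)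
  thus ?thesis
    using that \<eta> by fastforce
qed

lemma norm_sgn_minus_one_le:
  assumes "Re w > 0"
  shows "norm (sgn w - 1) \<le> 2 * \<bar>Im w\<bar> / Re w"
proof -
  have "norm (sgn w - sgn (of_real (Re w))) \<le> 2 * norm (w - of_real (Re w)) / norm (of_real (Re w) :: complex)"
    using assms by (intro norm_sgn_diff_le) (auto simp: complex_eq_iff)
  also have "w - of_real (Re w) = \<i> * of_real (Im w)"
    by (simp add: complex_eq_iff)
  finally show ?thesis
    using assms by (simp add: norm_mult sgn_of_real)
qed

lemma eventually_conic_cone:
  assumes "eventually P (conic d)" and d: "norm d = 1"
  obtains \<epsilon> R where "\<epsilon> > 0" "R > 0"
    "\<And>w. Re w \<ge> R \<Longrightarrow> \<bar>Im w\<bar> \<le> \<epsilon> * Re w \<Longrightarrow> P (w * d)"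
proof -
  obtain \<epsilon> R where *: "\<epsilon> > 0" "R > 0" "\<And>z. norm z \<ge> R \<Longrightarrow> norm (sgn z - d) \<le> \<epsilon> \<Longrightarrow> P z"
    using assms unfolding eventually_conic by blast
  show ?thesis
  proof (rule that[of "\<epsilon> / 2" R])
    fix w assume w: "Re w \<ge> R" "\<bar>Im w\<bar> \<le> \<epsilon> / 2 * Re w"
    have pos: "Re w > 0"
      using w * by simp
    have "norm w \<ge> R"
      using w(1) complex_Re_le_cmod[of w] by linarith
    moreover have "sgn (w * d) = sgn w * d"
      using d by (simp add: sgn_eq norm_mult)
    hence "norm (sgn (w * d) - d) = norm (sgn w - 1)"
      using d by (metis left_diff_distrib mult.right_neutral mult_1 norm_mult)
    moreover have "2 * \<bar>Im w\<bar> / Re w \<le> \<epsilon>"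
      using w(2) pos by (simp add: pos_divide_le_eq)
    hence "norm (sgn w - 1) \<le> \<epsilon>"
      using norm_sgn_minus_one_le[OF pos] by linarith
    ultimately show "P (w * d)"
      using *(3)[of "w * d"] d by (simp add: norm_mult)
  qed (use * in auto)
qed

lemma eventually_norm_exp_conic_le:
  assumes "Re (\<omega> * d) < c"
  shows "eventually (\<lambda>z. norm (exp (\<omega> * z)) \<le> exp (c * norm z)) (conic d)"
proof -
  have "((\<lambda>z. Re (\<omega> * sgn z)) \<longlongrightarrow> Re (\<omega> * d)) (conic d)"
    by (intro tendsto_intros tendsto_sgn_conic)
  hence "eventually (\<lambda>z. Re (\<omega> * sgn z) < c) (conic d)"
    using assms by (rule order_tendstoD)
  thus ?thesis
  proof (rule eventually_mono)
    fix z assume *: "Re (\<omega> * sgn z) < c"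
    have "\<omega> * z = of_real (norm z) * (\<omega> * sgn z)"
      by (cases "z = 0") (auto simp: sgn_eq)
    hence "Re (\<omega> * z) = norm z * Re (\<omega> * sgn z)"
      by (simp only: Re_complex_of_real Im_complex_of_real times_complex.sel)
    also have "\<dots> \<le> norm z * c"
      using * by (intro mult_left_mono) auto
    finally show "norm (exp (\<omega> * z)) \<le> exp (c * norm z)"
      by (simp add: mult.commute)
  qed
qed

lemma eventually_norm_exp_conic_ge:
  assumes "Re (\<omega> * d) > c"
  shows "eventually (\<lambda>z. norm (exp (\<omega> * z)) \<ge> exp (c * norm z)) (conic d)"
proof -
  have "eventually (\<lambda>z. norm (exp (- \<omega> * z)) \<le> exp (- c * norm z)) (conic d)"
    by (rule eventually_norm_exp_conic_le) (use assms in simp)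
  thus ?thesis
    by (rule eventually_mono) simp
qed

text \<open>After rotation by \<open>d\<close>, the two given sectors contain, outside a disc, a
  double cone |Im w| \<le> \<eta> |Re w|. What remains are two sectors of opening less than \<pi>
  whose boundary rays lie in that cone, so Phragmen-Lindelof and Liouville finish.\<close>

lemma exp_type_bounded_conic_imp_const:
  fixes g :: "complex \<Rightarrow> complex"
  assumes g: "g holomorphic_on UNIV" and type: "\<And>z. norm (g z) \<le> C * exp (C * norm z)"
    and d: "norm d = 1"
    and pos: "eventually (\<lambda>z. norm (g z) \<le> B1) (conic d)"
    and neg: "eventually (\<lambda>z. norm (g z) \<le> B2) (conic (- d))"
  obtains a where "\<And>z. g z = a"
proof -
  obtain e1 R1 where 1: "e1 > 0" "R1 > 0"
    "\<And>w. Re w \<ge> R1 \<Longrightarrow> \<bar>Im w\<bar> \<le> e1 * Re w \<Longrightarrow> norm (g (w * d)) \<le> B1"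
    using eventually_conic_cone[OF pos d] by blast
  obtain e2 R2 where 2: "e2 > 0" "R2 > 0"
    "\<And>w. Re w \<ge> R2 \<Longrightarrow> \<bar>Im w\<bar> \<le> e2 * Re w \<Longrightarrow> norm (g (w * (- d))) \<le> B2"
    using eventually_conic_cone[OF neg] d by (metis norm_minus_cancel)
  define \<eta> where "\<eta> = min e1 e2"
  have \<eta>: "\<eta> > 0" "\<eta> \<le> e1" "\<eta> \<le> e2"
    using 1 2 by (auto simp: \<eta>_def)
  \<comment> \<open>In the cone |w| is at most (1 + \<eta>) |Re w|, so |w| \<ge> R pushes |Re w|
    beyond both thresholds.\<close>
  define R where "R = (1 + \<eta>) * max R1 R2"
  have R: "R > 0"
    using 1 2 \<eta> by (auto simp: R_def intro!: mult_pos_pos)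
  have "compact (g ` cball 0 R)"
    by (intro compact_continuous_image holomorphic_on_imp_continuous_on holomorphic_on_subset[OF g]) auto
  then obtain B0 where B0: "\<And>z. norm z \<le> R \<Longrightarrow> norm (g z) \<le> B0"
    by (meson bounded_iff compact_imp_bounded imageI mem_cball_0)
  define B where "B = max 1 (max B0 (max B1 B2))"
  have cone: "norm (g (w * d)) \<le> B" if w: "\<bar>Im w\<bar> \<le> \<eta> * \<bar>Re w\<bar>" "norm w \<ge> R" for w
  proof -
    have "norm w \<le> \<bar>Re w\<bar> + \<bar>Im w\<bar>"
      by (rule cmod_le)
    also have "\<dots> \<le> (1 + \<eta>) * \<bar>Re w\<bar>"
      using w by (simp add: algebra_simps)
    finally have Re: "max R1 R2 \<le> \<bar>Re w\<bar>"
      using w(2) \<eta> mult_le_cancel_left_pos[of "1 + \<eta>" "max R1 R2" "\<bar>Re w\<bar>"]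
      unfolding R_def by linarith
    show ?thesis
    proof (cases "Re w > 0")
      case True
      have "\<eta> * \<bar>Re w\<bar> \<le> e1 * Re w"
        using True \<eta> by (simp add: mult_right_mono)
      hence "\<bar>Im w\<bar> \<le> e1 * Re w"
        using w(1) by linarith
      thus ?thesis
        using 1(3)[of w] True Re by (auto simp: B_def)
    next
      case False
      have "\<eta> * \<bar>Re w\<bar> \<le> e2 * Re (- w)"
        using False \<eta> by (simp add: mult_right_mono_neg)
      hence "\<bar>Im (- w)\<bar> \<le> e2 * Re (- w)"
        using w(1) by simp
      thus ?thesis
        using 2(3)[of "- w"] False Re by (auto simp: B_def)
    qed
  qed
  have hol: "(\<lambda>w. g (w * e)) holomorphic_on UNIV" for e
    by (rule holomorphic_on_compose[OF _ holomorphic_on_subset[OF g], unfolded o_def])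
      (auto intro!: holomorphic_intros)
  \<comment> \<open>The choice \<open>e = - d\<close> rotates the lower sector onto the upper one,
    so one statement serves both.\<close>
  have up: "norm (g (w * e)) \<le> B" if "Im w \<ge> \<eta> * \<bar>Re w\<bar>" "e = d \<or> e = - d" for w e
  proof (rule phragmen_lindelof_upper_sector[OF hol _ \<eta>(1) R _ _ _ that(1)])
    have ne: "norm e = 1"
      using that(2) d by auto
    show "norm (g (w * e)) \<le> C * exp (C * norm w)" for w
      using type[of "w * e"] by (simp add: norm_mult ne)
    show "B > 0"
      by (simp add: B_def)
    show "norm (g (w * e)) \<le> B" if "norm w \<le> R" for w
      using B0[of "w * e"] that by (simp add: norm_mult ne B_def)
    show "norm (g (w * e)) \<le> B" if "Im w = \<eta> * \<bar>Re w\<bar>" "norm w \<ge> R" for w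
    proof -
      have "\<bar>Im w\<bar> \<le> \<eta> * \<bar>Re w\<bar>"
        using that \<eta> by simp
      thus ?thesis
        using cone[of w] cone[of "- w"] that \<open>e = d \<or> e = - d\<close> by auto
    qed
  qed
  have all: "norm (g (w * d)) \<le> B" for w
  proof -
    consider "Im w \<ge> \<eta> * \<bar>Re w\<bar>" | "Im (- w) \<ge> \<eta> * \<bar>Re (- w)\<bar>" | "\<bar>Im w\<bar> \<le> \<eta> * \<bar>Re w\<bar>"
      by (simp, linarith)
    thus ?thesis
    proof cases
      case 3
      show ?thesis
      proof (cases "norm w \<le> R")
        case True
        thus ?thesis
          using B0[of "w * d"] d by (simp add: norm_mult B_def)
      next
        case False
        thus ?thesis
          using cone[OF 3] by simp
      qed
    qed (use up[of w d] up[of "- w" "- d"] in auto)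
  qed
  have "norm (g z) \<le> B" for z
  proof -
    have "d \<noteq> 0"
      using d by auto
    thus ?thesis
      using all[of "z / d"] by simp
  qed
  hence "bounded (range g)"
    by (auto simp: bounded_iff)
  hence "g constant_on UNIV"
    by (rule Liouville_theorem[OF g])
  thus ?thesis
    using that by (auto simp: constant_on_def)
qed

subsection \<open>Two auxiliary estimates\<close>

text \<open>Schwarz's lemma applied to w / (2 H - w): this Moebius map sends the half-plane Re w < H
  to the unit disc and fixes 0.\<close>

lemma borel_caratheodory:
  fixes h :: "complex \<Rightarrow> complex"
  assumes h: "h holomorphic_on ball a r" and H: "H > 0"
    and bd: "\<And>z. z \<in> ball a r \<Longrightarrow> Re (h z - h a) < H"
    and z: "norm (z - a) \<le> t" and t: "t < r"
  shows "norm (h z - h a) \<le> 2 * H * t / (r - t)"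
proof -
  have t0: "t \<ge> 0"
    using z norm_ge_zero order_trans by blast
  have r: "r > 0"
    using t0 t by simp
  define w where "w \<zeta> = h (a + of_real r * \<zeta>) - h a" for \<zeta>
  have in_ball: "a + of_real r * \<zeta> \<in> ball a r" if "norm \<zeta> < 1" for \<zeta>
    using that r by (simp add: dist_norm norm_mult)
  have lt: "norm (w \<zeta>) < norm (2 * of_real H - w \<zeta>)" if "norm \<zeta> < 1" for \<zeta>
  proof -
    have "Re (w \<zeta>) < H"
      unfolding w_def by (rule bd[OF in_ball[OF that]])
    hence "0 < 4 * H * (H - Re (w \<zeta>))"
      using H by simp
    hence "(Re (w \<zeta>))\<^sup>2 + (Im (w \<zeta>))\<^sup>2 < (2 * H - Re (w \<zeta>))\<^sup>2 + (Im (w \<zeta>))\<^sup>2"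
      by (simp add: power2_eq_square algebra_simps)
    thus ?thesis
      by (simp add: cmod_def)
  qed
  have nz: "2 * of_real H - w \<zeta> \<noteq> 0" if "norm \<zeta> < 1" for \<zeta>
    using lt[OF that] by auto
  have w_hol: "w holomorphic_on ball 0 1"
    unfolding w_def
    by (intro holomorphic_intros holomorphic_on_compose_gen[OF _ h, unfolded o_def])
      (use in_ball in auto)
  define \<zeta> where "\<zeta> = (z - a) / of_real r"
  have \<zeta>: "norm \<zeta> \<le> t / r" "norm \<zeta> < 1"
    using z t r by (auto simp: \<zeta>_def norm_divide field_simps)
  have "norm (w \<zeta> / (2 * of_real H - w \<zeta>)) \<le> norm \<zeta>"
  proof (rule Schwarz_Lemma(1)[of "\<lambda>\<zeta>. w \<zeta> / (2 * of_real H - w \<zeta>)"])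
    show "(\<lambda>\<zeta>. w \<zeta> / (2 * of_real H - w \<zeta>)) holomorphic_on ball 0 1"
      by (intro holomorphic_intros w_hol) (use nz in auto)
    show "norm (w z / (2 * of_real H - w z)) < 1" if "norm z < 1" for z
      using lt[OF that] nz[OF that] by (simp add: norm_divide)
  qed (use \<zeta> in \<open>auto simp: w_def\<close>)
  hence "norm (w \<zeta>) \<le> norm \<zeta> * norm (2 * of_real H - w \<zeta>)"
    using nz[OF \<zeta>(2)] by (simp add: norm_divide field_simps)
  also have "\<dots> \<le> (t / r) * (2 * H + norm (w \<zeta>))"
  proof (rule mult_mono[OF \<zeta>(1)])
    show "norm (2 * of_real H - w \<zeta>) \<le> 2 * H + norm (w \<zeta>)"
      using norm_triangle_ineq4[of "2 * of_real H" "w \<zeta>"] H by (simp add: norm_mult)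
  qed (use t0 r in auto)
  finally have "(r - t) * norm (w \<zeta>) \<le> 2 * H * t"
    using r by (simp add: field_simps)
  hence "norm (w \<zeta>) \<le> 2 * H * t / (r - t)"
    using t by (simp add: field_simps)
  moreover have "w \<zeta> = h z - h a"
    using r by (simp add: w_def \<zeta>_def)
  ultimately show ?thesis
    by simp
qed

text \<open>Three radii: the bound on the real part within \<open>3 * r\<close> controls
  \<open>h\<close> within \<open>2 * r\<close> of \<open>a\<close>, and that disc contains the disc
  of radius \<open>r\<close> about \<open>z\<close> needed for Cauchy's estimate.\<close>

lemma borel_caratheodory_deriv:
  fixes h :: "complex \<Rightarrow> complex"
  assumes h: "h holomorphic_on UNIV" and H: "H > 0" and r: "r > 0"
    and bd: "\<And>z. norm (z - a) < 3 * r \<Longrightarrow> Re (h z - h a) < H"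
    and z: "norm (z - a) \<le> r"
  shows "norm (deriv h z) \<le> 5 * H / r"
proof -
  have "norm ((deriv ^^ 1) h z) \<le> fact 1 * (5 * H) / r ^ 1"
  proof (rule Cauchy_higher_deriv_bound)
    fix w assume "w \<in> ball z r"
    hence "norm (w - a) \<le> 2 * r"
      using z norm_triangle_ineq[of "w - z" "z - a"] by (simp add: dist_norm norm_minus_commute)
    hence "norm (h w - h a) \<le> 2 * H * (2 * r) / (3 * r - 2 * r)"
      by (intro borel_caratheodory[OF holomorphic_on_subset[OF h] H])
        (use bd r in \<open>auto simp: dist_norm norm_minus_commute\<close>)
    \<comment> \<open>The left side equals \<open>4 * H\<close>; the larger constant provides the
      strict inequality for membership in an open ball.\<close>
    also have "\<dots> < 5 * H"
      using H r by simp
    finally show "h w \<in> ball (h a) (5 * H)"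
      by (simp add: dist_norm norm_minus_commute)
  qed (use r in \<open>auto intro!: holomorphic_on_imp_continuous_on holomorphic_on_subset[OF h]\<close>)
  thus ?thesis
    by simp
qed

lemma has_integral_abs_powr_bound:
  fixes A L c p :: real
  assumes p: "0 < p" "p < 1" and c: "A \<le> c" "c \<le> A + L"
  obtains I where "((\<lambda>t. \<bar>t - c\<bar> powr (- p)) has_integral I) {A..A+L}"
    "I \<le> 2 * L powr (1 - p) / (1 - p)"
proof -
  have 1: "((\<lambda>t. \<bar>t - c\<bar> powr (- p)) has_integral
      ((A + L - c) powr (1 - p) / (1 - p) - (c - c) powr (1 - p) / (1 - p))) {c..A+L}"
  proof (rule fundamental_theorem_of_calculus_interior_strong[where S="{}"])
    show "((\<lambda>t. (t - c) powr (1 - p) / (1 - p)) has_vector_derivative \<bar>t - c\<bar> powr (- p)) (at t)"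
      if "t \<in> {c<..<A+L} - {}" for t
      using that p by (auto intro!: derivative_eq_intros simp flip: has_real_derivative_iff_has_vector_derivative)
    show "continuous_on {c..A+L} (\<lambda>t. (t - c) powr (1 - p) / (1 - p))"
      by (intro continuous_intros continuous_on_powr') (use p in auto)
  qed (use c in auto)
  have 2: "((\<lambda>t. \<bar>t - c\<bar> powr (- p)) has_integral
      (- ((c - c) powr (1 - p) / (1 - p)) - (- ((c - A) powr (1 - p) / (1 - p))))) {A..c}"
  proof (rule fundamental_theorem_of_calculus_interior_strong[where S="{}"])
    show "((\<lambda>t. - ((c - t) powr (1 - p) / (1 - p))) has_vector_derivative \<bar>t - c\<bar> powr (- p)) (at t)"
      if "t \<in> {A<..<c} - {}" for t
      using that p by (auto intro!: derivative_eq_intros simp flip: has_real_derivative_iff_has_vector_derivative)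
    show "continuous_on {A..c} (\<lambda>t. - ((c - t) powr (1 - p) / (1 - p)))"
      by (intro continuous_intros continuous_on_powr') (use p in auto)
  qed (use c in auto)
  have le: "x powr (1 - p) / (1 - p) \<le> L powr (1 - p) / (1 - p)" if "0 \<le> x" "x \<le> L" for x
    using that p by (intro divide_right_mono powr_mono2) auto
  show ?thesis
    by (rule that[OF has_integral_combine[OF c 2 1]])
      (use le[of "A + L - c"] le[of "c - A"] c in simp)
qed

text \<open>For p < 1 the l^p quasi-norm dominates the l^1 norm: in x = x^p x^(1-p) the second
  factor is bounded through \<open>x i powr p \<le> M\<close>.\<close>

lemma sum_le_sum_powr_powr:
  fixes x :: "'i \<Rightarrow> real"
  assumes p: "0 < p" "p < 1" and x: "\<And>i. i \<in> I \<Longrightarrow> x i \<ge> 0"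
  shows "(\<Sum>i\<in>I. x i) \<le> (\<Sum>i\<in>I. x i powr p) powr (1 / p)"
proof (cases "finite I")
  case True
  define M where "M = (\<Sum>i\<in>I. x i powr p)"
  have M: "x i powr p \<le> M" if "i \<in> I" for i
    unfolding M_def using that True by (intro member_le_sum) auto
  have "x i \<le> x i powr p * M powr (1 / p - 1)" if "i \<in> I" for i
  proof -
    have "x i = (x i powr p) powr 1 * (x i powr p) powr (1 / p - 1)"
      using p x[OF that] by (simp add: powr_powr algebra_simps flip: powr_add)
    also have "\<dots> \<le> (x i powr p) powr 1 * M powr (1 / p - 1)"
      using p M[OF that] by (intro mult_left_mono powr_mono2) auto
    finally show ?thesis
      by simp
  qed
  hence "(\<Sum>i\<in>I. x i) \<le> (\<Sum>i\<in>I. x i powr p * M powr (1 / p - 1))"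
    by (rule sum_mono)
  also have "\<dots> = M powr 1 * M powr (1 / p - 1)"
    by (simp add: M_def sum_distrib_right sum_nonneg)
  also have "\<dots> = M powr (1 / p)"
    unfolding powr_add[symmetric] by simp
  finally show ?thesis
    by (simp add: M_def)
qed auto

text \<open>
  Since \<open>p < 1\<close>, the function \<open>|t|\<^sup>-\<^sup>p\<close> is integrable at \<open>0\<close>, so the mean over \<open>t\<close> of
  \<open>\<Sum> |t - c\<^sub>i|\<^sup>-\<^sup>p\<close> is at most of order \<open>|I| L\<^sup>-\<^sup>p\<close>.
\<close>

lemma exists_sum_inverse_distance_le:
  fixes c :: "'i \<Rightarrow> real" and A L p :: real
  assumes p: "0 < p" "p < 1" and I: "finite I" and L: "L > 0"
  obtains t where "A \<le> t" "t \<le> A + L" "\<And>i. i \<in> I \<Longrightarrow> t \<noteq> c i"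
    "(\<Sum>i\<in>I. 1 / \<bar>t - c i\<bar>) \<le> (8 * real (card I) / (1 - p)) powr (1 / p) / L"
proof (cases "I = {}")
  case True
  thus ?thesis
    using that[of A] L by simp
next
  case False
  \<comment> \<open>Moving the centres into the interval brings them closer to every
    \<open>t\<close> in it, which only enlarges the sum, and makes the integral bound
    applicable.\<close>
  define c' where "c' i = max A (min (A + L) (c i))" for i
  have c': "A \<le> c' i" "c' i \<le> A + L" for i
    using L by (auto simp: c'_def)
  have "\<exists>J. ((\<lambda>t. \<bar>t - c' i\<bar> powr (- p)) has_integral J) {A..A+L} \<and>
      J \<le> 2 * L powr (1 - p) / (1 - p)" for i
    using has_integral_abs_powr_bound[OF p c'(1)[of i] c'(2)[of i]] by metis
  then obtain J where J: "\<And>i. ((\<lambda>t. \<bar>t - c' i\<bar> powr (- p)) has_integral J i) {A..A+L}"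
      "\<And>i. J i \<le> 2 * L powr (1 - p) / (1 - p)"
    by metis
  define F where "F t = (\<Sum>i\<in>I. \<bar>t - c' i\<bar> powr (- p))" for t
  have F_int: "(F has_integral (\<Sum>i\<in>I. J i)) {A..A+L}"
    unfolding F_def by (intro has_integral_sum I J)
  \<comment> \<open>Four times the bound that the integral gives for the mean of \<open>F\<close>,
    so \<open>F\<close> cannot exceed \<open>M\<close> outside a finite set.\<close>
  define M where "M = 8 * real (card I) / (1 - p) * L powr (- p)"
  have "\<exists>t\<in>{A..A+L}. t \<notin> c' ` I \<and> F t \<le> M"
  proof (rule ccontr)
    assume "\<not> ?thesis"
    hence *: "F t > M" if "t \<in> {A..A+L} - c' ` I" for t
      using that by (force simp: not_le)
    \<comment> \<open>At a centre the term \<open>0 powr (- p)\<close> is 0, so \<open>F\<close> is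
      misleading at finitely many points. There it is overwritten, without effect on the
      integral.\<close>
    define G where "G t = (if t \<in> c' ` I then M else F t)" for t
    have G1: "(G has_integral (\<Sum>i\<in>I. J i)) {A..A+L}"
      by (rule has_integral_spike_finite[OF _ _ F_int, of "c' ` I"]) (auto simp: I G_def)
    have G2: "((\<lambda>_. M) has_integral (L * M)) {A..A+L}"
      using has_integral_const_real[of M A "A + L"] L by simp
    have "M \<le> G t" if "t \<in> {A..A+L}" for t
      using that *[of t] by (cases "t \<in> c' ` I") (simp_all add: G_def)
    hence "L * M \<le> (\<Sum>i\<in>I. J i)"
      by (rule has_integral_le[OF G2 G1])
    also have "\<dots> \<le> (\<Sum>i\<in>I. 2 * L powr (1 - p) / (1 - p))"
      by (intro sum_mono J)
    also have "\<dots> = L * M / 4"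
    proof -
      have "L powr (1 - p) = L * L powr (- p)"
        using L powr_add[of L 1 "- p"] by simp
      thus ?thesis
        using p by (simp add: M_def divide_simps)
    qed
    finally have "L * M \<le> L * M / 4" .
    moreover have "L * M > 0"
      using L p False I by (auto simp: M_def card_gt_0_iff intro!: mult_pos_pos divide_pos_pos)
    ultimately show False
      by simp
  qed
  then obtain t where t: "A \<le> t" "t \<le> A + L" "t \<notin> c' ` I" "F t \<le> M"
    by auto
  have ne: "t \<noteq> c i" if "i \<in> I" for i
    using t that by (force simp: c'_def)
  have "(\<Sum>i\<in>I. 1 / \<bar>t - c i\<bar>) \<le> (\<Sum>i\<in>I. 1 / \<bar>t - c' i\<bar>)"
  proof (intro sum_mono divide_left_mono)
    fix i assume i: "i \<in> I"
    show "\<bar>t - c' i\<bar> \<le> \<bar>t - c i\<bar>"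
      using t by (auto simp: c'_def)
    show "0 < \<bar>t - c i\<bar> * \<bar>t - c' i\<bar>"
    proof -
      have "t \<noteq> c' i"
        using t(3) i by blast
      thus ?thesis
        using ne[OF i] by simp
    qed
  qed auto
  also have "\<dots> \<le> (\<Sum>i\<in>I. (1 / \<bar>t - c' i\<bar>) powr p) powr (1 / p)"
    by (rule sum_le_sum_powr_powr[OF p]) auto
  also have "(\<Sum>i\<in>I. (1 / \<bar>t - c' i\<bar>) powr p) = F t"
    unfolding F_def by (intro sum.cong refl) (simp add: powr_divide powr_minus field_simps)
  also have "F t powr (1 / p) \<le> M powr (1 / p)"
    using t(4) p by (intro powr_mono2) (auto simp: F_def sum_nonneg)
  also have "\<dots> = (8 * real (card I) / (1 - p)) powr (1 / p) / L"
  proof -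
    have "M powr (1 / p) = (8 * real (card I) / (1 - p)) powr (1 / p) * (L powr (- p)) powr (1 / p)"
      unfolding M_def by (rule powr_mult)
    also have "(L powr (- p)) powr (1 / p) = L powr (- 1)"
      using p by (simp only: powr_powr) simp
    also have "L powr (- 1) = 1 / L"
      using L by (simp add: powr_minus divide_inverse)
    finally show ?thesis
      by simp
  qed
  finally show ?thesis
    using that t ne by blast
qed

subsection \<open>Growth of the exponent of a solution\<close>

text \<open>Gronwall along the segment from \<open>z0\<close> to \<open>z\<close>. Squares are used
  because the norm is not differentiable at 0; bounding the squared sum of norms by the sum of
  squares costs the factor \<open>n\<close> in the exponent.\<close>

lemma norm_square_gronwall:
  fixes y :: "nat \<Rightarrow> complex \<Rightarrow> complex"
  assumes y: "\<And>i. i < n \<Longrightarrow> y i holomorphic_on UNIV" and K: "K \<ge> 0"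
    and bd: "\<And>i z. i < n \<Longrightarrow> norm (z - z0) \<le> \<rho> \<Longrightarrow> norm (deriv (y i) z) \<le> K * (\<Sum>j<n. norm (y j z))"
    and z: "norm (z - z0) \<le> \<rho>"
  shows "(\<Sum>i<n. (norm (y i z))\<^sup>2) \<le> (\<Sum>i<n. (norm (y i z0))\<^sup>2) * exp (2 * K * n * norm (z - z0))"
proof -
  define u where "u = z - z0"
  define \<gamma> where "\<gamma> t = z0 + of_real t * u" for t
  define S where "S t = (\<Sum>i<n. y i (\<gamma> t) \<bullet> y i (\<gamma> t))" for t
  define a where "a = 2 * K * n * norm u"
  have in_ball: "norm (\<gamma> t - z0) \<le> \<rho>" if "0 \<le> t" "t \<le> 1" for t
  proof -
    have "norm (\<gamma> t - z0) = t * norm u"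
      using that by (simp add: \<gamma>_def norm_mult)
    also have "\<dots> \<le> 1 * norm u"
      using that by (intro mult_right_mono) auto
    finally show ?thesis
      using z by (simp add: u_def)
  qed
  have dy: "((\<lambda>t. y i (\<gamma> t)) has_vector_derivative (u * deriv (y i) (\<gamma> t))) (at t)" if "i < n" for i t
  proof -
    have "(y i has_field_derivative deriv (y i) (\<gamma> t)) (at (\<gamma> t))"
      using holomorphic_derivI[OF y[OF that] open_UNIV] by simp
    moreover have "(\<gamma> has_vector_derivative u) (at t)"
      unfolding \<gamma>_def by (auto intro!: derivative_eq_intros simp: scaleR_conv_of_real)
    ultimately show ?thesis
      using field_vector_diff_chain_at[of \<gamma> u t "y i"] by (simp add: o_def)
  qed
  have dS: "(S has_real_derivative (\<Sum>i<n. 2 * (y i (\<gamma> t) \<bullet> (u * deriv (y i) (\<gamma> t))))) (at t)" for t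
    unfolding S_def has_real_derivative_iff_has_vector_derivative
  proof (rule has_vector_derivative_sum)
    fix i assume "i \<in> {..<n}"
    hence "((\<lambda>t. y i (\<gamma> t)) has_derivative (\<lambda>x. x *\<^sub>R (u * deriv (y i) (\<gamma> t)))) (at t)"
      using dy[of i t] by (simp add: has_vector_derivative_def)
    from has_derivative_inner[OF this this]
    show "((\<lambda>t. y i (\<gamma> t) \<bullet> y i (\<gamma> t)) has_vector_derivative
        2 * (y i (\<gamma> t) \<bullet> (u * deriv (y i) (\<gamma> t)))) (at t)"
      by (simp add: has_vector_derivative_def inner_commute algebra_simps)
  qed
  have S_le: "(\<Sum>i<n. 2 * (y i (\<gamma> t) \<bullet> (u * deriv (y i) (\<gamma> t)))) \<le> a * S t" if "0 \<le> t" "t \<le> 1" for t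
  proof -
    have "(\<Sum>i<n. 2 * (y i (\<gamma> t) \<bullet> (u * deriv (y i) (\<gamma> t)))) \<le>
        (\<Sum>i<n. 2 * (norm (y i (\<gamma> t)) * (norm u * (K * (\<Sum>j<n. norm (y j (\<gamma> t)))))))"
    proof (intro sum_mono mult_left_mono order_trans[OF norm_cauchy_schwarz])
      fix i assume "i \<in> {..<n}"
      hence "norm (deriv (y i) (\<gamma> t)) \<le> K * (\<Sum>j<n. norm (y j (\<gamma> t)))"
        using bd in_ball[OF that] by auto
      thus "norm (u * deriv (y i) (\<gamma> t)) \<le> norm u * (K * (\<Sum>j<n. norm (y j (\<gamma> t))))"
        by (auto simp: norm_mult intro!: mult_left_mono)
    qed auto
    also have "\<dots> = 2 * K * norm u * (\<Sum>j<n. norm (y j (\<gamma> t)))\<^sup>2"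
      by (simp add: sum_distrib_left sum_distrib_right power2_eq_square mult_ac)
    also have "\<dots> \<le> 2 * K * norm u * ((\<Sum>j<n. (norm (y j (\<gamma> t)))\<^sup>2) * card {..<n})"
      by (intro mult_left_mono sum_squared_le_sum_of_squares) (use K in auto)
    also have "\<dots> = a * S t"
      by (simp add: a_def S_def power2_norm_eq_inner mult_ac)
    finally show ?thesis .
  qed
  have "S 1 * exp (- a * 1) \<le> S 0 * exp (- a * 0)"
  proof (rule DERIV_nonpos_imp_nonincreasing[of 0 1 "\<lambda>t. S t * exp (- a * t)"])
    fix t :: real assume t: "0 \<le> t" "t \<le> 1"
    have "((\<lambda>t. S t * exp (- a * t)) has_real_derivative
        ((\<Sum>i<n. 2 * (y i (\<gamma> t) \<bullet> (u * deriv (y i) (\<gamma> t)))) - a * S t) * exp (- a * t)) (at t)"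
      by (rule derivative_eq_intros dS refl | simp add: algebra_simps)+
    moreover have "((\<Sum>i<n. 2 * (y i (\<gamma> t) \<bullet> (u * deriv (y i) (\<gamma> t)))) - a * S t) * exp (- a * t) \<le> 0"
      using S_le[OF t] by (intro mult_nonpos_nonneg) auto
    ultimately show "\<exists>y. ((\<lambda>t. S t * exp (- a * t)) has_real_derivative y) (at t) \<and> y \<le> 0"
      by blast
  qed auto
  hence "S 1 \<le> S 0 * exp a"
    by (simp add: exp_minus field_simps)
  thus ?thesis
    by (simp add: S_def \<gamma>_def u_def a_def power2_norm_eq_inner)
qed

text \<open>The coefficient \<open>W\<close> is an arbitrary entire function at this level;
  exponential sums enter only in a later extension, which is used once for each of the two opposite
  directions.\<close>

locale factored_solution =
  fixes n :: nat and \<alpha> :: "nat \<Rightarrow> complex" and W f h :: "complex \<Rightarrow> complex"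
    and b :: "nat \<Rightarrow> complex" and m :: nat and s :: real
  assumes n: "n \<ge> 1" and W: "W holomorphic_on UNIV"
    and s: "0 < s" "s < 1" and summable_b_s: "summable (\<lambda>i. norm (b i) powr s)"
    and h: "h holomorphic_on UNIV"
    and f_eq: "\<And>z. f z = z ^ m * canonical_product b z * exp (h z)"
    and ode: "\<And>z. (deriv ^^ n) f z + (\<Sum>j=1..n-1. \<alpha> j * (deriv ^^ j) f z) - W z * f z = 0"
begin

lemma summable_b: "summable (\<lambda>i. norm (b i))"
  by (rule summable_norm_of_powr[OF s summable_b_s])

lemma f: "f holomorphic_on UNIV"
proof -
  have "(\<lambda>z. z ^ m * canonical_product b z * exp (h z)) holomorphic_on UNIV"
    by (intro holomorphic_intros h canonical_product_holomorphic[OF summable_b])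
  thus ?thesis
    using f_eq by (metis (no_types, lifting) holomorphic_transform)
qed

lemma f_nonzero: "eventually (\<lambda>z. f z \<noteq> 0) (at 0)"
proof -
  have "canonical_product b 0 \<noteq> 0"
    by (simp add: canonical_product_eq_0_iff[OF summable_b])
  from non_zero_neighbour_alt[OF canonical_product_holomorphic[OF summable_b] open_UNIV
      connected_UNIV UNIV_I UNIV_I this, of 0]
  have "eventually (\<lambda>z. canonical_product b z \<noteq> 0) (at 0)"
    by simp
  moreover have "eventually (\<lambda>z::complex. z \<noteq> 0) (at 0)"
    by (rule eventually_neq_at_within)
  ultimately show ?thesis
    by eventually_elim (simp add: f_eq)
qed

lemma not_zero_on_ball:
  assumes "\<rho> > 0"
  obtains w where "norm (w - z0) \<le> \<rho>" "f w \<noteq> 0"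
proof (rule ccontr)
  assume "\<not> thesis"
  hence *: "\<not> (norm (w - z0) \<le> \<rho> \<and> f w \<noteq> 0)" for w
    using that by blast
  have "f w = 0" if "norm (w - z0) \<le> \<rho>" for w
    using * that by blast
  hence z: "f w = 0" if "w \<in> ball z0 \<rho>" for w
    using that by (simp add: dist_norm norm_minus_commute)
  have "f w = 0" for w
    by (rule analytic_continuation_open[where f=f and g="\<lambda>_. 0" and s="ball z0 \<rho>" and s'=UNIV])
      (use z assms f in auto)
  thus False
    using eventually_happens'[OF _ f_nonzero] by auto
qed

lemma higher_holomorphic: "(deriv ^^ j) f holomorphic_on A"
  by (rule holomorphic_on_subset[OF holomorphic_higher_deriv[OF f open_UNIV]]) auto

definition weighted_jet :: "real \<Rightarrow> complex \<Rightarrow> real" where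
  "weighted_jet \<Lambda> z = (\<Sum>i<n. (norm ((deriv ^^ i) f z / of_real (\<Lambda> ^ i)))\<^sup>2)"

definition coeff_bound :: real where
  "coeff_bound = 1 + (\<Sum>j=1..n-1. norm (\<alpha> j))"

text \<open>For y i = f^(i) / \<Lambda>^i one has y i' = \<Lambda> y (i+1) below the last row, and
  in the last row |W| \<le> \<Lambda>^n and \<Lambda> \<ge> 1 again leave only one factor \<Lambda>.
  The exponent is therefore linear in \<Lambda>.\<close>

lemma weighted_jet_growth:
  assumes \<Lambda>: "\<Lambda> \<ge> 1" and W_le: "\<And>z. norm (z - z0) \<le> \<rho> \<Longrightarrow> norm (W z) \<le> \<Lambda> ^ n"
    and z: "norm (z - z0) \<le> \<rho>"
  shows "weighted_jet \<Lambda> z \<le> weighted_jet \<Lambda> z0 * exp (2 * (\<Lambda> * coeff_bound) * n * norm (z - z0))"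
  unfolding weighted_jet_def
proof (rule norm_square_gronwall[OF _ _ _ z])
  show "(\<lambda>z. (deriv ^^ i) f z / of_real (\<Lambda> ^ i)) holomorphic_on UNIV" for i
    using \<Lambda> by (intro holomorphic_intros higher_holomorphic) auto
  have cb: "coeff_bound \<ge> 1"
    by (simp add: coeff_bound_def sum_nonneg)
  show "\<Lambda> * coeff_bound \<ge> 0"
    using \<Lambda> cb by simp
  fix i z assume i: "i < n" and z: "norm (z - z0) \<le> \<rho>"
  define y where "y j = norm ((deriv ^^ j) f z / of_real (\<Lambda> ^ j))" for j
  have y: "norm ((deriv ^^ j) f z) = \<Lambda> ^ j * y j" for j
    using \<Lambda> by (simp add: y_def norm_divide norm_power)
  have y0: "y j \<ge> 0" for j
    by (simp add: y_def)
  define Y where "Y = (\<Sum>j<n. y j)"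
  have yY: "y j \<le> Y" if "j < n" for j
    unfolding Y_def by (rule member_le_sum) (use that y0 in auto)
  have Y0: "Y \<ge> 0"
    by (simp add: Y_def sum_nonneg y0)
  have "deriv (\<lambda>z. (deriv ^^ i) f z / of_real (\<Lambda> ^ i)) z = (deriv ^^ Suc i) f z / of_real (\<Lambda> ^ i)"
    using higher_holomorphic[of i UNIV]
    by (subst deriv_cdivide_right) (auto simp: holomorphic_on_imp_differentiable_at)
  hence eq: "norm (deriv (\<lambda>z. (deriv ^^ i) f z / of_real (\<Lambda> ^ i)) z) = norm ((deriv ^^ Suc i) f z) / \<Lambda> ^ i"
    using \<Lambda> by (simp add: norm_divide norm_power)
  have "norm ((deriv ^^ Suc i) f z) \<le> \<Lambda> ^ Suc i * (coeff_bound * Y)"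
  proof (cases "Suc i = n")
    case False
    hence "norm ((deriv ^^ Suc i) f z) \<le> \<Lambda> ^ Suc i * (1 * Y)"
      unfolding y using yY[of "Suc i"] i \<Lambda> by (intro mult_left_mono) auto
    also have "\<dots> \<le> \<Lambda> ^ Suc i * (coeff_bound * Y)"
      using cb Y0 \<Lambda> by (intro mult_left_mono mult_right_mono) auto
    finally show ?thesis .
  next
    case True
    have "(deriv ^^ n) f z = W z * f z - (\<Sum>j=1..n-1. \<alpha> j * (deriv ^^ j) f z)"
      using ode[of z] by (simp add: algebra_simps)
    hence "norm ((deriv ^^ n) f z) \<le> norm (W z * f z) + norm (\<Sum>j=1..n-1. \<alpha> j * (deriv ^^ j) f z)"
      using norm_triangle_ineq4 by metis
    also have "\<dots> \<le> \<Lambda> ^ n * Y + (\<Sum>j=1..n-1. norm (\<alpha> j) * (\<Lambda> ^ n * Y))"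
    proof (rule add_mono)
      have "norm (f z) \<le> Y"
        using yY[of 0] n y[of 0] by simp
      thus "norm (W z * f z) \<le> \<Lambda> ^ n * Y"
        unfolding norm_mult using W_le[OF z] \<Lambda> by (intro mult_mono) auto
      show "norm (\<Sum>j=1..n-1. \<alpha> j * (deriv ^^ j) f z) \<le> (\<Sum>j=1..n-1. norm (\<alpha> j) * (\<Lambda> ^ n * Y))"
      proof (rule sum_norm_le)
        fix j assume j: "j \<in> {1..n-1}"
        have "norm ((deriv ^^ j) f z) \<le> \<Lambda> ^ n * Y"
          unfolding y using j yY[of j] \<Lambda> y0 by (intro mult_mono power_increasing) auto
        thus "norm (\<alpha> j * (deriv ^^ j) f z) \<le> norm (\<alpha> j) * (\<Lambda> ^ n * Y)"
          by (auto simp: norm_mult intro!: mult_left_mono)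
      qed
    qed
    also have "\<dots> = \<Lambda> ^ n * (coeff_bound * Y)"
      by (simp add: coeff_bound_def algebra_simps sum_distrib_left sum_distrib_right)
    finally show ?thesis
      unfolding True .
  qed
  hence "norm ((deriv ^^ Suc i) f z) / \<Lambda> ^ i \<le> \<Lambda> * coeff_bound * Y"
    using \<Lambda> by (simp add: field_simps)
  thus "norm (deriv (\<lambda>z. (deriv ^^ i) f z / of_real (\<Lambda> ^ i)) z) \<le>
      \<Lambda> * coeff_bound * (\<Sum>j<n. norm ((deriv ^^ j) f z / of_real (\<Lambda> ^ j)))"
    unfolding eq by (simp add: Y_def y_def)
qed

text \<open>By Cauchy's estimates a small \<open>f\<close> on the disc of radius 1 / \<Lambda> would
  make the whole rescaled jet at its centre small; this radius is the one that matches the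
  weights.\<close>

lemma exists_large_value:
  assumes \<Lambda>: "\<Lambda> \<ge> 1" and pos: "weighted_jet \<Lambda> z0 > 0"
  obtains z1 where "norm (z1 - z0) \<le> 1 / \<Lambda>"
    "norm (f z1) \<ge> sqrt (weighted_jet \<Lambda> z0) / (2 * n * fact n)"
proof (rule ccontr)
  assume "\<not> thesis"
  hence *: "\<not> (norm (z1 - z0) \<le> 1 / \<Lambda> \<and>
      norm (f z1) \<ge> sqrt (weighted_jet \<Lambda> z0) / (2 * n * fact n))" for z1
    using that by blast
  define \<sigma> where "\<sigma> = sqrt (weighted_jet \<Lambda> z0)"
  \<comment> \<open>With this threshold the \<open>n\<close> squared entries add up to at most
    \<open>\<sigma>\<^sup>2 / (4 * n)\<close>, which is below
    \<open>\<sigma>\<^sup>2\<close>.\<close>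
  define c where "c = \<sigma> / (2 * n * fact n)"
  have \<sigma>: "\<sigma> > 0"
    using pos by (simp add: \<sigma>_def)
  have c: "c > 0"
    using \<sigma> n by (simp add: c_def)
  have lt: "norm (f z) < c" if "norm (z - z0) \<le> 1 / \<Lambda>" for z
    using *[of z] that by (simp add: not_le c_def \<sigma>_def)
  have jet: "norm ((deriv ^^ j) f z0 / of_real (\<Lambda> ^ j)) \<le> fact n * c" if j: "j < n" for j
  proof -
    have "norm ((deriv ^^ j) f z0) \<le> fact j * c / (1 / \<Lambda>) ^ j"
    proof (cases "j = 0")
      case True
      thus ?thesis
        using lt[of z0] \<Lambda> by simp
    next
      case False
      show ?thesis
      proof (rule Cauchy_higher_deriv_bound[where y = 0])
        show "f holomorphic_on ball z0 (1 / \<Lambda>)"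
          by (rule holomorphic_on_subset[OF f]) auto
        show "continuous_on (cball z0 (1 / \<Lambda>)) f"
          by (intro holomorphic_on_imp_continuous_on holomorphic_on_subset[OF f]) auto
        show "f w \<in> ball 0 c" if "w \<in> ball z0 (1 / \<Lambda>)" for w
          using that lt[of w] by (simp add: dist_norm norm_minus_commute)
      qed (use \<Lambda> False in auto)
    qed
    also have "\<dots> = fact j * c * \<Lambda> ^ j"
      using \<Lambda> by (simp add: power_divide)
    also have "\<dots> \<le> fact n * c * \<Lambda> ^ j"
      using c \<Lambda> j by (intro mult_right_mono fact_mono) auto
    finally show ?thesis
      using \<Lambda> by (simp add: norm_divide norm_power field_simps)
  qed
  have "weighted_jet \<Lambda> z0 \<le> (\<Sum>i<n. (fact n * c)\<^sup>2)"
    unfolding weighted_jet_def by (intro sum_mono power_mono jet) auto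
  also have "\<dots> = \<sigma>\<^sup>2 / (4 * n)"
    using n by (simp add: c_def power2_eq_square field_simps)
  also have "\<dots> < \<sigma>\<^sup>2"
    using n \<sigma> by (simp add: field_simps)
  also have "\<dots> = weighted_jet \<Lambda> z0"
    using pos by (simp add: \<sigma>_def)
  finally show False
    by simp
qed

text \<open>Vanishing initial data at \<open>z0\<close> would, through the growth estimate, make
  \<open>f\<close> vanish on a disc.\<close>

lemma weighted_jet_pos:
  assumes \<Lambda>: "\<Lambda> \<ge> 1" and \<rho>: "\<rho> > 0" and W_le: "\<And>z. norm (z - z0) \<le> \<rho> \<Longrightarrow> norm (W z) \<le> \<Lambda> ^ n"
  shows "weighted_jet \<Lambda> z0 > 0"
proof (rule ccontr)
  assume "\<not> weighted_jet \<Lambda> z0 > 0"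
  moreover have ge: "weighted_jet \<Lambda> z \<ge> 0" for z
    by (simp add: weighted_jet_def sum_nonneg)
  ultimately have z: "weighted_jet \<Lambda> z0 = 0"
    using ge[of z0] by linarith
  obtain w where w: "norm (w - z0) \<le> \<rho>" "f w \<noteq> 0"
    using not_zero_on_ball[OF \<rho>] by blast
  have "weighted_jet \<Lambda> w \<le> 0"
    using weighted_jet_growth[OF \<Lambda> W_le w(1)] z by simp
  moreover have "(norm ((deriv ^^ 0) f w / of_real (\<Lambda> ^ 0)))\<^sup>2 \<le> weighted_jet \<Lambda> w"
    unfolding weighted_jet_def by (rule member_le_sum[of 0]) (use n in auto)
  moreover have "(norm ((deriv ^^ 0) f w / of_real (\<Lambda> ^ 0)))\<^sup>2 > 0"
    using w(2) by simp
  ultimately show False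
    by linarith
qed

text \<open>Markov's inequality for the counting function of the zeros:
  \<open>norm (b i) > 1 / T\<close> says that the zero 1 / b i has modulus below
  \<open>T\<close>.\<close>

lemma card_large_b:
  assumes "T > 0"
  shows "finite {i. norm (b i) > 1 / T}"
    "real (card {i. norm (b i) > 1 / T}) \<le> T powr s * (\<Sum>i. norm (b i) powr s)"
proof -
  let ?K = "{i. norm (b i) > 1 / T}"
  show K: "finite ?K"
    by (rule finite_subset[OF _ finite_canonical_zeros[OF summable_b, of "1 / T"]]) (use assms in auto)
  have "real (card ?K) * (1 / T) powr s = (\<Sum>i\<in>?K. (1 / T) powr s)"
    by simp
  also have "\<dots> \<le> (\<Sum>i\<in>?K. norm (b i) powr s)"
    using s assms by (intro sum_mono powr_mono2) auto
  also have "\<dots> \<le> (\<Sum>i. norm (b i) powr s)"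
    by (intro sum_le_suminf summable_b_s K) auto
  finally show "real (card ?K) \<le> T powr s * (\<Sum>i. norm (b i) powr s)"
    using assms by (simp add: powr_divide field_simps)
qed


lemma split_large_b:
  assumes "T > 0"
  defines "K \<equiv> {i. norm (b i) > 1 / T}"
  defines "c \<equiv> \<lambda>i. if i \<in> K then 0 else b i"
  shows "canonical_product b z = (\<Prod>i\<in>K. 1 - b i * z) * canonical_product c z"
    and "summable (\<lambda>i. norm (c i))" and "(\<Sum>i. norm (c i)) \<le> (\<Sum>i. norm (b i))"
    and "norm (c i) \<le> 1 / T"
proof -
  show "canonical_product b z = (\<Prod>i\<in>K. 1 - b i * z) * canonical_product c z"
    unfolding c_def
    by (rule canonical_product_split[OF summable_b]) (use card_large_b(1)[OF assms(1)] in \<open>simp add: K_def\<close>)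
  show c: "summable (\<lambda>i. norm (c i))"
    unfolding c_def by (rule summable_remove[OF summable_b])
  show "(\<Sum>i. norm (c i)) \<le> (\<Sum>i. norm (b i))"
    by (rule suminf_le[OF _ c summable_b]) (auto simp: c_def)
  show "norm (c i) \<le> 1 / T"
    using assms(1) by (auto simp: c_def K_def not_less)
qed

text \<open>
  The factors of the canonical product with zeros near \<open>z0\<close> are divided out on the
  circle \<open>|z - z0| = 6 r\<close>, where they are not small; the maximum principle carries the bound inside.
\<close>

lemma Re_h_upper_bound:
  assumes r: "1 \<le> r" "16 * r \<le> norm z0" and M: "M > 0"
    and f_le: "\<And>z. norm (z - z0) \<le> 6 * r \<Longrightarrow> norm (f z) \<le> M" and z: "norm (z - z0) \<le> 4 * r"
  shows "Re (h z) \<le> ln M + (8 * (\<Sum>i. norm (b i) powr s) / (1 - s) + 4 * (\<Sum>i. norm (b i))) * norm z0"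
proof -
  define R where "R = norm z0"
  \<comment> \<open>Points within \<open>4 * r\<close> of \<open>z0\<close> have modulus at most
    \<open>2 * R\<close>, so every coefficient left in \<open>c\<close> satisfies |c i z| \<le> 1/2,
    as the lower bound for products demands.\<close>
  define T where "T = 4 * R"
  define K where "K = {i. norm (b i) > 1 / T}"
  define c where "c i = (if i \<in> K then 0 else b i)" for i
  have R: "R \<ge> 16"
    using r by (simp add: R_def)
  have T: "T > 0" "T \<ge> 1"
    using R by (auto simp: T_def)
  have split: "canonical_product b z = (\<Prod>i\<in>K. 1 - b i * z) * canonical_product c z" for z
    using split_large_b(1)[OF T(1)] by (simp add: K_def c_def[abs_def])
  have c: "summable (\<lambda>i. norm (c i))" "(\<Sum>i. norm (c i)) \<le> (\<Sum>i. norm (b i))" "\<And>i. norm (c i) \<le> 1 / T"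
    using split_large_b(2-4)[OF T(1)] by (simp_all add: K_def c_def[abs_def])
  have K: "finite K" "real (card K) \<le> T powr s * (\<Sum>i. norm (b i) powr s)"
    using card_large_b[OF T(1)] by (simp_all add: K_def)
  \<comment> \<open>The zeros within \<open>5 * r\<close> of \<open>z0\<close>. The margins 4 < 5 <
    6 keep them at distance at least \<open>r\<close> from the circle of radius
    \<open>6 * r\<close>, and all others of \<open>K\<close> at distance at least \<open>r\<close>
    from the disc of radius \<open>4 * r\<close>. A factor |b i| |1 / b i - z| is thus at least |b
    i| r, hence at least \<open>q\<close>.\<close>
  define near where "near = {i\<in>K. norm (1 - b i * z0) < 5 * r * norm (b i)}"
  have near: "near \<subseteq> K" "finite near"
    using K by (auto simp: near_def)
  define F where "F z = z ^ m * (\<Prod>i\<in>K - near. 1 - b i * z) * canonical_product c z * exp (h z)" for z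
  have f_F: "f z = (\<Prod>i\<in>near. 1 - b i * z) * F z" for z
    unfolding f_eq split F_def
    by (subst prod.subset_diff[OF near(1) K(1)]) (simp add: mult_ac)
  define q where "q = r / T"
  have q: "q > 0" "q \<le> 1"
    using r T(1) by (simp_all add: q_def) (simp add: T_def R_def)
  have b_ge: "norm (b i) * r \<ge> q" if "i \<in> K" for i
  proof -
    have "1 / T * r \<le> norm (b i) * r"
      using that r by (intro mult_right_mono) (auto simp: K_def)
    thus ?thesis
      by (simp add: q_def)
  qed
  have shift: "1 - b i * z = (1 - b i * z0) - b i * (z - z0)" for i z
    by (simp add: algebra_simps)
  have F_circle: "norm (F z) \<le> M * (1 / q) ^ card K" if z: "norm (z - z0) = 6 * r" for z
  proof -
    have "q \<le> norm (1 - b i * z)" if "i \<in> near" for i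
    proof -
      have "norm (b i * (z - z0)) - norm (1 - b i * z0) \<le> norm (1 - b i * z)"
        unfolding shift[of i z] by (metis norm_minus_commute norm_triangle_ineq2)
      moreover have "norm (b i * (z - z0)) = 6 * (norm (b i) * r)"
        by (simp add: norm_mult z)
      ultimately show ?thesis
        using that b_ge[of i] by (simp add: near_def mult_ac)
    qed
    hence "(\<Prod>i\<in>near. q) \<le> (\<Prod>i\<in>near. norm (1 - b i * z))"
      using q by (intro prod_mono) auto
    hence "q ^ card near \<le> norm (\<Prod>i\<in>near. 1 - b i * z)"
      by (simp add: prod_norm)
    moreover have "q ^ card K \<le> q ^ card near"
      using q near K by (intro power_decreasing card_mono) auto
    ultimately have "q ^ card K * norm (F z) \<le> norm (\<Prod>i\<in>near. 1 - b i * z) * norm (F z)"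
      by (intro mult_right_mono) auto
    also have "\<dots> = norm (f z)"
      by (simp add: f_F norm_mult)
    also have "\<dots> \<le> M"
      by (rule f_le) (simp add: z)
    finally show ?thesis
      using q by (simp add: field_simps power_divide)
  qed
  have F_hol: "F holomorphic_on UNIV"
    unfolding F_def by (intro holomorphic_intros h canonical_product_holomorphic[OF c(1)])
  have F_z: "norm (F z) \<le> M * (1 / q) ^ card K"
  proof (rule maximum_modulus_frontier[of F "cball z0 (6 * r)"])
    show "F holomorphic_on interior (cball z0 (6 * r))"
      by (rule holomorphic_on_subset[OF F_hol]) auto
    show "continuous_on (closure (cball z0 (6 * r))) F"
      by (intro holomorphic_on_imp_continuous_on holomorphic_on_subset[OF F_hol]) auto
    show "norm (F w) \<le> M * (1 / q) ^ card K" if "w \<in> frontier (cball z0 (6 * r))" for w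
      by (rule F_circle) (use that r in \<open>auto simp: dist_norm norm_minus_commute\<close>)
    show "z \<in> cball z0 (6 * r)"
      using z r by (simp add: dist_norm norm_minus_commute)
  qed auto
  have z_norm: "1 \<le> norm z" "norm z \<le> 2 * R"
  proof -
    have "norm z \<le> R + norm (z - z0)" "R \<le> norm z + norm (z - z0)"
      using norm_triangle_sub[of z z0] norm_triangle_sub[of z0 z]
      by (simp_all add: R_def norm_minus_commute)
    thus "1 \<le> norm z" "norm z \<le> 2 * R"
      using z r by (simp_all add: R_def)
  qed
  have far: "q ^ card K \<le> norm (\<Prod>i\<in>K - near. 1 - b i * z)"
  proof -
    have "q \<le> norm (1 - b i * z)" if "i \<in> K - near" for i
    proof -
      have "norm (1 - b i * z0) - norm (b i * (z - z0)) \<le> norm (1 - b i * z)"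
        unfolding shift[of i z] by (rule norm_triangle_ineq2)
      moreover have "norm (b i * (z - z0)) \<le> norm (b i) * (4 * r)"
        unfolding norm_mult using z by (intro mult_left_mono) auto
      moreover have "5 * (norm (b i) * r) \<le> norm (1 - b i * z0)"
        using that by (simp add: near_def not_less mult_ac)
      ultimately show ?thesis
        using that b_ge[of i] by simp
    qed
    hence "(\<Prod>i\<in>K - near. q) \<le> (\<Prod>i\<in>K - near. norm (1 - b i * z))"
      using q by (intro prod_mono) auto
    moreover have "q ^ card K \<le> q ^ card (K - near)"
      using q K by (intro power_decreasing card_mono) auto
    ultimately show ?thesis
      by (simp add: prod_norm)
  qed
  have tail: "exp (- (4 * R * (\<Sum>i. norm (b i)))) \<le> norm (canonical_product c z)"
  proof -
    have "norm (c i * z) \<le> 1 / T * (2 * R)" for i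
      unfolding norm_mult using c(3)[of i] z_norm T by (intro mult_mono) auto
    hence "norm (c i * z) \<le> 1 / 2" for i
      using R by (simp add: T_def)
    hence "exp (- (2 * norm z * (\<Sum>i. norm (c i)))) \<le> norm (canonical_product c z)"
      by (rule norm_canonical_product_ge[OF c(1)])
    moreover have "2 * norm z * (\<Sum>i. norm (c i)) \<le> 2 * (2 * R) * (\<Sum>i. norm (b i))"
      using z_norm c R by (intro mult_mono suminf_nonneg) auto
    hence "exp (- (4 * R * (\<Sum>i. norm (b i)))) \<le> exp (- (2 * norm z * (\<Sum>i. norm (c i))))"
      by simp
    ultimately show ?thesis
      by linarith
  qed
  have "1 * q ^ card K * exp (- (4 * R * (\<Sum>i. norm (b i)))) * exp (Re (h z)) \<le>
      norm (z ^ m) * norm (\<Prod>i\<in>K - near. 1 - b i * z) * norm (canonical_product c z) * exp (Re (h z))"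
    using z_norm q far tail by (intro mult_mono) (auto simp: norm_power one_le_power)
  also have "\<dots> = norm (F z)"
    by (simp add: F_def norm_mult)
  also have "\<dots> \<le> M * (1 / q) ^ card K"
    by (rule F_z)
  finally have "exp (Re (h z)) \<le> M * (1 / q) ^ (2 * card K) * exp (4 * R * (\<Sum>i. norm (b i)))"
    using q by (simp add: exp_minus field_simps power_mult power2_eq_square power_add mult_2)
  also have "\<dots> = exp (ln M + 2 * real (card K) * ln (1 / q) + 4 * R * (\<Sum>i. norm (b i)))"
    using M q by (simp add: exp_add exp_of_nat_mult[of "2 * card K", simplified])
  finally have "Re (h z) \<le> ln M + 2 * real (card K) * ln (1 / q) + 4 * R * (\<Sum>i. norm (b i))"
    by simp
  \<comment> \<open>The count is of order T^s and the logarithm at most T^(1-s) / (1-s), so their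
    product is linear in T; this uses s < 1.\<close>
  moreover have "2 * real (card K) * ln (1 / q) \<le> 8 * (\<Sum>i. norm (b i) powr s) / (1 - s) * R"
  proof -
    have "ln (1 / q) \<le> ln T"
    proof -
      have "T / r \<le> T / 1"
        using r T by (intro divide_left_mono) auto
      thus ?thesis
        using q r T(1) by (subst ln_le_cancel_iff) (auto simp: q_def)
    qed
    also have "\<dots> \<le> T powr (1 - s) / (1 - s)"
      using s T by (intro ln_powr_bound) auto
    finally have "2 * real (card K) * ln (1 / q) \<le>
        2 * (T powr s * (\<Sum>i. norm (b i) powr s)) * (T powr (1 - s) / (1 - s))"
      using K q by (intro mult_mono) (auto simp: suminf_nonneg summable_b_s)
    also have "\<dots> = 2 * (T powr s * T powr (1 - s)) * ((\<Sum>i. norm (b i) powr s) / (1 - s))"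
      by simp
    also have "T powr s * T powr (1 - s) = T"
      using T unfolding powr_add[symmetric] by simp
    finally show ?thesis
      by (simp add: T_def mult_ac)
  qed
  ultimately show ?thesis
    by (simp add: R_def algebra_simps)
qed

text \<open>Let \<sigma> be the square root of the jet at \<open>z0\<close>. Then |f| \<le> \<sigma>
  exp (O(\<Lambda> r)) within \<open>6 * r\<close>, while |f| \<ge> \<sigma> c0 at some
  \<open>z1\<close> within 1 / \<Lambda>. The unknown \<sigma> cancels in Re (h z - h z1), leaving
  O(\<Lambda> r + |z0|), and the Borel-Caratheodory bound divides this by \<open>r\<close>. The
  radius stays free because different regions call for different choices.\<close>

lemma deriv_h_bound:
  obtains C where "C > 0"
    "\<And>z0 r \<Lambda>. 1 \<le> r \<Longrightarrow> 16 * r \<le> norm z0 \<Longrightarrow> 1 \<le> \<Lambda> \<Longrightarrow>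
      (\<And>z. norm (z - z0) \<le> 6 * r \<Longrightarrow> norm (W z) \<le> \<Lambda> ^ n) \<Longrightarrow>
      norm (deriv h z0) \<le> C * (\<Lambda> + norm z0 / r)"
proof -
  define B where "B = (\<Sum>i. norm (b i))"
  define Q where "Q = 8 * (\<Sum>i. norm (b i) powr s) / (1 - s) + 4 * B"
  define c0 where "c0 = 1 / (2 * real n * fact n)"
  have B: "B \<ge> 0"
    unfolding B_def by (intro suminf_nonneg summable_b) auto
  have Q: "Q \<ge> 0"
    unfolding Q_def using B s by (intro add_nonneg_nonneg divide_nonneg_nonneg mult_nonneg_nonneg
        suminf_nonneg summable_b_s) auto
  have c0: "c0 > 0"
    using n by (simp add: c0_def)
  have cb: "coeff_bound \<ge> 1"
    by (simp add: coeff_bound_def sum_nonneg)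
  define D where "D = Q + 2 * m + 2 * B + \<bar>ln c0\<bar> + 6 * coeff_bound * n + 1"
  have D: "D > 0"
    unfolding D_def using Q B cb by (intro add_nonneg_pos add_nonneg_nonneg) auto
  show ?thesis
  proof (rule that[of "5 * D"])
    show "5 * D > 0"
      using D by simp
    fix z0 :: complex and r \<Lambda> :: real
    assume r: "1 \<le> r" "16 * r \<le> norm z0" and \<Lambda>: "1 \<le> \<Lambda>"
      and W_le: "\<And>z. norm (z - z0) \<le> 6 * r \<Longrightarrow> norm (W z) \<le> \<Lambda> ^ n"
    define R where "R = norm z0"
    have R: "R \<ge> 16"
      using r by (simp add: R_def)
    have jet_pos: "weighted_jet \<Lambda> z0 > 0"
      by (rule weighted_jet_pos[OF \<Lambda> _ W_le]) (use r in auto)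
    define \<sigma> where "\<sigma> = sqrt (weighted_jet \<Lambda> z0)"
    have \<sigma>: "\<sigma> > 0"
      using jet_pos by (simp add: \<sigma>_def)
    define e where "e = 6 * \<Lambda> * coeff_bound * n * r"
    define M where "M = \<sigma> * exp e"
    have M: "M > 0" "ln M = ln \<sigma> + e"
      using \<sigma> by (simp_all add: M_def ln_mult)
    have f_le: "norm (f z) \<le> M" if z: "norm (z - z0) \<le> 6 * r" for z
    proof -
      have "(norm (f z))\<^sup>2 = (norm ((deriv ^^ 0) f z / of_real (\<Lambda> ^ 0)))\<^sup>2"
        by simp
      also have "\<dots> \<le> weighted_jet \<Lambda> z"
        unfolding weighted_jet_def by (rule member_le_sum[of 0]) (use n in auto)
      also have "\<dots> \<le> weighted_jet \<Lambda> z0 * exp (2 * (\<Lambda> * coeff_bound) * n * norm (z - z0))"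
        by (rule weighted_jet_growth[OF \<Lambda> W_le z])
      also have "\<dots> \<le> weighted_jet \<Lambda> z0 * exp (2 * (\<Lambda> * coeff_bound) * n * (6 * r))"
      proof -
        have "2 * (\<Lambda> * coeff_bound) * n * norm (z - z0) \<le> 2 * (\<Lambda> * coeff_bound) * n * (6 * r)"
          using \<Lambda> cb by (intro mult_left_mono z mult_nonneg_nonneg) auto
        thus ?thesis
          using jet_pos by (intro mult_left_mono) auto
      qed
      also have "2 * (\<Lambda> * coeff_bound) * n * (6 * r) = 2 * e"
        by (simp add: e_def)
      also have "weighted_jet \<Lambda> z0 * exp (2 * e) = M\<^sup>2"
        using jet_pos by (simp add: M_def \<sigma>_def power_mult_distrib exp_double)
      finally show ?thesis
        by (rule power2_le_imp_le) (use M in simp)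
    qed
    obtain z1 where z1: "norm (z1 - z0) \<le> 1 / \<Lambda>" "norm (f z1) \<ge> \<sigma> * c0"
      by (rule exists_large_value[OF \<Lambda> jet_pos], rule that) (simp_all add: \<sigma>_def c0_def)
    have "1 / \<Lambda> \<le> 1"
      using \<Lambda> by simp
    hence z1r: "norm (z1 - z0) \<le> r"
      using z1 r by linarith
    have z1R: "norm z1 \<le> 2 * R"
      using norm_triangle_sub[of z1 z0] z1r r by (simp add: R_def)
    have low: "ln \<sigma> + ln c0 - 2 * m * R - 2 * B * R \<le> Re (h z1)"
    proof -
      have "\<sigma> * c0 \<le> norm z1 ^ m * norm (canonical_product b z1) * exp (Re (h z1))"
        using z1(2) by (simp add: f_eq norm_mult norm_power)
      also have "\<dots> \<le> exp (2 * m * R) * exp (2 * B * R) * exp (Re (h z1))"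
      proof (intro mult_mono)
        have "norm z1 \<le> exp (2 * R)"
          using z1R exp_ge_add_one_self[of "2 * R"] by linarith
        hence "norm z1 ^ m \<le> exp (2 * R) ^ m"
          by (rule power_mono) simp
        also have "\<dots> = exp (m * (2 * R))"
          by (rule exp_of_nat_mult[symmetric])
        finally show "norm z1 ^ m \<le> exp (2 * m * R)"
          by (simp add: mult_ac)
        have "norm (canonical_product b z1) \<le> exp (norm z1 * B)"
          unfolding B_def by (rule norm_canonical_product_le[OF summable_b])
        also have "\<dots> \<le> exp (2 * B * R)"
          using mult_right_mono[OF z1R B] by (simp add: mult_ac)
        finally show "norm (canonical_product b z1) \<le> exp (2 * B * R)" .
      qed auto
      also have "\<dots> = exp (2 * m * R + 2 * B * R + Re (h z1))"
        by (simp add: exp_add)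
      finally have "ln (\<sigma> * c0) \<le> 2 * m * R + 2 * B * R + Re (h z1)"
        using \<sigma> c0 ln_le_cancel_iff[of "\<sigma> * c0" "exp (2 * m * R + 2 * B * R + Re (h z1))"] by simp
      thus ?thesis
        using \<sigma> c0 by (simp add: ln_mult)
    qed
    define H where "H = D * (\<Lambda> * r + R)"
    have H: "H > 0"
      unfolding H_def using D \<Lambda> r R by (intro mult_pos_pos add_pos_pos) auto
    have "norm (deriv h z0) \<le> 5 * H / r"
    proof (rule borel_caratheodory_deriv[OF h H, where a = z1])
      show "norm (z0 - z1) \<le> r"
        using z1r by (simp add: norm_minus_commute)
      fix z assume "norm (z - z1) < 3 * r"
      hence z: "norm (z - z0) \<le> 4 * r"
        using norm_triangle_ineq[of "z - z1" "z1 - z0"] z1r by simp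
      have "Re (h z) \<le> ln M + Q * R"
        using Re_h_upper_bound[OF r M(1) f_le z] by (simp add: Q_def B_def R_def)
      hence "Re (h z - h z1) \<le> e + Q * R - ln c0 + 2 * m * R + 2 * B * R"
        using low M(2) by simp
      also have "\<dots> < H"
      proof -
        have "- ln c0 \<le> \<bar>ln c0\<bar> * R"
          using R mult_left_mono[of 1 R "\<bar>ln c0\<bar>"] by linarith
        moreover have "H = (6 * coeff_bound * n) * (\<Lambda> * r) + (Q + 2 * m + 2 * B + \<bar>ln c0\<bar> + 1) * (\<Lambda> * r)
            + (Q + 2 * m + 2 * B + \<bar>ln c0\<bar>) * R + (6 * coeff_bound * n) * R + R"
          by (simp add: H_def D_def algebra_simps)
        moreover have "0 \<le> (Q + 2 * m + 2 * B + \<bar>ln c0\<bar> + 1) * (\<Lambda> * r)"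
          using Q B \<Lambda> r by (intro mult_nonneg_nonneg add_nonneg_nonneg) auto
        moreover have "0 \<le> (6 * coeff_bound * n) * R"
          using cb R by (intro mult_nonneg_nonneg) auto
        moreover have "e = (6 * coeff_bound * n) * (\<Lambda> * r)"
          by (simp add: e_def)
        ultimately show ?thesis
          using R by (simp add: algebra_simps)
      qed
      finally show "Re (h z - h z1) < H" .
    qed (use r in auto)
    also have "\<dots> = 5 * D * (\<Lambda> + norm z0 / r)"
      using r by (simp add: H_def R_def field_simps)
    finally show "norm (deriv h z0) \<le> 5 * D * (\<Lambda> + norm z0 / r)" .
  qed
qed

end

section \<open>Order estimates in sectors\<close>

lemma eventually_conic_cball_fixed:
  assumes "eventually P (conic d)"
  shows "eventually (\<lambda>z. \<forall>w. norm (w - z) \<le> r \<longrightarrow> P w) (conic d)"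
proof -
  obtain \<eta> where \<eta>: "\<eta> > 0" "\<eta> < 1"
    "eventually (\<lambda>z. \<forall>w. norm (w - z) \<le> \<eta> * norm z \<longrightarrow> P w) (conic d)"
    using eventually_conic_cball[OF assms] .
  from eventually_norm_conic[of "r / \<eta>" d] \<eta>(3) show ?thesis
  proof eventually_elim
    case (elim z)
    have "r \<le> \<eta> * norm z"
      using elim(1) \<eta>(1) by (simp add: field_simps)
    thus ?case
      using elim(2) by auto
  qed
qed

lemma norm_exp_shift_le:
  fixes w z \<omega> :: complex
  assumes "norm (w - z) \<le> r"
  shows "norm (exp (\<omega> * w)) \<le> exp (norm \<omega> * r) * norm (exp (\<omega> * z))"
proof -
  have "Re (\<omega> * w) = Re (\<omega> * z) + Re (\<omega> * (w - z))"
    by (simp add: algebra_simps)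
  also have "Re (\<omega> * (w - z)) \<le> norm \<omega> * norm (w - z)"
    using complex_Re_le_cmod[of "\<omega> * (w - z)"] by (simp only: norm_mult)
  also have "\<dots> \<le> norm \<omega> * r"
    by (intro mult_left_mono assms) auto
  finally show ?thesis
    by (simp add: norm_exp_eq_Re add.commute flip: exp_add)
qed

text \<open>Cauchy's estimate on unit discs: these stay in a slightly larger sector, and the
  exponential varies on them by a bounded factor only.\<close>

lemma bigo_conic_deriv:
  assumes g: "g holomorphic_on UNIV" and bd: "g \<in> O[conic d](\<lambda>z. exp (\<omega> * z))"
  shows "deriv g \<in> O[conic d](\<lambda>z. exp (\<omega> * z))"
proof -
  obtain c where c: "c > 0" "eventually (\<lambda>z. norm (g z) \<le> c * norm (exp (\<omega> * z))) (conic d)"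
    using landau_o.bigE[OF bd] by blast
  show ?thesis
  proof (rule landau_o.bigI[of "2 * c * exp (norm \<omega>)"])
    show "eventually (\<lambda>z. norm (deriv g z) \<le> 2 * c * exp (norm \<omega>) * norm (exp (\<omega> * z))) (conic d)"
      using eventually_conic_cball_fixed[OF c(2), of 1]
    proof eventually_elim
      case (elim z)
      have "norm ((deriv ^^ 1) g z) \<le> fact 1 * (2 * c * exp (norm \<omega>) * norm (exp (\<omega> * z))) / 1 ^ 1"
      proof (rule Cauchy_higher_deriv_bound[where y = 0])
        fix w assume w: "w \<in> ball z 1"
        hence "norm (w - z) \<le> 1"
          by (simp add: dist_norm norm_minus_commute)
        hence "norm (g w) \<le> c * (exp (norm \<omega> * 1) * norm (exp (\<omega> * z)))"
          using elim c(1) norm_exp_shift_le[of w z 1 \<omega>]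
          by (meson mult_left_mono order_trans less_imp_le)
        also have "\<dots> < 2 * c * exp (norm \<omega>) * norm (exp (\<omega> * z))"
          using c(1) by simp
        finally show "g w \<in> ball 0 (2 * c * exp (norm \<omega>) * norm (exp (\<omega> * z)))"
          by simp
      qed (auto intro!: holomorphic_on_imp_continuous_on holomorphic_on_subset[OF g])
      thus ?case
        by simp
    qed
  qed (use c in simp)
qed

lemma bigo_conic_exp_mono:
  assumes "Re (\<omega> * d) < Re (\<omega>' * d)"
  shows "(\<lambda>z. exp (\<omega> * z)) \<in> O[conic d](\<lambda>z. exp (\<omega>' * z))"
proof (rule landau_o.bigI[of 1])
  have "Re ((\<omega> - \<omega>') * d) < 0"
    using assms by (simp add: algebra_simps)
  from eventually_norm_exp_conic_le[OF this]
  show "eventually (\<lambda>z. norm (exp (\<omega> * z)) \<le> 1 * norm (exp (\<omega>' * z))) (conic d)"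
  proof (rule eventually_mono)
    fix z assume *: "norm (exp ((\<omega> - \<omega>') * z)) \<le> exp (0 * norm z)"
    have "norm (exp (\<omega> * z)) = norm (exp ((\<omega> - \<omega>') * z)) * norm (exp (\<omega>' * z))"
      by (simp add: algebra_simps flip: norm_mult exp_add)
    also have "\<dots> \<le> 1 * norm (exp (\<omega>' * z))"
      using * by (intro mult_right_mono) auto
    finally show "norm (exp (\<omega> * z)) \<le> 1 * norm (exp (\<omega>' * z))" .
  qed
qed simp

text \<open>Absorbs the term |z0| / r in the bound on \<open>deriv h\<close> when
  \<open>r = 1\<close>.\<close>

lemma bigo_conic_norm_exp:
  assumes "Re (\<omega> * d) > 0"
  shows "(\<lambda>z. of_real (norm z)) \<in> O[conic d](\<lambda>z. exp (\<omega> * z))"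
proof -
  define \<delta> where "\<delta> = Re (\<omega> * d) / 2"
  have \<delta>: "\<delta> > 0" "\<delta> < Re (\<omega> * d)"
    using assms by (auto simp: \<delta>_def)
  show ?thesis
  proof (rule landau_o.bigI[of "1 / \<delta>"])
    show "eventually (\<lambda>z. norm (of_real (norm z) :: complex) \<le> 1 / \<delta> * norm (exp (\<omega> * z))) (conic d)"
      using eventually_norm_exp_conic_ge[OF \<delta>(2)]
    proof eventually_elim
      case (elim z)
      have "\<delta> * norm z \<le> norm (exp (\<omega> * z))"
        using elim exp_ge_add_one_self[of "\<delta> * norm z"] by linarith
      thus ?case
        using \<delta> by (simp add: field_simps)
    qed
  qed (use \<delta> in simp)
qed

context factored_solution
begin

abbreviation "v \<equiv> deriv h"

lemma v: "v holomorphic_on A"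
  by (rule holomorphic_on_subset[OF holomorphic_deriv[OF h open_UNIV]]) auto

text \<open>A crude version with radius 1 and \<open>\<Lambda>\<close> bounding |W| itself; all that
  matters here is finite exponential type, as input to Phragmen-Lindelof.\<close>

lemma v_exp_type:
  assumes A: "A > 0" "\<And>z. norm (W z) \<le> A * exp (A * norm z)"
  obtains C where "C > 0" "\<And>z. norm (v z) \<le> C * exp (C * norm z)"
proof -
  obtain C where C: "C > 0"
    "\<And>z0 r \<Lambda>. 1 \<le> r \<Longrightarrow> 16 * r \<le> norm z0 \<Longrightarrow> 1 \<le> \<Lambda> \<Longrightarrow>
      (\<And>z. norm (z - z0) \<le> 6 * r \<Longrightarrow> norm (W z) \<le> \<Lambda> ^ n) \<Longrightarrow>
      norm (v z0) \<le> C * (\<Lambda> + norm z0 / r)"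
    by (rule deriv_h_bound) (rule that, assumption, blast)
  have "compact (v ` cball 0 16)"
    by (intro compact_continuous_image holomorphic_on_imp_continuous_on v) auto
  then obtain B where B: "\<And>z. norm z \<le> 16 \<Longrightarrow> norm (v z) \<le> B"
    by (meson bounded_iff compact_imp_bounded imageI mem_cball_0)
  define D where "D = max (max B 1) (max (1 + A) (C * (2 + A * exp (6 * A))))"
  have D: "D > 0" "B \<le> D" "1 + A \<le> D" "C * (2 + A * exp (6 * A)) \<le> D"
    by (auto simp: D_def)
  have "norm (v z) \<le> D * exp (D * norm z)" for z
  proof (cases "norm z \<le> 16")
    case True
    have "norm (v z) \<le> D * 1"
      using B[OF True] D by simp
    also have "\<dots> \<le> D * exp (D * norm z)"
      using D by (intro mult_left_mono) auto
    finally show ?thesis .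
  next
    case False
    define \<Lambda> where "\<Lambda> = 1 + A * exp (6 * A) * exp (A * norm z)"
    have \<Lambda>: "\<Lambda> \<ge> 1"
      using A by (simp add: \<Lambda>_def)
    have "norm (v z) \<le> C * (\<Lambda> + norm z / 1)"
    proof (rule C(2))
      fix w assume w: "norm (w - z) \<le> 6 * 1"
      have "norm w \<le> 6 + norm z"
        using w norm_triangle_sub[of w z] by simp
      hence "exp (A * norm w) \<le> exp (A * (6 + norm z))"
        using A by simp
      hence "norm (W w) \<le> A * exp (A * (6 + norm z))"
        using A(2)[of w] A(1) by (meson mult_left_mono order_trans less_imp_le)
      also have "\<dots> = A * exp (6 * A) * exp (A * norm z)"
        by (simp add: algebra_simps exp_add)
      also have "\<dots> \<le> \<Lambda>"
        by (simp add: \<Lambda>_def)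
      also have "\<dots> \<le> \<Lambda> ^ n"
        using \<Lambda> n by (intro self_le_power) auto
      finally show "norm (W w) \<le> \<Lambda> ^ n" .
    qed (use False \<Lambda> in auto)
    also have "\<Lambda> + norm z / 1 \<le> (2 + A * exp (6 * A)) * exp ((1 + A) * norm z)"
    proof -
      have "norm z \<le> exp (norm z)"
        using exp_ge_add_one_self[of "norm z"] by linarith
      also have "\<dots> \<le> exp ((1 + A) * norm z)"
        using A by (simp add: algebra_simps)
      finally have 1: "norm z \<le> exp ((1 + A) * norm z)" .
      have 2: "exp (A * norm z) \<le> exp ((1 + A) * norm z)"
        by (simp add: algebra_simps)
      have "A * exp (6 * A) * exp (A * norm z) \<le> A * exp (6 * A) * exp ((1 + A) * norm z)"
        using A by (intro mult_left_mono 2) auto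
      moreover have "1 \<le> exp ((1 + A) * norm z)"
        using A by simp
      ultimately have "1 + A * exp (6 * A) * exp (A * norm z) + norm z \<le>
          2 * exp ((1 + A) * norm z) + A * exp (6 * A) * exp ((1 + A) * norm z)"
        using 1 by linarith
      thus ?thesis
        by (simp only: \<Lambda>_def distrib_right div_by_1)
    qed
    also have "C * ((2 + A * exp (6 * A)) * exp ((1 + A) * norm z)) \<le> D * exp (D * norm z)"
    proof -
      have "exp ((1 + A) * norm z) \<le> exp (D * norm z)"
        using D by (simp add: mult_right_mono)
      thus ?thesis
        unfolding mult.assoc[symmetric] using D by (intro mult_mono) auto
    qed
    finally show ?thesis
      using C(1) by (simp add: mult_left_mono)
  qed
  thus ?thesis
    using that D(1) by blast
qed

text \<open>The radius is taken proportional to |z|, which keeps |z| / r bounded; radius 1 would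
  leave a linear term.\<close>

lemma v_bounded_conic:
  assumes A: "eventually (\<lambda>z. norm (W z) \<le> A) (conic d)"
  obtains B where "eventually (\<lambda>z. norm (v z) \<le> B) (conic d)"
proof -
  obtain C where C: "C > 0"
    "\<And>z0 r \<Lambda>. 1 \<le> r \<Longrightarrow> 16 * r \<le> norm z0 \<Longrightarrow> 1 \<le> \<Lambda> \<Longrightarrow>
      (\<And>z. norm (z - z0) \<le> 6 * r \<Longrightarrow> norm (W z) \<le> \<Lambda> ^ n) \<Longrightarrow>
      norm (v z0) \<le> C * (\<Lambda> + norm z0 / r)"
    by (rule deriv_h_bound) (rule that, assumption, blast)
  obtain \<eta> where \<eta>: "\<eta> > 0" "\<eta> < 1"
    "eventually (\<lambda>z. \<forall>w. norm (w - z) \<le> \<eta> * norm z \<longrightarrow> norm (W w) \<le> A) (conic d)"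
    using eventually_conic_cball[OF A] .
  define \<Lambda> where "\<Lambda> = max 1 A"
  from eventually_norm_conic[of "16 / \<eta>" d] \<eta>(3)
  have "eventually (\<lambda>z. norm (v z) \<le> C * (\<Lambda> + 16 / \<eta>)) (conic d)"
  proof eventually_elim
    case (elim z)
    \<comment> \<open>From \<eta> < 1 follows 16 r \<le> |z|; also 6 r \<le> \<eta> |z| keeps the
      disc where \<open>W\<close> is bounded, and |z| > 16 / \<eta> makes r at least 1.\<close>
    define r where "r = \<eta> / 16 * norm z"
    have z: "norm z > 0"
      using elim(1) \<eta> by (smt (verit) divide_pos_pos)
    have r: "1 \<le> r" "16 * r \<le> norm z" "6 * r \<le> \<eta> * norm z"
      using elim(1) \<eta> z by (simp_all add: r_def field_simps)
    have "norm (v z) \<le> C * (\<Lambda> + norm z / r)"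
    proof (rule C(2)[OF r(1,2)])
      fix w assume "norm (w - z) \<le> 6 * r"
      hence "norm (w - z) \<le> \<eta> * norm z"
        using r by linarith
      hence "norm (W w) \<le> \<Lambda>"
        using elim(2) by (simp add: \<Lambda>_def le_max_iff_disj)
      also have "\<dots> \<le> \<Lambda> ^ n"
        using n by (intro self_le_power) (auto simp: \<Lambda>_def)
      finally show "norm (W w) \<le> \<Lambda> ^ n" .
    qed (simp add: \<Lambda>_def)
    also have "norm z / r = 16 / \<eta>"
      using z \<eta> by (simp add: r_def)
    finally show ?case .
  qed
  thus ?thesis
    using that by blast
qed

text \<open>Radius 1 is enough: on such discs exp (p z) varies by a bounded factor, so
  \<open>\<Lambda>\<close> can be a multiple of |exp (p z / n)|, and the leftover |z| is dominated
  by that growing exponential.\<close>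

lemma v_bigo_conic:
  assumes p: "Re (p * d) > 0" and W_O: "W \<in> O[conic d](\<lambda>z. exp (p * z))"
  shows "v \<in> O[conic d](\<lambda>z. exp (p / of_nat n * z))"
proof -
  obtain C where C: "C > 0"
    "\<And>z0 r \<Lambda>. 1 \<le> r \<Longrightarrow> 16 * r \<le> norm z0 \<Longrightarrow> 1 \<le> \<Lambda> \<Longrightarrow>
      (\<And>z. norm (z - z0) \<le> 6 * r \<Longrightarrow> norm (W z) \<le> \<Lambda> ^ n) \<Longrightarrow>
      norm (v z0) \<le> C * (\<Lambda> + norm z0 / r)"
    by (rule deriv_h_bound) (rule that, assumption, blast)
  obtain c where c: "c > 0" "eventually (\<lambda>z. norm (W z) \<le> c * norm (exp (p * z))) (conic d)"
    using landau_o.bigE[OF W_O] by blast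
  define K where "K = max 1 (c * exp (norm p * 6))"
  have K: "K \<ge> 1" "c * exp (norm p * 6) \<le> K"
    by (auto simp: K_def)
  have pn: "Re (p / of_nat n * d) > 0"
  proof -
    have "p / of_nat n * d = (p * d) / of_nat n"
      by simp
    thus ?thesis
      using p n by (simp only: Re_divide_of_nat) simp
  qed
  have e1: "eventually (\<lambda>z. exp (0 * norm z) \<le> norm (exp (p / of_nat n * z))) (conic d)"
    by (rule eventually_norm_exp_conic_ge[OF pn])
  have "eventually (\<lambda>z. norm (v z) \<le> C * K * norm (exp (p / of_nat n * z)) + C * norm z) (conic d)"
    using eventually_conic_cball_fixed[OF c(2), of 6] e1 eventually_norm_conic[of 16 d]
  proof eventually_elim
    case (elim z)
    define \<Lambda> where "\<Lambda> = K * norm (exp (p / of_nat n * z))"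
    have "norm (v z) \<le> C * (\<Lambda> + norm z / 1)"
    proof (rule C(2))
      have "1 * 1 \<le> \<Lambda>"
        unfolding \<Lambda>_def using K elim(2) by (intro mult_mono) auto
      thus "1 \<le> \<Lambda>"
        by simp
      fix w assume w: "norm (w - z) \<le> 6 * 1"
      hence "norm (W w) \<le> c * norm (exp (p * w))"
        using elim(1) by simp
      also have "\<dots> \<le> c * (exp (norm p * 6) * norm (exp (p * z)))"
        using c(1) w by (intro mult_left_mono norm_exp_shift_le) auto
      also have "\<dots> \<le> K ^ n * norm (exp (p * z))"
      proof -
        have "c * exp (norm p * 6) \<le> K ^ n"
          using K self_le_power[of K n] n by linarith
        thus ?thesis
          unfolding mult.assoc[symmetric] by (rule mult_right_mono) auto
      qed
      also have "norm (exp (p * z)) = norm (exp (p / of_nat n * z)) ^ n"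
        using n by (simp flip: norm_power exp_of_nat_mult)
      finally show "norm (W w) \<le> \<Lambda> ^ n"
        by (simp add: \<Lambda>_def power_mult_distrib)
    qed (use elim in auto)
    thus ?case
      by (simp add: \<Lambda>_def algebra_simps)
  qed
  hence ev: "eventually (\<lambda>z. norm (v z) \<le> 1 * norm (of_real (C * K * norm (exp (p / of_nat n * z)) + C * norm z) :: complex)) (conic d)"
  proof (rule eventually_mono)
    fix z assume *: "norm (v z) \<le> C * K * norm (exp (p / of_nat n * z)) + C * norm z"
    hence "0 \<le> C * K * norm (exp (p / of_nat n * z)) + C * norm z"
      using norm_ge_zero order_trans by blast
    thus "norm (v z) \<le> 1 * norm (of_real (C * K * norm (exp (p / of_nat n * z)) + C * norm z) :: complex)"
      using * by (simp only: norm_of_real) simp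
  qed
  have "v \<in> O[conic d](\<lambda>z. of_real (C * K * norm (exp (p / of_nat n * z)) + C * norm z))"
    by (rule landau_o.bigI[OF _ ev]) simp
  also have "(\<lambda>z. of_real (C * K * norm (exp (p / of_nat n * z)) + C * norm z)) \<in>
      O[conic d](\<lambda>z. exp (p / of_nat n * z))"
  proof -
    have "(\<lambda>z. of_real (C * K) * of_real (norm (exp (p / of_nat n * z))) + of_real C * of_real (norm z) :: complex) \<in>
        O[conic d](\<lambda>z. exp (p / of_nat n * z))"
    proof (intro sum_in_bigo)
      show "(\<lambda>z. of_real (C * K) * of_real (norm (exp (p / of_nat n * z))) :: complex) \<in>
        O[conic d](\<lambda>z. exp (p / of_nat n * z))"
        by (rule landau_o.bigI[of "norm (of_real (C * K) :: complex) + 1"])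
          (auto simp: norm_mult add_nonneg_pos mult_right_mono)
      show "(\<lambda>z. of_real C * of_real (norm z) :: complex) \<in> O[conic d](\<lambda>z. exp (p / of_nat n * z))"
        using bigo_conic_norm_exp[OF pn] C(1) by simp
    qed
    thus ?thesis
      by simp
  qed
  finally show ?thesis .
qed


definition \<kappa> :: "complex \<Rightarrow> complex" where
  "\<kappa> z = z ^ m * canonical_product b z"

lemma \<kappa>: "\<kappa> holomorphic_on A"
  unfolding \<kappa>_def[abs_def] by (intro holomorphic_intros canonical_product_holomorphic[OF summable_b])

lemma f_eq_\<kappa>: "f = (\<lambda>z. \<kappa> z * exp (h z))"
  by (auto simp: f_eq \<kappa>_def)

text \<open>
  On suitable circles around every point, of radius comparable to \<open>|z0|\<close>, the logarithmic
  derivatives of \<open>\<kappa>\<close> of all orders tend to 0; this is where order less than 1 enters.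
\<close>

lemma \<kappa>_log_deriv_small:
  assumes \<eta>: "0 < \<eta>" "\<eta> \<le> 1 / 2"
  obtains \<epsilon> where "(\<epsilon> \<longlongrightarrow> 0) at_top"
    "\<And>z0. z0 \<noteq> 0 \<Longrightarrow> \<exists>t. \<eta> / 2 * norm z0 \<le> t \<and> t \<le> \<eta> * norm z0 \<and>
      (\<forall>z j. norm (z - z0) = t \<longrightarrow> \<kappa> z \<noteq> 0 \<and> norm ((deriv ^^ j) \<kappa> z) \<le> \<epsilon> (norm z0) ^ j * norm (\<kappa> z))"
proof -
  define S where "S = (\<Sum>i. norm (b i) powr s)"
  \<comment> \<open>Strictly between \<open>s\<close> and 1: p < 1 makes the averaged kernel
    integrable, and s < p makes R^(s/p - 1) tend to 0.\<close>
  define p where "p = (1 + s) / 2"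
  have p: "0 < p" "p < 1" "s < p"
    using s by (auto simp: p_def)
  have S: "S \<ge> 0"
    unfolding S_def by (intro suminf_nonneg summable_b_s) auto
  \<comment> \<open>The summands account for the zero at the origin, for the zeros of modulus below
    \<open>4 * R\<close>, and for all remaining ones.\<close>
  define \<epsilon> where "\<epsilon> R = 2 * real m / R +
      ((8 * ((4 * R) powr s * S) / (1 - p)) powr (1 / p) / (\<eta> / 2 * R) + 2 * S * (4 * R) powr (s - 1))" for R
  show ?thesis
  proof (rule that[of \<epsilon>])
    have "((\<lambda>R. 2 * real m / R) \<longlongrightarrow> 0) at_top"
      by real_asymp
    moreover have "((\<lambda>R. (8 * ((4 * R) powr s * S) / (1 - p)) powr (1 / p) / (\<eta> / 2 * R)) \<longlongrightarrow> 0) at_top"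
    proof -
      define D where "D = (8 * S * 4 powr s / (1 - p)) powr (1 / p) / (\<eta> / 2)"
      define q where "q = s / p - 1"
      have q: "q < 0"
        using p by (simp add: q_def)
      have "((\<lambda>R::real. D * R powr q) \<longlongrightarrow> 0) at_top"
        using q by (intro tendsto_mult_right_zero tendsto_neg_powr filterlim_ident)
      moreover have "eventually (\<lambda>R. D * R powr q =
          (8 * ((4 * R) powr s * S) / (1 - p)) powr (1 / p) / (\<eta> / 2 * R)) at_top"
        using eventually_gt_at_top[of 0]
      proof eventually_elim
        case (elim R)
        have "8 * ((4 * R) powr s * S) / (1 - p) = (8 * S * 4 powr s / (1 - p)) * R powr s"
          by (simp add: powr_mult)
        hence "(8 * ((4 * R) powr s * S) / (1 - p)) powr (1 / p) =
            (8 * S * 4 powr s / (1 - p)) powr (1 / p) * R powr (s / p)"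
          by (simp only: powr_mult powr_powr) simp
        moreover have "R powr q = R powr (s / p) / R"
          using elim by (simp add: q_def powr_diff)
        ultimately show ?case
          by (simp add: D_def)
      qed
      ultimately show ?thesis
        by (rule Lim_transform_eventually)
    qed
    moreover have "((\<lambda>R. 2 * S * (4 * R) powr (s - 1)) \<longlongrightarrow> 0) at_top"
    proof (intro tendsto_mult_right_zero tendsto_neg_powr)
      show "filterlim (\<lambda>R::real. 4 * R) at_top at_top"
        by real_asymp
    qed (use s in simp)
    ultimately show "(\<epsilon> \<longlongrightarrow> 0) at_top"
      unfolding \<epsilon>_def by (intro tendsto_add_zero)
    fix z0 :: complex assume z0: "z0 \<noteq> 0"
    define R where "R = norm z0"
    have R: "R > 0"
      using z0 by (simp add: R_def)
    define T where "T = 4 * R"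
    have T: "T > 0"
      using R by (simp add: T_def)
    define K where "K = {i. norm (b i) > 1 / T}"
    have K: "finite K" "real (card K) \<le> T powr s * S"
      using card_large_b[OF T] by (simp_all add: K_def S_def)
    have bK: "b i \<noteq> 0" if "i \<in> K" for i
      using that T by (auto simp: K_def)
    \<comment> \<open>The distances of the zeros from \<open>z0\<close>; the averaging lemma picks a
      radius \<open>t\<close> that stays away from all of them.\<close>
    define c where "c i = norm (inverse (b i) - z0)" for i
    obtain t where t: "\<eta> / 2 * R \<le> t" "t \<le> \<eta> / 2 * R + \<eta> / 2 * R" "\<And>i. i \<in> K \<Longrightarrow> t \<noteq> c i"
      "(\<Sum>i\<in>K. 1 / \<bar>t - c i\<bar>) \<le> (8 * real (card K) / (1 - p)) powr (1 / p) / (\<eta> / 2 * R)"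
      by (rule exists_sum_inverse_distance_le[OF p(1,2) K(1), of "\<eta> / 2 * R" "\<eta> / 2 * R" c])
        (use \<eta> R in auto)
    have "\<kappa> z \<noteq> 0 \<and> norm ((deriv ^^ j) \<kappa> z) \<le> \<epsilon> R ^ j * norm (\<kappa> z)" if z: "norm (z - z0) = t" for z j
    proof -
      have "\<eta> * R \<le> 1 / 2 * R"
        using \<eta> R by (intro mult_right_mono) auto
      moreover have "t \<le> \<eta> * R"
        using t(2) by (simp add: mult.commute)
      ultimately have tR: "t \<le> R / 2"
        by linarith
      have "norm z \<le> R + t" "R \<le> norm z + t"
        using norm_triangle_sub[of z z0] norm_triangle_sub[of z0 z] z
        by (simp_all add: R_def norm_minus_commute)
      hence zR: "norm z \<le> 2 * R" "norm z \<ge> R / 2"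
        using tR by auto
      have z_nz: "z \<noteq> 0"
        using zR R by auto
      define g where "g i = (if i \<in> K then 1 / \<bar>t - c i\<bar> else 0)" for i
      have large: "b i * z \<noteq> 1 \<and> norm (b i) / norm (1 - b i * z) \<le> g i" if i: "i \<in> K" for i
      proof -
        have eq: "1 - b i * z = b i * (inverse (b i) - z)"
          using bK[OF i] by (simp add: algebra_simps)
        have tri: "\<bar>norm (z - z0) - norm (inverse (b i) - z0)\<bar> \<le> norm ((z - z0) - (inverse (b i) - z0))"
          by (rule norm_triangle_ineq3)
        have ge: "\<bar>t - c i\<bar> \<le> norm (inverse (b i) - z)"
        proof -
          have "(z - z0) - (inverse (b i) - z0) = - (inverse (b i) - z)"
            by simp
          thus ?thesis
            using tri unfolding z c_def by (simp only: norm_minus_cancel)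
        qed
        moreover have pos: "\<bar>t - c i\<bar> > 0"
          using t(3)[OF i] by simp
        ultimately have "norm (inverse (b i) - z) > 0"
          by linarith
        hence "1 - b i * z \<noteq> 0"
          unfolding eq using bK[OF i] by auto
        moreover have "norm (b i) / norm (1 - b i * z) = 1 / norm (inverse (b i) - z)"
          unfolding eq using bK[OF i] by (simp add: norm_mult)
        moreover have "1 / norm (inverse (b i) - z) \<le> 1 / \<bar>t - c i\<bar>"
          using ge pos by (intro divide_left_mono mult_pos_pos) auto
        ultimately show ?thesis
          using i by (simp add: g_def)
      qed
      have small: "b i * z \<noteq> 1 \<and> norm (b i) / norm (1 - b i * z) \<le> 2 * (norm (b i) powr s * T powr (s - 1))"
        if i: "i \<notin> K" for i
      proof -
        have bi: "norm (b i) \<le> 1 / T"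
          using i by (simp add: K_def)
        have "norm (b i * z) \<le> 1 / T * (2 * R)"
          unfolding norm_mult using bi zR T by (intro mult_mono) auto
        hence half: "norm (b i * z) \<le> 1 / 2"
          using R by (simp add: T_def)
        have ge: "norm (1 - b i * z) \<ge> 1 / 2"
          using norm_triangle_ineq2[of 1 "b i * z"] half by simp
        \<comment> \<open>Part of the exponent is traded for the decaying factor T^(s-1), while the
          power \<open>s\<close> that remains is summable.\<close>
        have "norm (b i) = norm (b i) powr s * norm (b i) powr (1 - s)"
          unfolding powr_add[symmetric] by simp
        also have "\<dots> \<le> norm (b i) powr s * (1 / T) powr (1 - s)"
          using bi s by (intro mult_left_mono powr_mono2) auto
        also have "(1 / T) powr (1 - s) = T powr (s - 1)"
          using T by (simp add: powr_divide powr_diff)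
        finally have "norm (b i) \<le> norm (b i) powr s * T powr (s - 1)" .
        moreover have "norm (b i) / norm (1 - b i * z) \<le> norm (b i) / (1 / 2)"
          using ge by (intro divide_left_mono) auto
        moreover have "b i * z \<noteq> 1"
          using ge by auto
        ultimately show ?thesis
          by simp
      qed
      have nz: "b i * z \<noteq> 1" for i
        using large small by blast
      define G where "G i = g i + 2 * (norm (b i) powr s * T powr (s - 1))" for i
      have le_G: "norm (b i) / norm (1 - b i * z) \<le> G i" for i
      proof (cases "i \<in> K")
        case True
        have "0 \<le> 2 * (norm (b i) powr s * T powr (s - 1))"
          by simp
        thus ?thesis
          using large[OF True] unfolding G_def by linarith
      next
        case False
        thus ?thesis
          using small[OF False] by (simp add: G_def g_def)
      qed
      have g_sums: "g sums (\<Sum>i\<in>K. 1 / \<bar>t - c i\<bar>)"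
        unfolding g_def by (rule sums_If_finite_set[OF K(1)])
      have "(\<lambda>i. norm (b i) powr s) sums S"
        unfolding S_def by (rule summable_sums[OF summable_b_s])
      hence "(\<lambda>i. 2 * (norm (b i) powr s * T powr (s - 1))) sums (2 * (S * T powr (s - 1)))"
        by (intro sums_mult sums_mult2)
      hence G_sums: "G sums ((\<Sum>i\<in>K. 1 / \<bar>t - c i\<bar>) + 2 * (S * T powr (s - 1)))"
        unfolding G_def by (rule sums_add[OF g_sums])
      have sm: "summable (\<lambda>i. norm (b i) / norm (1 - b i * z))"
        by (rule summable_comparison_test'[OF sums_summable[OF G_sums]]) (use le_G in simp)
      have "(\<Sum>i. norm (b i) / norm (1 - b i * z)) \<le> suminf G"
        by (rule suminf_le[OF le_G sm sums_summable[OF G_sums]])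
      also have "suminf G = (\<Sum>i\<in>K. 1 / \<bar>t - c i\<bar>) + 2 * (S * T powr (s - 1))"
        by (rule sums_unique[OF G_sums, symmetric])
      also have "(\<Sum>i\<in>K. 1 / \<bar>t - c i\<bar>) \<le> (8 * (T powr s * S) / (1 - p)) powr (1 / p) / (\<eta> / 2 * R)"
      proof (rule order_trans[OF t(4)], rule divide_right_mono)
        show "(8 * real (card K) / (1 - p)) powr (1 / p) \<le> (8 * (T powr s * S) / (1 - p)) powr (1 / p)"
          using K p by (intro powr_mono2 divide_right_mono mult_left_mono) auto
      qed (use \<eta> R in simp)
      finally have sum_le: "(\<Sum>i. norm (b i) / norm (1 - b i * z)) \<le>
          (8 * (T powr s * S) / (1 - p)) powr (1 / p) / (\<eta> / 2 * R) + 2 * (S * T powr (s - 1))"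
        by simp
      have "real m / norm z \<le> real m / (R / 2)"
        using zR R by (intro divide_left_mono mult_pos_pos) auto
      hence \<rho>_le: "real m / norm z + (\<Sum>i. norm (b i) / norm (1 - b i * z)) \<le> \<epsilon> R"
        using sum_le by (simp add: \<epsilon>_def T_def mult_ac)
      have \<rho>_ge: "real m / norm z + (\<Sum>i. norm (b i) / norm (1 - b i * z)) \<ge> 0"
        by (intro add_nonneg_nonneg suminf_nonneg sm) auto
      have "norm ((deriv ^^ j) \<kappa> z) \<le>
          (real m / norm z + (\<Sum>i. norm (b i) / norm (1 - b i * z))) ^ j * norm (\<kappa> z)"
        unfolding \<kappa>_def[abs_def]
        by (rule norm_higher_deriv_canonical_product_le[OF summable_b z_nz nz sm])
      also have "\<dots> \<le> \<epsilon> R ^ j * norm (\<kappa> z)"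
        by (intro mult_right_mono power_mono \<rho>_le \<rho>_ge) auto
      finally have "norm ((deriv ^^ j) \<kappa> z) \<le> \<epsilon> R ^ j * norm (\<kappa> z)" .
      moreover have "\<kappa> z \<noteq> 0"
        using z_nz nz by (simp add: \<kappa>_def canonical_product_eq_0_iff[OF summable_b])
      ultimately show ?thesis
        by blast
    qed
    thus "\<exists>t. \<eta> / 2 * norm z0 \<le> t \<and> t \<le> \<eta> * norm z0 \<and>
      (\<forall>z j. norm (z - z0) = t \<longrightarrow> \<kappa> z \<noteq> 0 \<and> norm ((deriv ^^ j) \<kappa> z) \<le> \<epsilon> (norm z0) ^ j * norm (\<kappa> z))"
      using t(1,2) by (intro exI[of _ t]) (auto simp: R_def)
  qed
qed

end

subsection \<open>Reduction to an algebraic equation for the logarithmic derivative\<close>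

context factored_solution
begin

text \<open>The complete Bell polynomials in the derivatives of \<open>h\<close>, introduced as
  quotients so that they are visibly entire.\<close>

definition bell :: "nat \<Rightarrow> complex \<Rightarrow> complex" where
  "bell i z = (deriv ^^ i) (\<lambda>z. exp (h z)) z * exp (- h z)"

lemma exp_h: "(\<lambda>z. exp (h z)) holomorphic_on UNIV"
  by (intro holomorphic_intros h)

lemma bell: "bell i holomorphic_on UNIV"
  unfolding bell_def[abs_def]
  by (intro holomorphic_intros h holomorphic_higher_deriv[OF exp_h open_UNIV])

lemma bell_0: "bell 0 z = 1"
  by (simp add: bell_def flip: exp_add)

lemma bell_Suc: "bell (Suc i) z = v z * bell i z + deriv (bell i) z"
proof -
  have "((deriv ^^ i) (\<lambda>z. exp (h z)) has_field_derivative (deriv ^^ Suc i) (\<lambda>z. exp (h z)) z) (at z)"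
    by (rule has_field_derivative_higher_deriv[OF exp_h open_UNIV UNIV_I])
  moreover have "(h has_field_derivative v z) (at z)"
    using holomorphic_derivI[OF h open_UNIV UNIV_I] .
  ultimately have "(bell i has_field_derivative
      ((deriv ^^ Suc i) (\<lambda>z. exp (h z)) z * exp (- h z) +
       (deriv ^^ i) (\<lambda>z. exp (h z)) z * (exp (- h z) * (- v z)))) (at z)"
    unfolding bell_def[abs_def] by (auto intro!: derivative_eq_intros)
  hence "deriv (bell i) z = (deriv ^^ Suc i) (\<lambda>z. exp (h z)) z * exp (- h z) +
       (deriv ^^ i) (\<lambda>z. exp (h z)) z * (exp (- h z) * (- v z))"
    by (rule DERIV_imp_deriv)
  thus ?thesis
    by (simp add: bell_def)
qed

text \<open>Coefficients of the operator P; its term of order zero is left in \<open>W\<close>,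
  hence \<open>a 0 = 0\<close>.\<close>

definition a :: "nat \<Rightarrow> complex" where
  "a i = (if i = n then 1 else if i = 0 then 0 else \<alpha> i)"

text \<open>The coefficient of the j-th derivative of \<open>\<kappa>\<close> in exp (-h) P(\<kappa>
  exp h). For \<open>j = 0\<close> this is exp (-h) P(exp h), so \<open>coef 0 - W\<close> is the
  defect.\<close>

definition coef :: "nat \<Rightarrow> complex \<Rightarrow> complex" where
  "coef j z = (\<Sum>i=0..n. a i * of_nat (i choose j) * bell (i - j) z)"

lemma coef: "coef j holomorphic_on UNIV"
  unfolding coef_def[abs_def] by (intro holomorphic_intros bell)

lemma ode_\<kappa>: "(\<Sum>j=0..n. coef j z * (deriv ^^ j) \<kappa> z) = W z * \<kappa> z"
proof -
  have "(\<Sum>i=0..n. a i * (deriv ^^ i) f z) = (\<Sum>i\<in>insert 0 (insert n {1..n-1}). a i * (deriv ^^ i) f z)"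
    by (rule sum.cong) (use n in auto)
  also have "\<dots> = (deriv ^^ n) f z + (\<Sum>i=1..n-1. a i * (deriv ^^ i) f z)"
    using n by (subst sum.insert, simp, force, subst sum.insert) (auto simp: a_def)
  also have "(\<Sum>i=1..n-1. a i * (deriv ^^ i) f z) = (\<Sum>i=1..n-1. \<alpha> i * (deriv ^^ i) f z)"
    by (rule sum.cong) (auto simp: a_def)
  also have "(deriv ^^ n) f z + \<dots> = W z * f z"
    using ode[of z] by (simp add: algebra_simps)
  finally have 1: "(\<Sum>i=0..n. a i * (deriv ^^ i) f z) = W z * f z" .
  have 2: "(deriv ^^ i) f z = exp (h z) * (\<Sum>j=0..n. of_nat (i choose j) * bell (i - j) z * (deriv ^^ j) \<kappa> z)"
    if "i \<le> n" for i
  proof -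
    have "(deriv ^^ i) f z = (\<Sum>j=0..i. of_nat (i choose j) * (deriv ^^ j) \<kappa> z * (deriv ^^ (i - j)) (\<lambda>z. exp (h z)) z)"
      unfolding f_eq_\<kappa> by (rule higher_deriv_mult[OF \<kappa> exp_h open_UNIV UNIV_I])
    also have "\<dots> = (\<Sum>j=0..n. of_nat (i choose j) * (deriv ^^ j) \<kappa> z * (deriv ^^ (i - j)) (\<lambda>z. exp (h z)) z)"
      by (rule sum.mono_neutral_left) (use that in \<open>auto simp: binomial_eq_0\<close>)
    also have "\<dots> = (\<Sum>j=0..n. exp (h z) * (of_nat (i choose j) * bell (i - j) z * (deriv ^^ j) \<kappa> z))"
      by (intro sum.cong refl) (simp add: bell_def exp_minus)
    finally show ?thesis
      by (simp add: sum_distrib_left)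
  qed
  have "W z * f z = exp (h z) * (\<Sum>i=0..n. \<Sum>j=0..n. a i * (of_nat (i choose j) * bell (i - j) z * (deriv ^^ j) \<kappa> z))"
    unfolding 1[symmetric] sum_distrib_left by (intro sum.cong refl) (simp add: 2 sum_distrib_left mult_ac)
  also have "\<dots> = exp (h z) * (\<Sum>j=0..n. coef j z * (deriv ^^ j) \<kappa> z)"
    by (subst sum.swap) (simp add: coef_def sum_distrib_left sum_distrib_right mult_ac)
  finally show ?thesis
    by (simp add: f_eq_\<kappa>)
qed

end

section \<open>Orders of magnitude relative to a bounding exponential\<close>

locale dominated_solution = factored_solution +
  fixes d p :: complex
  assumes d: "norm d = 1" and p: "Re (p * d) > 0" and W_O: "W \<in> O[conic d](\<lambda>z. exp (p * z))"
begin

text \<open>A scale of integer powers of exp (p z / n), in which \<open>v\<close> has weight 1 and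
  \<open>W\<close> has weight \<open>n\<close>.\<close>

definition ex :: "nat \<Rightarrow> complex \<Rightarrow> complex" where
  "ex k z = exp (of_nat k * (p / of_nat n) * z)"

lemma ex_mult: "ex i z * ex j z = ex (i + j) z"
  by (simp add: ex_def algebra_simps flip: exp_add)

lemma ex_nonzero: "ex i z \<noteq> 0"
  by (simp add: ex_def)

lemma p_div_n: "Re (p / of_nat n * d) > 0"
proof -
  have "p / of_nat n * d = (p * d) / of_nat n"
    by simp
  thus ?thesis
    using p n by (simp only: Re_divide_of_nat) simp
qed

lemma Re_ex: "Re (of_nat k * (p / of_nat n) * d) = real k * Re (p / of_nat n * d)"
proof -
  have "Re (of_nat k * x) = real k * Re x" for x
    by simp
  thus ?thesis
    by (simp only: mult.assoc)
qed

lemma ex_mono: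
  assumes "i \<le> j"
  shows "ex i \<in> O[conic d](ex j)"
proof (cases "i = j")
  case False
  have "Re (of_nat i * (p / of_nat n) * d) < Re (of_nat j * (p / of_nat n) * d)"
    unfolding Re_ex using assms False p_div_n by (intro mult_strict_right_mono) auto
  thus ?thesis
    unfolding ex_def[abs_def] by (rule bigo_conic_exp_mono)
qed auto

lemma big_ex_mono: "g \<in> O[conic d](ex i) \<Longrightarrow> i \<le> j \<Longrightarrow> g \<in> O[conic d](ex j)"
  using landau_o.big_trans ex_mono by blast

lemma big_ex_mult:
  "g \<in> O[conic d](ex i) \<Longrightarrow> g' \<in> O[conic d](ex j) \<Longrightarrow> (\<lambda>z. g z * g' z) \<in> O[conic d](ex (i + j))"
  unfolding ex_mult[symmetric, abs_def] by (rule landau_o.big.mult)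

lemma big_ex_deriv: "g holomorphic_on UNIV \<Longrightarrow> g \<in> O[conic d](ex i) \<Longrightarrow> deriv g \<in> O[conic d](ex i)"
  unfolding ex_def[abs_def] by (rule bigo_conic_deriv)

lemma v_big: "v \<in> O[conic d](ex 1)"
  using v_bigo_conic[OF p W_O] by (simp add: ex_def[abs_def])

lemma bell_big: "bell i \<in> O[conic d](ex i)"
proof (induction i)
  case 0
  have "bell 0 = (\<lambda>_. 1)" "ex 0 = (\<lambda>_. 1)"
    by (auto simp: bell_0 ex_def)
  thus ?case
    by simp
next
  case (Suc i)
  have "(\<lambda>z. v z * bell i z) \<in> O[conic d](ex (Suc i))"
    using big_ex_mult[OF v_big Suc] by simp
  moreover have "deriv (bell i) \<in> O[conic d](ex (Suc i))"
    using big_ex_deriv[OF bell Suc] by (rule big_ex_mono) simp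
  ultimately show ?case
    unfolding bell_Suc[abs_def] by (rule sum_in_bigo)
qed

text \<open>In the recursion, multiplication by \<open>v\<close> raises the weight by one and
  differentiation does not, so everything apart from the pure power of \<open>v\<close> falls short
  by one weight.\<close>

lemma bell_lead: "(\<lambda>z. bell (Suc i) z - v z ^ Suc i) \<in> O[conic d](ex i)"
proof (induction i)
  case 0
  have "deriv (bell 0) z = 0" for z
    unfolding bell_0[abs_def] by simp
  hence "(\<lambda>z. bell (Suc 0) z - v z ^ Suc 0) = (\<lambda>_. 0)"
    by (auto simp: bell_Suc bell_0)
  thus ?case
    by simp
next
  case (Suc i)
  have "(\<lambda>z. v z * (bell (Suc i) z - v z ^ Suc i)) \<in> O[conic d](ex (Suc i))"
    using big_ex_mult[OF v_big Suc] by simp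
  moreover have "deriv (bell (Suc i)) \<in> O[conic d](ex (Suc i))"
    by (rule big_ex_deriv[OF bell bell_big])
  ultimately have "(\<lambda>z. v z * (bell (Suc i) z - v z ^ Suc i) + deriv (bell (Suc i)) z) \<in> O[conic d](ex (Suc i))"
    by (rule sum_in_bigo)
  also have "(\<lambda>z. v z * (bell (Suc i) z - v z ^ Suc i) + deriv (bell (Suc i)) z) =
      (\<lambda>z. bell (Suc (Suc i)) z - v z ^ Suc (Suc i))"
    by (auto simp: bell_Suc[of "Suc i"] algebra_simps)
  finally show ?case .
qed

lemma coef_term_big:
  assumes "i \<le> k + j"
  shows "(\<lambda>z. a i * of_nat (i choose j) * bell (i - j) z) \<in> O[conic d](ex k)"
proof -
  have "bell (i - j) \<in> O[conic d](ex k)"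
    using bell_big by (rule big_ex_mono) (use assms in simp)
  from landau_o.big.mult[OF bigo_const this, of "a i * of_nat (i choose j)"] show ?thesis
    by simp
qed

lemma coef_big:
  assumes "j \<le> n"
  shows "coef j \<in> O[conic d](ex (n - j))"
  unfolding coef_def[abs_def] by (intro big_sum_in_bigo coef_term_big) (use assms in auto)

text \<open>Only the summand \<open>i = n\<close>, where \<open>a n = 1\<close>, reaches the weight
  \<open>n - j\<close>; every smaller \<open>i\<close> loses at least one.\<close>

lemma coef_lead:
  assumes "j < n"
  shows "(\<lambda>z. coef j z - of_nat (n choose j) * v z ^ (n - j)) \<in> O[conic d](ex (n - j - 1))"
proof -
  have "{0..n} = insert n {0..<n}"
    by auto
  hence eq: "coef j z - of_nat (n choose j) * v z ^ (n - j) =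
      of_nat (n choose j) * (bell (n - j) z - v z ^ (n - j)) +
      (\<Sum>i=0..<n. a i * of_nat (i choose j) * bell (i - j) z)" for z
    by (simp add: coef_def a_def algebra_simps)
  obtain q where q: "n - j = Suc q"
    using assms by (metis Suc_diff_Suc)
  have "(\<lambda>z. of_nat (n choose j) * (bell (n - j) z - v z ^ (n - j))) \<in> O[conic d](ex (n - j - 1))"
    using bell_lead[of q] unfolding q by simp
  moreover have "(\<lambda>z. \<Sum>i=0..<n. a i * of_nat (i choose j) * bell (i - j) z) \<in> O[conic d](ex (n - j - 1))"
    by (intro big_sum_in_bigo coef_term_big) (use assms in auto)
  ultimately show ?thesis
    unfolding eq by (rule sum_in_bigo)
qed

text \<open>On the circles where the logarithmic derivatives of \<open>\<kappa>\<close> are small,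
  the equation divided by \<open>\<kappa>\<close> bounds \<open>coef 0 - W\<close> by O(\<epsilon>)
  |ex (n - 1)|. The quotient is entire, so the maximum principle carries the bound to the centre,
  which may itself be a zero of \<open>\<kappa>\<close>.\<close>

lemma defect_tendsto_0: "((\<lambda>z. (coef 0 z - W z) / ex (n - 1) z) \<longlongrightarrow> 0) (conic d)"
proof -
  have "\<exists>c. c > 0 \<and> eventually (\<lambda>z. norm (coef j z) \<le> c * norm (ex (n - 1) z)) (conic d)"
    if "j \<in> {1..n}" for j
  proof -
    have "coef j \<in> O[conic d](ex (n - 1))"
      using coef_big[of j] by (rule big_ex_mono) (use that in auto)
    thus ?thesis
      by (elim landau_o.bigE) auto
  qed
  then obtain c where c: "\<And>j. j \<in> {1..n} \<Longrightarrow> c j > 0"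
    "\<And>j. j \<in> {1..n} \<Longrightarrow> eventually (\<lambda>z. norm (coef j z) \<le> c j * norm (ex (n - 1) z)) (conic d)"
    by metis
  have "eventually (\<lambda>z. \<forall>j\<in>{1..n}. norm (coef j z) \<le> c j * norm (ex (n - 1) z)) (conic d)"
    using c(2) by (intro eventually_ball_finite) auto
  then obtain \<eta>0 where \<eta>0: "\<eta>0 > 0" "\<eta>0 < 1" and ev:
    "eventually (\<lambda>z. \<forall>w. norm (w - z) \<le> \<eta>0 * norm z \<longrightarrow>
      (\<forall>j\<in>{1..n}. norm (coef j w) \<le> c j * norm (ex (n - 1) w))) (conic d)"
    by (rule eventually_conic_cball)
  define \<eta> where "\<eta> = \<eta>0 / 2"
  have \<eta>: "0 < \<eta>" "\<eta> \<le> 1 / 2" "\<eta> \<le> \<eta>0"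
    using \<eta>0 by (auto simp: \<eta>_def)
  obtain \<epsilon> where \<epsilon>: "(\<epsilon> \<longlongrightarrow> 0) at_top"
    "\<And>z0. z0 \<noteq> 0 \<Longrightarrow> \<exists>t. \<eta> / 2 * norm z0 \<le> t \<and> t \<le> \<eta> * norm z0 \<and>
      (\<forall>z j. norm (z - z0) = t \<longrightarrow> \<kappa> z \<noteq> 0 \<and> norm ((deriv ^^ j) \<kappa> z) \<le> \<epsilon> (norm z0) ^ j * norm (\<kappa> z))"
    by (rule \<kappa>_log_deriv_small[OF \<eta>(1,2)], rule that, assumption) blast
  have \<epsilon>_conic: "((\<lambda>z. \<epsilon> (norm z)) \<longlongrightarrow> 0) (conic d)"
    by (rule filterlim_compose[OF \<epsilon>(1) filterlim_norm_conic])
  have "eventually (\<lambda>z. \<epsilon> (norm z) < 1) (conic d)"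
    using \<epsilon>_conic by (rule order_tendstoD) simp
  with ev eventually_norm_conic[of 0 d]
  have "eventually (\<lambda>z. norm ((coef 0 z - W z) / ex (n - 1) z) \<le> (\<Sum>j=1..n. c j) * \<bar>\<epsilon> (norm z)\<bar>) (conic d)"
  proof eventually_elim
    case (elim z0)
    define \<delta> where "\<delta> = \<epsilon> (norm z0)"
    obtain t where t: "\<eta> / 2 * norm z0 \<le> t" "t \<le> \<eta> * norm z0"
      and circ: "\<And>z j. norm (z - z0) = t \<Longrightarrow> \<kappa> z \<noteq> 0 \<and> norm ((deriv ^^ j) \<kappa> z) \<le> \<delta> ^ j * norm (\<kappa> z)"
      using \<epsilon>(2)[of z0] elim(2) unfolding \<delta>_def by auto
    have t0: "t > 0"
      using t(1) \<eta>(1) elim(2) by (smt (verit) divide_pos_pos mult_pos_pos)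
    have t\<eta>: "t \<le> \<eta>0 * norm z0"
      using t(2) mult_right_mono[OF \<eta>(3), of "norm z0"] by simp
    let ?G = "\<lambda>z. (coef 0 z - W z) / ex (n - 1) z"
    have G_hol: "?G holomorphic_on UNIV"
      unfolding ex_def by (intro holomorphic_intros coef W) auto
    \<comment> \<open>The sign of \<open>\<epsilon>\<close> is not given by its limit; it follows
      from the derivative estimate at one point of the circle, where \<open>\<kappa>\<close> is
      nonzero.\<close>
    have \<delta>0: "\<delta> \<ge> 0"
    proof -
      define z where "z = z0 + of_real t"
      have "norm (z - z0) = t"
        using t0 by (simp add: z_def)
      from circ[OF this, of 1] have *: "\<kappa> z \<noteq> 0" "norm ((deriv ^^ 1) \<kappa> z) \<le> \<delta> ^ 1 * norm (\<kappa> z)"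
        by blast+
      have "0 \<le> \<delta> ^ 1 * norm (\<kappa> z)"
        by (rule order_trans[OF norm_ge_zero *(2)])
      thus ?thesis
        using *(1) by (simp add: zero_le_mult_iff)
    qed
    have "norm (?G z0) \<le> (\<Sum>j=1..n. c j) * \<delta>"
    proof (rule maximum_modulus_frontier[of ?G "cball z0 t"])
      show "?G holomorphic_on interior (cball z0 t)"
        by (rule holomorphic_on_subset[OF G_hol]) auto
      show "continuous_on (closure (cball z0 t)) ?G"
        by (intro holomorphic_on_imp_continuous_on holomorphic_on_subset[OF G_hol]) auto
      fix z assume "z \<in> frontier (cball z0 t)"
      hence z: "norm (z - z0) = t"
        by (simp add: frontier_cball dist_norm norm_minus_commute)
      have \<kappa>z: "\<kappa> z \<noteq> 0"
        using circ[OF z] by blast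
      have "(\<Sum>j=0..n. coef j z * (deriv ^^ j) \<kappa> z) =
          coef 0 z * \<kappa> z + (\<Sum>j=1..n. coef j z * (deriv ^^ j) \<kappa> z)"
        by (simp add: sum.atLeast_Suc_atMost)
      hence "(coef 0 z - W z) * \<kappa> z = - (\<Sum>j=1..n. coef j z * (deriv ^^ j) \<kappa> z)"
        using ode_\<kappa>[of z] by (simp add: algebra_simps add_eq_0_iff)
      hence "norm (coef 0 z - W z) * norm (\<kappa> z) = norm (\<Sum>j=1..n. coef j z * (deriv ^^ j) \<kappa> z)"
        by (metis norm_minus_cancel norm_mult)
      also have "\<dots> \<le> (\<Sum>j=1..n. (c j * norm (ex (n - 1) z)) * (\<delta> * norm (\<kappa> z)))"
      proof (rule sum_norm_le)
        fix j assume j: "j \<in> {1..n}"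
        have "norm (coef j z) \<le> c j * norm (ex (n - 1) z)"
          using elim(1) z t\<eta> j by auto
        moreover have "norm ((deriv ^^ j) \<kappa> z) \<le> \<delta> * norm (\<kappa> z)"
        proof -
          have "\<delta> ^ j \<le> \<delta> ^ 1"
            using \<delta>0 elim(3) j by (intro power_decreasing) (auto simp: \<delta>_def)
          hence "\<delta> ^ j * norm (\<kappa> z) \<le> \<delta> * norm (\<kappa> z)"
            by (intro mult_right_mono) auto
          thus ?thesis
            using circ[OF z, of j] by linarith
        qed
        ultimately show "norm (coef j z * (deriv ^^ j) \<kappa> z) \<le> (c j * norm (ex (n - 1) z)) * (\<delta> * norm (\<kappa> z))"
          unfolding norm_mult using c(1)[OF j] by (intro mult_mono) auto
      qed
      also have "\<dots> = ((\<Sum>j=1..n. c j) * \<delta> * norm (ex (n - 1) z)) * norm (\<kappa> z)"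
        by (simp add: sum_distrib_left sum_distrib_right mult_ac)
      finally have "norm (coef 0 z - W z) \<le> (\<Sum>j=1..n. c j) * \<delta> * norm (ex (n - 1) z)"
        using \<kappa>z by simp
      thus "norm (?G z) \<le> (\<Sum>j=1..n. c j) * \<delta>"
        using ex_nonzero[of "n - 1" z] by (simp add: norm_divide divide_le_eq)
    qed (use t0 in auto)
    thus ?case
      using \<delta>0 by (simp add: \<delta>_def)
  qed
  moreover have "((\<lambda>z. (\<Sum>j=1..n. c j) * \<bar>\<epsilon> (norm z)\<bar>) \<longlongrightarrow> 0) (conic d)"
    by (rule tendsto_mult_right_zero[OF tendsto_rabs_zero[OF \<epsilon>_conic]])
  ultimately show ?thesis
    by (rule Lim_null_comparison)
qed

text \<open>Both functions are compared with \<open>coef 0\<close>: \<open>W\<close> through the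
  defect, the power of \<open>v\<close> through the leading term of \<open>coef 0\<close>.\<close>

lemma v_power_approx: "(\<lambda>z. v z ^ n - W z) \<in> O[conic d](ex (n - 1))"
proof -
  have "eventually (\<lambda>z. norm ((coef 0 z - W z) / ex (n - 1) z) < 1) (conic d)"
    using order_tendstoD(2)[OF tendsto_norm_zero[OF defect_tendsto_0], of 1] by simp
  hence "eventually (\<lambda>z. norm (coef 0 z - W z) \<le> 1 * norm (ex (n - 1) z)) (conic d)"
    by (rule eventually_mono) (simp add: norm_divide ex_nonzero divide_less_eq split: if_splits)
  hence 1: "(\<lambda>z. coef 0 z - W z) \<in> O[conic d](ex (n - 1))"
    by (rule landau_o.bigI[rotated]) simp
  have "(\<lambda>z. coef 0 z - v z ^ n) \<in> O[conic d](ex (n - 1))"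
    using coef_lead[of 0] n by simp
  with 1 have "(\<lambda>z. (coef 0 z - W z) - (coef 0 z - v z ^ n)) \<in> O[conic d](ex (n - 1))"
    by (rule sum_in_bigo)
  thus ?thesis
    by simp
qed

end

subsection \<open>Exponential sums\<close>

text \<open>Not a normal form: coefficients may vanish. Only a set containing the frequencies is
  recorded, so algebraic closure properties reduce to those of \<open>G\<close>.\<close>

definition exp_sum :: "complex set \<Rightarrow> (complex \<Rightarrow> complex) \<Rightarrow> bool" where
  "exp_sum G X \<longleftrightarrow> (\<exists>F c. finite F \<and> F \<subseteq> G \<and> X = (\<lambda>z. \<Sum>\<omega>\<in>F. c \<omega> * exp (\<omega> * z)))"

lemma exp_sum_single: "\<omega> \<in> G \<Longrightarrow> exp_sum G (\<lambda>z. c * exp (\<omega> * z))"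
  unfolding exp_sum_def by (rule exI[of _ "{\<omega>}"], rule exI[of _ "\<lambda>_. c"]) auto

lemma exp_sum_zero: "exp_sum G (\<lambda>z. 0)"
  unfolding exp_sum_def by (rule exI[of _ "{}"]) auto

lemma exp_sum_const: "0 \<in> G \<Longrightarrow> exp_sum G (\<lambda>z. c)"
  using exp_sum_single[of 0 G c] by simp

lemma exp_sum_mono: "exp_sum G X \<Longrightarrow> G \<subseteq> G' \<Longrightarrow> exp_sum G' X"
  unfolding exp_sum_def by blast

lemma exp_sum_add:
  assumes "exp_sum G X" "exp_sum G Y"
  shows "exp_sum G (\<lambda>z. X z + Y z)"
proof -
  obtain F c where 1: "finite F" "F \<subseteq> G" "X = (\<lambda>z. \<Sum>\<omega>\<in>F. c \<omega> * exp (\<omega> * z))"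
    using assms(1) unfolding exp_sum_def by blast
  obtain F' c' where 2: "finite F'" "F' \<subseteq> G" "Y = (\<lambda>z. \<Sum>\<omega>\<in>F'. c' \<omega> * exp (\<omega> * z))"
    using assms(2) unfolding exp_sum_def by blast
  let ?c = "\<lambda>\<omega>. (if \<omega> \<in> F then c \<omega> else 0) + (if \<omega> \<in> F' then c' \<omega> else 0)"
  have "X z + Y z = (\<Sum>\<omega>\<in>F \<union> F'. ?c \<omega> * exp (\<omega> * z))" for z
  proof -
    have "X z = (\<Sum>\<omega>\<in>F \<union> F'. (if \<omega> \<in> F then c \<omega> else 0) * exp (\<omega> * z))"
      unfolding 1(3) by (rule sum.mono_neutral_cong_left) (use 1 2 in auto)
    moreover have "Y z = (\<Sum>\<omega>\<in>F \<union> F'. (if \<omega> \<in> F' then c' \<omega> else 0) * exp (\<omega> * z))"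
      unfolding 2(3) by (rule sum.mono_neutral_cong_left) (use 1 2 in auto)
    ultimately show ?thesis
      by (simp only: distrib_right sum.distrib)
  qed
  thus ?thesis
    unfolding exp_sum_def using 1 2 by (intro exI[of _ "F \<union> F'"] exI[of _ ?c]) auto
qed

lemma exp_sum_sum:
  assumes "\<And>i. i \<in> I \<Longrightarrow> exp_sum G (X i)"
  shows "exp_sum G (\<lambda>z. \<Sum>i\<in>I. X i z)"
  using assms by (induction I rule: infinite_finite_induct) (auto intro: exp_sum_zero exp_sum_add)

lemma exp_sum_mult:
  assumes "exp_sum G X" "exp_sum G Y" and G: "\<And>x y. x \<in> G \<Longrightarrow> y \<in> G \<Longrightarrow> x + y \<in> G"
  shows "exp_sum G (\<lambda>z. X z * Y z)"
proof -
  obtain F c where 1: "finite F" "F \<subseteq> G" "X = (\<lambda>z. \<Sum>\<omega>\<in>F. c \<omega> * exp (\<omega> * z))"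
    using assms(1) unfolding exp_sum_def by blast
  obtain F' c' where 2: "finite F'" "F' \<subseteq> G" "Y = (\<lambda>z. \<Sum>\<omega>\<in>F'. c' \<omega> * exp (\<omega> * z))"
    using assms(2) unfolding exp_sum_def by blast
  have "(\<lambda>z. X z * Y z) = (\<lambda>z. \<Sum>\<omega>\<in>F. \<Sum>\<omega>'\<in>F'. (c \<omega> * c' \<omega>') * exp ((\<omega> + \<omega>') * z))"
    unfolding 1(3) 2(3) sum_product
    by (intro ext sum.cong refl) (simp add: distrib_right exp_add)
  thus ?thesis
    using 1(2) 2(2) by (auto intro!: exp_sum_sum exp_sum_single G)
qed

lemma exp_sum_cmult:
  assumes "exp_sum G X"
  shows "exp_sum G (\<lambda>z. a * X z)"
proof -
  obtain F c where 1: "finite F" "F \<subseteq> G" "X = (\<lambda>z. \<Sum>\<omega>\<in>F. c \<omega> * exp (\<omega> * z))"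
    using assms(1) unfolding exp_sum_def by blast
  show ?thesis
    unfolding exp_sum_def
    by (rule exI[of _ F], rule exI[of _ "\<lambda>\<omega>. a * c \<omega>"])
      (use 1 in \<open>auto simp: sum_distrib_left mult.assoc\<close>)
qed

lemma exp_sum_diff: "exp_sum G X \<Longrightarrow> exp_sum G Y \<Longrightarrow> exp_sum G (\<lambda>z. X z - Y z)"
  using exp_sum_add[of G X "\<lambda>z. (- 1) * Y z"] exp_sum_cmult[of G Y "- 1"] by simp

lemma exp_sum_deriv:
  assumes "exp_sum G X"
  shows "exp_sum G (deriv X)"
proof -
  obtain F c where 1: "finite F" "F \<subseteq> G" "X = (\<lambda>z. \<Sum>\<omega>\<in>F. c \<omega> * exp (\<omega> * z))"
    using assms(1) unfolding exp_sum_def by blast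
  have "(X has_field_derivative (\<Sum>\<omega>\<in>F. (c \<omega> * \<omega>) * exp (\<omega> * z))) (at z)" for z
    unfolding 1(3) by (auto intro!: derivative_eq_intros sum.cong simp: mult_ac)
  hence "deriv X = (\<lambda>z. \<Sum>\<omega>\<in>F. (c \<omega> * \<omega>) * exp (\<omega> * z))"
    by (auto intro: DERIV_imp_deriv)
  thus ?thesis
    unfolding exp_sum_def using 1 by (intro exI[of _ F] exI[of _ "\<lambda>\<omega>. c \<omega> * \<omega>"]) auto
qed

lemma exp_sum_poly:
  assumes "exp_sum G X" and G: "0 \<in> G" "\<And>x y. x \<in> G \<Longrightarrow> y \<in> G \<Longrightarrow> x + y \<in> G"
  shows "exp_sum G (\<lambda>z. poly Q (X z))"
proof (induction Q)
  case (pCons a Q)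
  thus ?case
    by (auto intro!: exp_sum_add exp_sum_const exp_sum_mult assms)
qed (simp add: exp_sum_zero)

lemma exp_sum_holomorphic: "exp_sum G X \<Longrightarrow> X holomorphic_on A"
  unfolding exp_sum_def by (auto intro!: holomorphic_intros)

lemma exp_sum_exp_type:
  assumes "exp_sum G X"
  obtains C where "C > 0" "\<And>z. norm (X z) \<le> C * exp (C * norm z)"
proof -
  obtain F c where 1: "finite F" "F \<subseteq> G" "X = (\<lambda>z. \<Sum>\<omega>\<in>F. c \<omega> * exp (\<omega> * z))"
    using assms(1) unfolding exp_sum_def by blast
  define C where "C = 1 + (\<Sum>\<omega>\<in>F. norm (c \<omega>)) + (\<Sum>\<omega>\<in>F. norm \<omega>)"
  have C: "C > 0" "(\<Sum>\<omega>\<in>F. norm (c \<omega>)) \<le> C"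
    by (auto simp: C_def sum_nonneg add_pos_nonneg)
  have C2: "norm \<omega> \<le> C" if "\<omega> \<in> F" for \<omega>
    using member_le_sum[OF that, of norm] 1(1) sum_nonneg[of F "\<lambda>\<omega>. norm (c \<omega>)"] by (simp add: C_def)
  have "norm (X z) \<le> C * exp (C * norm z)" for z
  proof -
    have "norm (X z) \<le> (\<Sum>\<omega>\<in>F. norm (c \<omega>) * exp (C * norm z))"
      unfolding 1(3)
    proof (rule sum_norm_le)
      fix \<omega> assume \<omega>: "\<omega> \<in> F"
      have "norm (exp (\<omega> * z)) \<le> exp (norm (\<omega> * z))"
        by (rule norm_exp)
      also have "\<dots> \<le> exp (C * norm z)"
        using C2[OF \<omega>] by (simp add: norm_mult mult_right_mono)
      finally show "norm (c \<omega> * exp (\<omega> * z)) \<le> norm (c \<omega>) * exp (C * norm z)"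
        by (simp only: norm_mult) (rule mult_left_mono, auto)
    qed
    also have "\<dots> = (\<Sum>\<omega>\<in>F. norm (c \<omega>)) * exp (C * norm z)"
      by (simp add: sum_distrib_right)
    also have "\<dots> \<le> C * exp (C * norm z)"
      using C by (intro mult_right_mono) auto
    finally show ?thesis .
  qed
  thus ?thesis
    using that C(1) by blast
qed

lemma exp_sum_decay:
  assumes "exp_sum G X" and G: "\<And>\<omega>. \<omega> \<in> G \<Longrightarrow> Re (\<omega> * d) < 0"
  obtains \<delta> C where "\<delta> > 0" "C > 0" "eventually (\<lambda>z. norm (X z) \<le> C * exp (- \<delta> * norm z)) (conic d)"
proof -
  obtain F c where 1: "finite F" "F \<subseteq> G" "X = (\<lambda>z. \<Sum>\<omega>\<in>F. c \<omega> * exp (\<omega> * z))"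
    using assms(1) unfolding exp_sum_def by blast
  \<comment> \<open>Half of each rate leaves slack for directions near \<open>d\<close>; the
    inserted 1 keeps the minimum meaningful when \<open>F\<close> is empty.\<close>
  define \<delta> where "\<delta> = Min (insert 1 ((\<lambda>\<omega>. - Re (\<omega> * d) / 2) ` F))"
  have \<delta>: "\<delta> > 0"
    unfolding \<delta>_def using 1 G by (subst Min_gr_iff) auto
  have "Re (\<omega> * d) < - \<delta>" if \<omega>: "\<omega> \<in> F" for \<omega>
  proof -
    have "\<delta> \<le> - Re (\<omega> * d) / 2"
      unfolding \<delta>_def using 1(1) \<omega> by (intro Min_le) auto
    thus ?thesis
      using G[of \<omega>] \<omega> 1(2) by auto
  qed
  hence "eventually (\<lambda>z. \<forall>\<omega>\<in>F. norm (exp (\<omega> * z)) \<le> exp (- \<delta> * norm z)) (conic d)"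
    by (intro eventually_ball_finite 1 ballI eventually_norm_exp_conic_le)
  hence "eventually (\<lambda>z. norm (X z) \<le> (1 + (\<Sum>\<omega>\<in>F. norm (c \<omega>))) * exp (- \<delta> * norm z)) (conic d)"
  proof (rule eventually_mono)
    fix z assume *: "\<forall>\<omega>\<in>F. norm (exp (\<omega> * z)) \<le> exp (- \<delta> * norm z)"
    have "norm (X z) \<le> (\<Sum>\<omega>\<in>F. norm (c \<omega>) * exp (- \<delta> * norm z))"
      unfolding 1(3)
    proof (rule sum_norm_le)
      fix \<omega> assume \<omega>: "\<omega> \<in> F"
      show "norm (c \<omega> * exp (\<omega> * z)) \<le> norm (c \<omega>) * exp (- \<delta> * norm z)"
        unfolding norm_mult using * \<omega> by (intro mult_left_mono) auto
    qed
    also have "\<dots> \<le> (1 + (\<Sum>\<omega>\<in>F. norm (c \<omega>))) * exp (- \<delta> * norm z)"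
      by (simp add: sum_distrib_right[symmetric] distrib_right)
    finally show "norm (X z) \<le> (1 + (\<Sum>\<omega>\<in>F. norm (c \<omega>))) * exp (- \<delta> * norm z)" .
  qed
  thus ?thesis
    using that \<delta> by (meson add_pos_nonneg norm_ge_zero sum_nonneg zero_less_one)
qed

lemma exp_sum_decay_bounded:
  assumes "exp_sum G X" and "\<And>\<omega>. \<omega> \<in> G \<Longrightarrow> Re (\<omega> * d) < 0"
  obtains B where "eventually (\<lambda>z. norm (X z) \<le> B) (conic d)"
proof -
  obtain \<delta> C where *: "\<delta> > 0" "C > 0" "eventually (\<lambda>z. norm (X z) \<le> C * exp (- \<delta> * norm z)) (conic d)"
    using assms by (rule exp_sum_decay)
  have "eventually (\<lambda>z. norm (X z) \<le> C) (conic d)"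
    using *(3)
  proof eventually_elim
    case (elim z)
    have "C * exp (- \<delta> * norm z) \<le> C * 1"
      using * by (intro mult_left_mono) auto
    thus ?case
      using elim by simp
  qed
  thus ?thesis
    using that by blast
qed

text \<open>Genericity of \<open>d\<close> leaves 0 as the only frequency that neither grows nor
  decays, which is why the remaining part is a constant.\<close>

lemma exp_sum_split:
  assumes X: "exp_sum G X" and gen: "\<And>\<omega>. \<omega> \<in> G \<Longrightarrow> Re (\<omega> * d) = 0 \<Longrightarrow> \<omega> = 0"
  obtains P N c where "exp_sum {\<omega>\<in>G. Re (\<omega> * d) > 0} P" "exp_sum {\<omega>\<in>G. Re (\<omega> * d) < 0} N"
    "\<And>z. X z = P z + N z + c"
proof -
  obtain F c where 1: "finite F" "F \<subseteq> G" "X = (\<lambda>z. \<Sum>\<omega>\<in>F. c \<omega> * exp (\<omega> * z))"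
    using X unfolding exp_sum_def by blast
  let ?P = "{\<omega>\<in>F. Re (\<omega> * d) > 0}" and ?N = "{\<omega>\<in>F. Re (\<omega> * d) < 0}" and ?Z = "{\<omega>\<in>F. \<omega> = 0}"
  have F: "F = (?P \<union> ?N) \<union> ?Z"
    using gen 1(2) by (auto simp del: times_complex.sel) (metis linorder_neqE_linordered_idom subset_iff)
  have "X z = (\<Sum>\<omega>\<in>?P. c \<omega> * exp (\<omega> * z)) + (\<Sum>\<omega>\<in>?N. c \<omega> * exp (\<omega> * z)) + (\<Sum>\<omega>\<in>?Z. c \<omega>)" for z
  proof -
    have "X z = (\<Sum>\<omega>\<in>(?P \<union> ?N) \<union> ?Z. c \<omega> * exp (\<omega> * z))"
      unfolding 1(3) using F by simp
    also have "\<dots> = (\<Sum>\<omega>\<in>?P \<union> ?N. c \<omega> * exp (\<omega> * z)) + (\<Sum>\<omega>\<in>?Z. c \<omega> * exp (\<omega> * z))"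
      by (rule sum.union_disjoint) (use 1(1) in auto)
    also have "(\<Sum>\<omega>\<in>?P \<union> ?N. c \<omega> * exp (\<omega> * z)) =
        (\<Sum>\<omega>\<in>?P. c \<omega> * exp (\<omega> * z)) + (\<Sum>\<omega>\<in>?N. c \<omega> * exp (\<omega> * z))"
      by (rule sum.union_disjoint) (use 1(1) in auto)
    also have "(\<Sum>\<omega>\<in>?Z. c \<omega> * exp (\<omega> * z)) = (\<Sum>\<omega>\<in>?Z. c \<omega>)"
      by (rule sum.cong) auto
    finally show ?thesis .
  qed
  moreover have "exp_sum {\<omega>\<in>G. Re (\<omega> * d) > 0} (\<lambda>z. \<Sum>\<omega>\<in>?P. c \<omega> * exp (\<omega> * z))"
    unfolding exp_sum_def using 1 by (intro exI[of _ ?P] exI[of _ c]) auto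
  moreover have "exp_sum {\<omega>\<in>G. Re (\<omega> * d) < 0} (\<lambda>z. \<Sum>\<omega>\<in>?N. c \<omega> * exp (\<omega> * z))"
    unfolding exp_sum_def using 1 by (intro exI[of _ ?N] exI[of _ c]) auto
  ultimately show ?thesis
    using that by blast
qed

text \<open>
  If the frequencies have distinct growth rates in direction \<open>d\<close>, the fastest growing term
  cannot be cancelled by the others.
\<close>

lemma exp_sum_tendsto_0:
  assumes X: "exp_sum G X" and d: "norm d = 1"
    and gen: "\<And>\<omega> \<omega>'. \<omega> \<in> G \<Longrightarrow> \<omega>' \<in> G \<Longrightarrow> Re (\<omega> * d) = Re (\<omega>' * d) \<Longrightarrow> \<omega> = \<omega>'"
    and lim: "(X \<longlongrightarrow> 0) (conic d)"
  shows "exp_sum {\<omega>\<in>G. Re (\<omega> * d) < 0} X"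
proof -
  obtain F0 c where 0: "finite F0" "F0 \<subseteq> G" "X = (\<lambda>z. \<Sum>\<omega>\<in>F0. c \<omega> * exp (\<omega> * z))"
    using X unfolding exp_sum_def by blast
  \<comment> \<open>Vanishing coefficients are dropped so that the fastest frequency found below
    really occurs.\<close>
  define F where "F = {\<omega>\<in>F0. c \<omega> \<noteq> 0}"
  have F: "finite F" "F \<subseteq> G" "\<And>\<omega>. \<omega> \<in> F \<Longrightarrow> c \<omega> \<noteq> 0"
    using 0 by (auto simp: F_def)
  have XF: "X = (\<lambda>z. \<Sum>\<omega>\<in>F. c \<omega> * exp (\<omega> * z))"
    unfolding 0(3) F_def by (rule ext, rule sum.mono_neutral_right) (use 0(1) in auto)
  have "Re (\<omega> * d) < 0" if "\<omega> \<in> F" for \<omega>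
  proof (rule ccontr)
    assume neg: "\<not> Re (\<omega> * d) < 0"
    have ne: "F \<noteq> {}"
      using that by auto
    obtain \<omega>1 where \<omega>1: "\<omega>1 \<in> F" "\<And>\<omega>. \<omega> \<in> F \<Longrightarrow> Re (\<omega> * d) \<le> Re (\<omega>1 * d)"
    proof -
      let ?R = "(\<lambda>\<omega>. Re (\<omega> * d)) ` F"
      have "Max ?R \<in> ?R"
        using F(1) ne by (intro Max_in) auto
      then obtain \<omega>1 where "\<omega>1 \<in> F" "Re (\<omega>1 * d) = Max ?R"
        by (metis (no_types, lifting) imageE)
      moreover have "Re (\<omega> * d) \<le> Max ?R" if "\<omega> \<in> F" for \<omega>
        using F(1) that by (intro Max_ge) auto
      ultimately show thesis
        using that by (metis (no_types, lifting))
    qed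
    have pos: "Re (\<omega>1 * d) \<ge> 0"
      using \<omega>1(2)[OF that] neg by linarith
    have lt: "Re ((\<omega> - \<omega>1) * d) < 0" if "\<omega> \<in> F - {\<omega>1}" for \<omega>
    proof -
      have "Re (\<omega> * d) \<noteq> Re (\<omega>1 * d)"
        using gen[of \<omega> \<omega>1] that \<omega>1(1) F(2) by blast
      moreover have "Re (\<omega> * d) \<le> Re (\<omega>1 * d)"
        using \<omega>1(2) that by blast
      ultimately show ?thesis
        by (simp add: left_diff_distrib)
    qed
    have ray: "((\<lambda>t::real. exp (\<omega> * (of_real t * d))) \<longlongrightarrow> 0) at_top" if "Re (\<omega> * d) < 0" for \<omega>
    proof (rule tendsto_norm_zero_cancel)
      have "((\<lambda>t::real. exp (Re (\<omega> * d) * t)) \<longlongrightarrow> 0) at_top"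
        using that by real_asymp
      moreover have "norm (exp (\<omega> * (of_real t * d))) = exp (Re (\<omega> * d) * t)" for t
      proof -
        have "\<omega> * (of_real t * d) = of_real t * (\<omega> * d)"
          by (simp add: mult_ac)
        thus ?thesis
          by (simp only: norm_exp_eq_Re Re_complex_of_real Im_complex_of_real times_complex.sel(1)[of "of_real t"])
            (simp add: mult.commute)
      qed
      ultimately show "((\<lambda>t::real. norm (exp (\<omega> * (of_real t * d)))) \<longlongrightarrow> 0) at_top"
        by simp
    qed
    \<comment> \<open>Along the ray, X exp (- \<omega>1 z) tends to \<open>c \<omega>1\<close>;
      since Re (\<omega>1 d) \<ge> 0, it also inherits the limit 0 of \<open>X\<close>.\<close>
    have "((\<lambda>t::real. c \<omega>1 + (\<Sum>\<omega>\<in>F - {\<omega>1}. c \<omega> * exp ((\<omega> - \<omega>1) * (of_real t * d)))) \<longlongrightarrow>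
        c \<omega>1 + (\<Sum>\<omega>\<in>F - {\<omega>1}. c \<omega> * 0)) at_top"
      by (intro tendsto_intros ray lt)
    also have "(\<lambda>t::real. c \<omega>1 + (\<Sum>\<omega>\<in>F - {\<omega>1}. c \<omega> * exp ((\<omega> - \<omega>1) * (of_real t * d)))) =
        (\<lambda>t. X (of_real t * d) * exp (- \<omega>1 * (of_real t * d)))"
    proof
      fix t :: real
      define z where "z = of_real t * d"
      have "X z * exp (- \<omega>1 * z) = (\<Sum>\<omega>\<in>F. c \<omega> * exp ((\<omega> - \<omega>1) * z))"
        unfolding XF by (simp add: sum_distrib_right left_diff_distrib mult.assoc flip: exp_add)
      also have "\<dots> = c \<omega>1 + (\<Sum>\<omega>\<in>F - {\<omega>1}. c \<omega> * exp ((\<omega> - \<omega>1) * z))"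
        by (subst sum.remove[OF F(1) \<omega>1(1)]) simp
      finally show "c \<omega>1 + (\<Sum>\<omega>\<in>F - {\<omega>1}. c \<omega> * exp ((\<omega> - \<omega>1) * (of_real t * d))) =
          X (of_real t * d) * exp (- \<omega>1 * (of_real t * d))"
        by (simp add: z_def)
    qed
    finally have 1: "((\<lambda>t. X (of_real t * d) * exp (- \<omega>1 * (of_real t * d))) \<longlongrightarrow> c \<omega>1) at_top"
      by simp
    have 2: "((\<lambda>t. X (of_real t * d)) \<longlongrightarrow> 0) at_top"
      by (rule filterlim_compose[OF lim filterlim_ray_conic[OF d]])
    have "((\<lambda>t. X (of_real t * d) * exp (- \<omega>1 * (of_real t * d))) \<longlongrightarrow> 0) at_top"
    proof (rule Lim_null_comparison[OF _ tendsto_norm_zero[OF 2]])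
      show "eventually (\<lambda>t. norm (X (of_real t * d) * exp (- \<omega>1 * (of_real t * d))) \<le> norm (X (of_real t * d))) at_top"
        using eventually_ge_at_top[of 0]
      proof eventually_elim
        case (elim t)
        have "- \<omega>1 * (of_real t * d) = of_real (- t) * (\<omega>1 * d)"
          by (simp add: mult_ac)
        hence "Re (- \<omega>1 * (of_real t * d)) = - t * Re (\<omega>1 * d)"
          by (simp only: Re_complex_of_real Im_complex_of_real times_complex.sel(1)[of "of_real (- t)"])
        also have "\<dots> \<le> 0"
          using elim pos by (simp add: mult_nonneg_nonneg)
        finally have "norm (exp (- \<omega>1 * (of_real t * d))) \<le> 1"
          by (simp add: norm_exp_eq_Re)
        thus ?case
          unfolding norm_mult by (rule mult_left_le) simp
      qed
    qed
    hence "c \<omega>1 = 0"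
      using 1 tendsto_unique trivial_limit_at_top_linorder by blast
    thus False
      using F(3)[OF \<omega>1(1)] by simp
  qed
  thus ?thesis
    unfolding exp_sum_def using F XF by (intro exI[of _ F] exI[of _ c]) auto
qed

text \<open>Taylor's formula by iteration: f x = f 0 + x g x, where g is holomorphic after removing
  the singularity at 0, and an approximation of g of order P gives one of f of order P + 1.\<close>

lemma holomorphic_poly_approx:
  assumes "f holomorphic_on ball 0 1"
  obtains Q C where "C > 0" "\<And>x. norm x \<le> 1 / 2 \<Longrightarrow> norm (f x - poly Q x) \<le> C * norm (x :: complex) ^ P"
proof -
  have "\<exists>Q C. C > 0 \<and> (\<forall>x. norm x \<le> 1 / 2 \<longrightarrow> norm (f x - poly Q x) \<le> C * norm (x :: complex) ^ P)"
    using assms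
  proof (induction P arbitrary: f)
    case 0
    have "compact (f ` cball 0 (1 / 2))"
      by (intro compact_continuous_image holomorphic_on_imp_continuous_on holomorphic_on_subset[OF 0]) auto
    then obtain B where B: "\<And>x. norm x \<le> 1 / 2 \<Longrightarrow> norm (f x) \<le> B"
      by (meson bounded_iff compact_imp_bounded imageI mem_cball_0)
    show ?case
      by (rule exI[of _ 0], rule exI[of _ "max 1 B"]) (use B in \<open>auto simp: le_max_iff_disj\<close>)
  next
    case (Suc P)
    define g where "g x = (if x = 0 then deriv f 0 else (f x - f 0) / (x - 0))" for x
    have g: "g holomorphic_on ball 0 1"
      unfolding g_def by (rule pole_lemma[OF Suc.prems]) simp
    obtain Q C where *: "C > 0" "\<And>x. norm x \<le> 1 / 2 \<Longrightarrow> norm (g x - poly Q x) \<le> C * norm x ^ P"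
      using Suc.IH[OF g] by blast
    have "norm (f x - poly (pCons (f 0) Q) x) \<le> C * norm x ^ Suc P" if "norm x \<le> 1 / 2" for x
    proof -
      have "f x - poly (pCons (f 0) Q) x = x * (g x - poly Q x)"
        by (simp add: g_def field_simps)
      hence "norm (f x - poly (pCons (f 0) Q) x) = norm x * norm (g x - poly Q x)"
        by (simp add: norm_mult)
      also have "\<dots> \<le> norm x * (C * norm x ^ P)"
        by (intro mult_left_mono * that) auto
      finally show ?thesis
        by (simp add: mult_ac)
    qed
    thus ?case
      using *(1) by blast
  qed
  thus ?thesis
    using that by blast
qed

lemma poly_lipschitz:
  obtains L where "L > 0"
    "\<And>x y. norm x \<le> 1 \<Longrightarrow> norm y \<le> 1 \<Longrightarrow> norm (poly Q x - poly Q y) \<le> L * norm (x - y :: complex)"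
proof -
  have "compact (poly (pderiv Q) ` cball 0 1)"
    by (intro compact_continuous_image continuous_intros) auto
  then obtain B where B: "\<And>x. norm x \<le> 1 \<Longrightarrow> norm (poly (pderiv Q) x) \<le> B"
    by (meson bounded_iff compact_imp_bounded imageI mem_cball_0)
  have "norm (poly Q x - poly Q y) \<le> max 1 B * norm (x - y)" if "norm x \<le> 1" "norm y \<le> 1" for x y
  proof (rule field_differentiable_bound[of "cball 0 1" "poly Q" "poly (pderiv Q)"])
    show "(poly Q has_field_derivative poly (pderiv Q) z) (at z within cball 0 1)" for z
      by (rule DERIV_subset[OF poly_DERIV]) auto
    show "norm (poly (pderiv Q) z) \<le> max 1 B" if "z \<in> cball 0 1" for z
      using B[of z] that by (simp add: le_max_iff_disj)
  qed (use that in auto)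
  thus ?thesis
    by (intro that[of "max 1 B"]) auto
qed

subsection \<open>Asymptotics in a sector with a dominant exponential\<close>

text \<open>The converse passage to \<open>eventually_conic_cone\<close>: multiplication by
  \<open>cnj d\<close> undoes the rotation. A property obtained on a convex cone thereby returns to
  the sector filter.\<close>

lemma eventually_conic_cone_ball:
  assumes d: "norm d = 1" and "\<epsilon> > 0"
  shows "eventually (\<lambda>z. Re (z * cnj d) \<ge> R \<and> \<bar>Im (z * cnj d)\<bar> \<le> \<epsilon> * Re (z * cnj d)) (conic d)"
proof -
  have dd: "d * cnj d = 1"
    using d by (simp add: complex_norm_square[symmetric])
  have "((\<lambda>z. sgn z * cnj d) \<longlongrightarrow> d * cnj d) (conic d)"
    by (intro tendsto_intros tendsto_sgn_conic)
  hence lim: "((\<lambda>z. sgn z * cnj d) \<longlongrightarrow> 1) (conic d)"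
    by (simp add: dd)
  have "eventually (\<lambda>z. Re (sgn z * cnj d) > 1 / 2) (conic d)"
    using tendsto_Re[OF lim] by (rule order_tendstoD) simp
  moreover have "eventually (\<lambda>z. \<bar>Im (sgn z * cnj d)\<bar> < \<epsilon> / 2) (conic d)"
    using tendsto_rabs[OF tendsto_Im[OF lim]] by (rule order_tendstoD) (use assms in simp)
  ultimately show ?thesis
    using eventually_norm_conic[of "max 0 (2 * R)" d]
  proof eventually_elim
    case (elim z)
    have "z * cnj d = of_real (norm z) * (sgn z * cnj d)"
      by (cases "z = 0") (auto simp: sgn_eq)
    hence Re: "Re (z * cnj d) = norm z * Re (sgn z * cnj d)"
      and Im: "Im (z * cnj d) = norm z * Im (sgn z * cnj d)"
      by (simp_all only: Re_complex_of_real Im_complex_of_real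
          times_complex.sel[of "of_real (norm z)"])
    have z: "norm z > 0" "norm z > 2 * R"
      using elim(3) by auto
    have half: "norm z * (1 / 2) \<le> Re (z * cnj d)"
      unfolding Re using elim(1) by (intro mult_left_mono) auto
    have "\<bar>Im (z * cnj d)\<bar> = norm z * \<bar>Im (sgn z * cnj d)\<bar>"
      unfolding Im by (simp add: abs_mult)
    also have "\<dots> \<le> norm z * (\<epsilon> / 2)"
      using elim(2) by (intro mult_left_mono) auto
    also have "\<dots> = \<epsilon> * (norm z * (1 / 2))"
      by simp
    also have "\<dots> \<le> \<epsilon> * Re (z * cnj d)"
      using half assms(2) by (intro mult_left_mono) auto
    finally show ?case
      using half z by linarith
  qed
qed

text \<open>Which exponential leads is decided by \<open>d\<close>. The group structure of
  \<open>G\<close> keeps quotients by the leading exponential inside it, and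
  \<open>p / of_nat n\<close> must lie in \<open>G\<close> because it is the leading frequency of
  \<open>v\<close>.\<close>

locale leading_exponential = dominated_solution +
  fixes G :: "complex set" and \<beta> :: complex and Y :: "complex \<Rightarrow> complex"
  assumes G0: "0 \<in> G" and G_add: "\<And>x y. x \<in> G \<Longrightarrow> y \<in> G \<Longrightarrow> x + y \<in> G"
    and G_minus: "\<And>x. x \<in> G \<Longrightarrow> - x \<in> G" and p_G: "p / of_nat n \<in> G"
    and \<beta>: "\<beta> \<noteq> 0" and W_eq: "\<And>z. W z = \<beta> * exp (p * z) + Y z"
    and Y: "exp_sum {\<omega>\<in>G. Re (\<omega> * d) < Re (p * d)} Y"
begin

lemma G_mult: "x \<in> G \<Longrightarrow> of_nat k * x \<in> G"
proof (induction k)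
  case (Suc k)
  have "of_nat (Suc k) * x = x + of_nat k * x"
    by (simp add: algebra_simps)
  thus ?case
    using Suc G_add by simp
qed (simp add: G0)

lemma p_in_G: "p \<in> G"
  using G_mult[OF p_G, of n] n by simp

lemma ex_n: "ex n z = exp (p * z)"
  using n by (simp add: ex_def)

lemma Y_quotient: "exp_sum {\<omega>\<in>G. Re (\<omega> * d) < 0} (\<lambda>z. Y z * exp (- p * z))"
proof -
  obtain F c where F: "finite F" "F \<subseteq> {\<omega>\<in>G. Re (\<omega> * d) < Re (p * d)}"
    "Y = (\<lambda>z. \<Sum>\<omega>\<in>F. c \<omega> * exp (\<omega> * z))"
    using Y unfolding exp_sum_def by blast
  have eq: "(\<lambda>z. Y z * exp (- p * z)) = (\<lambda>z. \<Sum>\<omega>\<in>F. c \<omega> * exp ((\<omega> + - p) * z))"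
    unfolding F(3) by (intro ext) (simp add: sum_distrib_right left_diff_distrib mult.assoc flip: exp_add)
  show ?thesis
    unfolding eq
  proof (intro exp_sum_sum exp_sum_single)
    fix \<omega> assume "\<omega> \<in> F"
    hence "\<omega> \<in> G" "Re (\<omega> * d) < Re (p * d)"
      using F(2) by auto
    thus "\<omega> + - p \<in> {\<omega>\<in>G. Re (\<omega> * d) < 0}"
      using G_add[OF _ G_minus[OF p_in_G]] by (simp add: algebra_simps)
  qed
qed

text \<open>Write v^n = \<beta> exp (p z) (1 + w') and expand the n-th root. The function
  \<open>w'\<close> need not be an exponential sum, but it differs from the explicit sum
  \<open>w\<close> by O(1 / |ex 1|); after multiplication by \<open>ex 1\<close> the replacement of
  \<open>w'\<close> by \<open>w\<close> costs O(1).\<close>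

lemma v_exp_sum_approx:
  obtains S B where "exp_sum G S" "eventually (\<lambda>z. norm (v z - S z) \<le> B) (conic d)"
proof -
  define w where "w z = inverse \<beta> * (Y z * exp (- p * z))" for z
  have w_sum: "exp_sum {\<omega>\<in>G. Re (\<omega> * d) < 0} w"
    unfolding w_def[abs_def] by (rule exp_sum_cmult[OF Y_quotient])
  define w' where "w' z = v z ^ n / (\<beta> * exp (p * z)) - 1" for z
  have w'_hol: "w' holomorphic_on UNIV"
    unfolding w'_def using \<beta> by (intro holomorphic_intros v) auto
  obtain c where c: "c > 0" "eventually (\<lambda>z. norm (v z ^ n - W z) \<le> c * norm (ex (n - 1) z)) (conic d)"
    using landau_o.bigE[OF v_power_approx] by blast
  define c1 where "c1 = c / norm \<beta>"
  have c1: "c1 > 0"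
    using c(1) \<beta> by (simp add: c1_def)
  have close: "eventually (\<lambda>z. norm (w' z - w z) \<le> c1 / norm (ex 1 z)) (conic d)"
    using c(2)
  proof eventually_elim
    case (elim z)
    have "w' z - w z = (v z ^ n - W z) / (\<beta> * exp (p * z))"
      using \<beta> by (simp add: w'_def w_def W_eq exp_minus field_simps)
    also have "exp (p * z) = ex (n - 1) z * ex 1 z"
      unfolding ex_mult using n by (simp add: ex_n)
    finally have "norm (w' z - w z) = norm (v z ^ n - W z) / (norm \<beta> * (norm (ex (n - 1) z) * norm (ex 1 z)))"
      by (simp add: norm_divide norm_mult)
    also have "\<dots> \<le> (c * norm (ex (n - 1) z)) / (norm \<beta> * (norm (ex (n - 1) z) * norm (ex 1 z)))"
      using elim by (intro divide_right_mono) auto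
    also have "\<dots> = c1 / norm (ex 1 z)"
      using ex_nonzero[of "n - 1" z] by (simp add: c1_def)
    finally show ?case .
  qed
  define \<tau> where "\<tau> = Re (p / of_nat n * d) / 2"
  have \<tau>: "\<tau> > 0" "\<tau> < Re (p / of_nat n * d)"
    using p_div_n by (auto simp: \<tau>_def)
  have ex1_ge: "eventually (\<lambda>z. norm (ex 1 z) \<ge> exp (\<tau> * norm z)) (conic d)"
    using eventually_norm_exp_conic_ge[OF \<tau>(2)] by (simp add: ex_def)
  obtain \<delta> C where w_decay: "\<delta> > 0" "C > 0" "eventually (\<lambda>z. norm (w z) \<le> C * exp (- \<delta> * norm z)) (conic d)"
    using w_sum by (rule exp_sum_decay) auto
  \<comment> \<open>A common rate: \<open>w\<close> decays with rate \<open>\<delta>\<close>, and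
    the difference \<open>w' - w\<close> with rate \<open>\<tau>\<close>.\<close>
  define \<delta>' where "\<delta>' = min \<delta> \<tau>"
  have \<delta>': "\<delta>' > 0" "\<delta>' \<le> \<delta>" "\<delta>' \<le> \<tau>"
    using w_decay \<tau> by (auto simp: \<delta>'_def)
  have w'_decay: "eventually (\<lambda>z. norm (w' z) \<le> (C + c1) * exp (- \<delta>' * norm z)) (conic d)"
    using close w_decay(3) ex1_ge
  proof eventually_elim
    case (elim z)
    have "norm (w' z) \<le> norm (w z) + norm (w' z - w z)"
      by (rule norm_triangle_sub)
    also have "norm (w z) \<le> C * exp (- \<delta>' * norm z)"
    proof -
      have "C * exp (- \<delta> * norm z) \<le> C * exp (- \<delta>' * norm z)"
        using w_decay(2) \<delta>' by (intro mult_left_mono) (auto simp: mult_right_mono)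
      thus ?thesis
        using elim(2) by linarith
    qed
    also have "norm (w' z - w z) \<le> c1 * exp (- \<delta>' * norm z)"
    proof -
      have "c1 / norm (ex 1 z) \<le> c1 / exp (\<tau> * norm z)"
        using elim(3) c1 ex_nonzero[of 1 z] by (intro divide_left_mono) auto
      also have "\<dots> = c1 * exp (- \<tau> * norm z)"
        by (simp add: exp_minus divide_inverse)
      also have "\<dots> \<le> c1 * exp (- \<delta>' * norm z)"
        using c1 \<delta>' by (intro mult_left_mono) (auto simp: mult_right_mono)
      finally show ?thesis
        using elim(1) by linarith
    qed
    finally show ?case
      by (simp add: distrib_right)
  qed
  have w'_small: "eventually (\<lambda>z. norm (w' z) \<le> 1 / 2) (conic d)"
  proof -
    have "eventually (\<lambda>z. (C + c1) * exp (- \<delta>' * norm z) < 1 / 2) (conic d)"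
      using tendsto_exp_decay_conic[OF \<delta>'(1)] by (rule order_tendstoD) simp
    with w'_decay show ?thesis
      by eventually_elim simp
  qed
  have w_small: "eventually (\<lambda>z. norm (w z) \<le> 1) (conic d)"
  proof -
    have "eventually (\<lambda>z. C * exp (- \<delta> * norm z) < 1) (conic d)"
      using tendsto_exp_decay_conic[OF w_decay(1)] by (rule order_tendstoD) simp
    with w_decay(3) show ?thesis
      by eventually_elim simp
  qed
  define root where "root x = exp (Ln (1 + x) / of_nat n)" for x :: complex
  have root_hol: "root holomorphic_on ball 0 1"
  proof -
    have "1 + x \<notin> \<real>\<^sub>\<le>\<^sub>0" if "norm x < 1" for x :: complex
      using that abs_Re_le_cmod[of x] by (auto simp: complex_nonpos_Reals_iff)
    thus ?thesis
      unfolding root_def using n by (intro holomorphic_intros) auto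
  qed
  have root_pow: "root x ^ n = 1 + x" "root x \<noteq> 0" if "norm x \<le> 1 / 2" for x
  proof -
    have "1 + x \<noteq> 0"
    proof
      assume "1 + x = 0"
      hence "x = - 1"
        by (simp add: add_eq_0_iff)
      thus False
        using that by simp
    qed
    thus "root x ^ n = 1 + x"
      using n by (simp add: root_def flip: exp_of_nat_mult)
  qed (simp add: root_def)
  define r0 where "r0 = exp (Ln \<beta> / of_nat n)"
  have r0: "r0 ^ n = \<beta>" "r0 \<noteq> 0"
    using \<beta> n by (auto simp: r0_def simp flip: exp_of_nat_mult)
  obtain \<epsilon> R where cone: "\<epsilon> > 0" "R > 0"
    "\<And>x. Re x \<ge> R \<Longrightarrow> \<bar>Im x\<bar> \<le> \<epsilon> * Re x \<Longrightarrow> norm (w' (x * d)) \<le> 1 / 2"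
    using eventually_conic_cone[OF w'_small d] by blast
  define \<Omega> where "\<Omega> = {x. Re x \<ge> R \<and> \<bar>Im x\<bar> \<le> \<epsilon> * Re x}"
  \<comment> \<open>The quotient of \<open>v\<close> by one chosen branch of the root. Its values
    are n-th roots of unity, so continuity on the connected cone makes it constant and the branch is
    the same throughout.\<close>
  define y where "y x = v (x * d) / (r0 * ex 1 (x * d) * root (w' (x * d)))" for x
  have y_pow: "y x ^ n = 1" if "x \<in> \<Omega>" for x
  proof -
    have small: "norm (w' (x * d)) \<le> 1 / 2"
      using that cone(3) by (auto simp: \<Omega>_def)
    have "y x ^ n = v (x * d) ^ n / (\<beta> * exp (p * (x * d)) * (1 + w' (x * d)))"
    proof -
      have "ex 1 z ^ n = exp (p * z)" for z
        using n by (simp add: ex_def flip: exp_of_nat_mult)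
      thus ?thesis
        by (simp add: y_def power_divide power_mult_distrib r0 root_pow(1)[OF small])
    qed
    moreover have "v (x * d) ^ n = \<beta> * exp (p * (x * d)) * (1 + w' (x * d))"
      using \<beta> by (simp add: w'_def)
    moreover have "1 + w' (x * d) \<noteq> 0"
      using root_pow[OF small] by (metis power_not_zero)
    ultimately show ?thesis
      using \<beta> by simp
  qed
  have "y constant_on \<Omega>"
  proof (rule continuous_finite_range_constant)
    have "convex \<Omega>"
    proof -
      have "\<Omega> = {x. Re x \<ge> R} \<inter> {x. Im x - \<epsilon> * Re x \<le> 0} \<inter> {x. - Im x - \<epsilon> * Re x \<le> 0}"
        by (auto simp: \<Omega>_def)
      moreover have "convex {x. Re x \<ge> R}"
        by (rule convex_halfspace_Re_ge)
      moreover have "convex {x. Im x - \<epsilon> * Re x \<le> 0}"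
        using convex_halfspace_le[of "Complex (- \<epsilon>) 1" 0] by (simp add: inner_complex_def algebra_simps)
      moreover have "convex {x. - Im x - \<epsilon> * Re x \<le> 0}"
        using convex_halfspace_le[of "Complex (- \<epsilon>) (- 1)" 0] by (simp add: inner_complex_def algebra_simps)
      ultimately show ?thesis
        by (simp add: convex_Int)
    qed
    thus "connected \<Omega>"
      by (rule convex_connected)
    show "continuous_on \<Omega> y"
    proof -
      have 1: "continuous_on \<Omega> (\<lambda>x. g (x * d))" if "g holomorphic_on UNIV" for g
        by (rule continuous_on_compose2[OF holomorphic_on_imp_continuous_on[OF that]])
          (auto intro!: continuous_intros)
      have "continuous_on \<Omega> (\<lambda>x. root (w' (x * d)))"
      proof (rule continuous_on_compose2[OF holomorphic_on_imp_continuous_on[OF root_hol] 1[OF w'_hol]])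
        show "(\<lambda>x. w' (x * d)) ` \<Omega> \<subseteq> ball 0 1"
          using cone(3) by (fastforce simp: \<Omega>_def)
      qed
      moreover have "continuous_on \<Omega> (\<lambda>x. ex 1 (x * d))"
        by (rule 1) (auto simp: ex_def intro!: holomorphic_intros)
      ultimately show ?thesis
        unfolding y_def using r0(2) ex_nonzero by (intro continuous_intros 1[OF v]) (auto simp: root_def)
    qed
    have "y ` \<Omega> \<subseteq> {x. x ^ n = 1}"
      using y_pow by auto
    moreover have "finite {x::complex. x ^ n = 1}"
      using n by (intro finite_roots_unity) auto
    ultimately show "finite (y ` \<Omega>)"
      by (rule finite_subset)
  qed
  then obtain \<omega> where \<omega>: "\<And>x. x \<in> \<Omega> \<Longrightarrow> y x = \<omega>"
    by (auto simp: constant_on_def)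
  have v_eq: "eventually (\<lambda>z. v z = \<omega> * r0 * ex 1 z * root (w' z)) (conic d)"
    using eventually_conic_cone_ball[OF d cone(1), of R]
  proof eventually_elim
    case (elim z)
    have "cnj d * d = 1"
      using d complex_norm_square[of d] by (simp add: mult.commute)
    hence z: "z * cnj d * d = z"
      by (simp add: mult.assoc)
    have "y (z * cnj d) = \<omega>"
      by (rule \<omega>) (use elim in \<open>auto simp: \<Omega>_def\<close>)
    thus ?case
      unfolding y_def z using r0(2) ex_nonzero[of 1 z] by (simp add: root_def field_simps)
  qed
  \<comment> \<open>So many terms that |w'|^N compensates the growth of |ex 1|, which is at most exp
    (|p / n| |z|).\<close>
  define N where "N = nat \<lceil>norm (p / of_nat n) / \<delta>'\<rceil>"
  have N: "norm (p / of_nat n) \<le> real N * \<delta>'"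
  proof -
    have "norm (p / of_nat n) / \<delta>' \<le> real N"
      unfolding N_def by linarith
    thus ?thesis
      using \<delta>'(1) by (simp only: pos_divide_le_eq)
  qed
  obtain Q D where Q: "D > 0" "\<And>x. norm x \<le> 1 / 2 \<Longrightarrow> norm (root x - poly Q x) \<le> D * norm x ^ N"
    using holomorphic_poly_approx[OF root_hol] by blast
  obtain L where L: "L > 0"
    "\<And>x y. norm x \<le> 1 \<Longrightarrow> norm y \<le> 1 \<Longrightarrow> norm (poly Q x - poly Q y) \<le> L * norm (x - y)"
    using poly_lipschitz by blast
  define S where "S z = (\<omega> * r0) * (1 * exp (p / of_nat n * z) * poly Q (w z))" for z
  have S: "exp_sum G S"
    unfolding S_def[abs_def]
    by (intro exp_sum_cmult exp_sum_mult exp_sum_single exp_sum_poly G0 G_add p_G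
        exp_sum_mono[OF w_sum]) auto
  have "eventually (\<lambda>z. norm (v z - S z) \<le> norm (\<omega> * r0) * (D * (C + c1) ^ N + L * c1)) (conic d)"
    using v_eq w'_small w_small w'_decay close
  proof eventually_elim
    case (elim z)
    have "v z - S z = (\<omega> * r0) * (ex 1 z * (root (w' z) - poly Q (w z)))"
      unfolding elim(1) S_def by (simp add: ex_def algebra_simps)
    hence "norm (v z - S z) = norm (\<omega> * r0) * (norm (ex 1 z) * norm (root (w' z) - poly Q (w z)))"
      by (simp add: norm_mult)
    also have "norm (ex 1 z) * norm (root (w' z) - poly Q (w z)) \<le> D * (C + c1) ^ N + L * c1"
    proof -
      have "norm (root (w' z) - poly Q (w z)) \<le>
          norm (root (w' z) - poly Q (w' z)) + norm (poly Q (w' z) - poly Q (w z))"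
        using norm_triangle_ineq[of "root (w' z) - poly Q (w' z)" "poly Q (w' z) - poly Q (w z)"] by simp
      also have "\<dots> \<le> D * norm (w' z) ^ N + L * (c1 / norm (ex 1 z))"
      proof (rule add_mono)
        show "norm (root (w' z) - poly Q (w' z)) \<le> D * norm (w' z) ^ N"
          by (rule Q(2)) (use elim in simp)
        have "norm (poly Q (w' z) - poly Q (w z)) \<le> L * norm (w' z - w z)"
          by (rule L(2)) (use elim in simp_all)
        also have "\<dots> \<le> L * (c1 / norm (ex 1 z))"
          using L(1) elim(5) by (intro mult_left_mono) auto
        finally show "norm (poly Q (w' z) - poly Q (w z)) \<le> L * (c1 / norm (ex 1 z))" .
      qed
      finally have "norm (ex 1 z) * norm (root (w' z) - poly Q (w z)) \<le>
          norm (ex 1 z) * (D * norm (w' z) ^ N + L * (c1 / norm (ex 1 z)))"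
        by (rule mult_left_mono) simp
      also have "\<dots> = D * (norm (ex 1 z) * norm (w' z) ^ N) + L * c1"
        using ex_nonzero[of 1 z] by (simp add: field_simps)
      also have "norm (ex 1 z) * norm (w' z) ^ N \<le> (C + c1) ^ N"
      proof -
        have "norm (ex 1 z) \<le> exp (norm (p / of_nat n * z))"
          unfolding ex_def by (simp only: of_nat_1 mult_1_left) (rule norm_exp)
        also have "\<dots> \<le> exp (real N * \<delta>' * norm z)"
          using N by (simp only: norm_mult exp_le_cancel_iff) (rule mult_right_mono, auto)
        finally have 1: "norm (ex 1 z) \<le> exp (real N * \<delta>' * norm z)" .
        have "norm (w' z) ^ N \<le> ((C + c1) * exp (- \<delta>' * norm z)) ^ N"
          using elim(4) by (rule power_mono) simp
        also have "\<dots> = (C + c1) ^ N * exp (- (real N * \<delta>' * norm z))"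
          by (simp add: power_mult_distrib mult.assoc flip: exp_of_nat_mult)
        finally have 2: "norm (w' z) ^ N \<le> (C + c1) ^ N * exp (- (real N * \<delta>' * norm z))" .
        have "norm (ex 1 z) * norm (w' z) ^ N \<le>
            exp (real N * \<delta>' * norm z) * ((C + c1) ^ N * exp (- (real N * \<delta>' * norm z)))"
          by (rule mult_mono[OF 1 2]) auto
        also have "\<dots> = (C + c1) ^ N"
          by (simp add: exp_minus)
        finally show ?thesis .
      qed
      finally show ?thesis
        using Q(1) by simp
    qed
    finally show ?case
      by (simp add: mult_left_mono)
  qed
  thus ?thesis
    using that S by blast
qed

end

subsection \<open>The form of the solution\<close>

lemma countable_additive_subgroup:
  fixes \<Lambda> :: "complex set"
  assumes "countable \<Lambda>"
  obtains G where "countable G" "\<Lambda> \<subseteq> G" "0 \<in> G" "\<And>x y. x \<in> G \<Longrightarrow> y \<in> G \<Longrightarrow> x + y \<in> G"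
    "\<And>x. x \<in> G \<Longrightarrow> - x \<in> G"
proof -
  define H where "H = rec_nat (insert 0 \<Lambda>) (\<lambda>_ S. S \<union> (\<lambda>(x, y). x + y) ` (S \<times> S) \<union> uminus ` S)"
  have H0: "H 0 = insert 0 \<Lambda>" and HS: "H (Suc i) = H i \<union> (\<lambda>(x, y). x + y) ` (H i \<times> H i) \<union> uminus ` H i" for i
    by (simp_all add: H_def)
  have mono: "H i \<subseteq> H j" if "i \<le> j" for i j
    by (rule lift_Suc_mono_le[OF _ that]) (auto simp: HS)
  show ?thesis
  proof (rule that[of "\<Union>i. H i"])
    have "countable (H i)" for i
      by (induction i) (use assms in \<open>simp_all add: H0 HS\<close>)
    thus "countable (\<Union>i. H i)"
      by simp
    show "\<Lambda> \<subseteq> (\<Union>i. H i)" "0 \<in> (\<Union>i. H i)"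
      using H0 by blast+
    show "x + y \<in> (\<Union>i. H i)" if "x \<in> (\<Union>i. H i)" "y \<in> (\<Union>i. H i)" for x y
    proof -
      obtain i j where ij: "x \<in> H i" "y \<in> H j"
        using \<open>x \<in> _\<close> \<open>y \<in> _\<close> by blast
      hence "x \<in> H (max i j)" "y \<in> H (max i j)"
        using mono[of i "max i j"] mono[of j "max i j"] by auto
      hence "(\<lambda>(x, y). x + y) (x, y) \<in> H (Suc (max i j))"
        unfolding HS by blast
      thus ?thesis
        by auto
    qed
    show "- x \<in> (\<Union>i. H i)" if "x \<in> (\<Union>i. H i)" for x
    proof -
      obtain i where "x \<in> H i"
        using \<open>x \<in> _\<close> by blast
      hence "- x \<in> H (Suc i)"
        unfolding HS by blast
      thus ?thesis
        by blast
    qed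
  qed
qed

text \<open>For d proportional to 1 + i t, a small t > 0 preserves finitely many strict
  inequalities. If Im \<omega> \<noteq> 0, the condition Re (\<omega> d) = 0 determines t, so
  \<open>G\<close> forbids only countably many t; if Im \<omega> = 0, it forces \<omega> =
  0.\<close>

lemma generic_direction:
  fixes X G :: "complex set"
  assumes X: "finite X" "\<And>x. x \<in> X \<Longrightarrow> Re x > 0" and G: "countable G"
  obtains d where "norm d = 1" "\<And>x. x \<in> X \<Longrightarrow> Re (x * d) > 0"
    "\<And>\<omega>. \<omega> \<in> G \<Longrightarrow> Re (\<omega> * d) = 0 \<Longrightarrow> \<omega> = 0"
proof -
  have "eventually (\<lambda>t. \<forall>x\<in>X. Re x - t * Im x > 0) (at_right (0::real))"
  proof (intro eventually_ball_finite X ballI)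
    fix x assume "x \<in> X"
    have "((\<lambda>t. Re x - t * Im x) \<longlongrightarrow> Re x - 0 * Im x) (at_right 0)"
      by (intro tendsto_intros)
    thus "eventually (\<lambda>t. Re x - t * Im x > 0) (at_right 0)"
      by (rule order_tendstoD) (use X(2)[OF \<open>x \<in> X\<close>] in simp)
  qed
  then obtain t0 where t0: "t0 > 0" "\<And>t x. 0 < t \<Longrightarrow> t < t0 \<Longrightarrow> x \<in> X \<Longrightarrow> Re x - t * Im x > 0"
    unfolding eventually_at_right_field by blast
  have "countable ((\<lambda>\<omega>. Re \<omega> / Im \<omega>) ` G)"
    using G by simp
  moreover have "uncountable {0<..<t0}"
    using t0(1) by (simp add: uncountable_open_interval)
  ultimately have "{0<..<t0} - (\<lambda>\<omega>. Re \<omega> / Im \<omega>) ` G \<noteq> {}"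
    using uncountable_minus_countable by (metis countable_empty)
  then obtain t where "t \<in> {0<..<t0} - (\<lambda>\<omega>. Re \<omega> / Im \<omega>) ` G"
    by blast
  hence t: "0 < t" "t < t0" "t \<notin> (\<lambda>\<omega>. Re \<omega> / Im \<omega>) ` G"
    by simp_all
  define r where "r = norm (Complex 1 t)"
  have r: "r > 0"
    by (simp add: r_def complex_eq_iff)
  define d where "d = Complex 1 t / of_real r"
  have Re: "Re (x * d) = (Re x - t * Im x) / r" for x
    using r by (simp add: d_def Re_divide_of_real mult.commute diff_divide_distrib)
  show ?thesis
  proof (rule that[of d])
    show "norm d = 1"
      using r by (simp add: d_def norm_divide r_def)
    show "Re (x * d) > 0" if "x \<in> X" for x
      unfolding Re using t0(2)[OF t(1,2) that] r by simp
    show "\<omega> = 0" if "\<omega> \<in> G" "Re (\<omega> * d) = 0" for \<omega>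
    proof -
      have eq: "Re \<omega> = t * Im \<omega>"
        using that(2) r unfolding Re by simp
      have "Im \<omega> = 0"
      proof (rule ccontr)
        assume "Im \<omega> \<noteq> 0"
        hence "t = Re \<omega> / Im \<omega>"
          using eq by simp
        thus False
          using t(3) that(1) by blast
      qed
      thus ?thesis
        using eq by (simp add: complex_eq_iff)
    qed
  qed
qed

lemma exp_sum_lower_bigo:
  assumes "exp_sum {\<omega>\<in>G. Re (\<omega> * d) < Re (p * d)} Y"
  shows "Y \<in> O[conic d](\<lambda>z. exp (p * z))"
proof -
  obtain F c where F: "finite F" "F \<subseteq> {\<omega>\<in>G. Re (\<omega> * d) < Re (p * d)}"
    "Y = (\<lambda>z. \<Sum>\<omega>\<in>F. c \<omega> * exp (\<omega> * z))"
    using assms unfolding exp_sum_def by blast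
  show ?thesis
    unfolding F(3)
  proof (rule big_sum_in_bigo)
    fix \<omega> assume "\<omega> \<in> F"
    hence "(\<lambda>z. exp (\<omega> * z)) \<in> O[conic d](\<lambda>z. exp (p * z))"
      using F(2) by (intro bigo_conic_exp_mono) auto
    from landau_o.big.mult[OF bigo_const this, of "c \<omega>"]
    show "(\<lambda>z. c \<omega> * exp (\<omega> * z)) \<in> O[conic d](\<lambda>z. exp (p * z))"
      by simp
  qed
qed

text \<open>The frequency 0 of \<open>deriv h\<close> integrates to the linear term, the origin of
  the factor e^(cz) of the solution; every other term keeps its frequency.\<close>

lemma exp_sum_primitive:
  assumes h: "h holomorphic_on UNIV" and v: "exp_sum G (deriv h)"
  obtains F c b a where "finite F" "\<And>z. h z = a + b * z + (\<Sum>\<omega>\<in>F. c \<omega> * exp (\<omega> * z))"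
proof -
  obtain F c where F: "finite F" "deriv h = (\<lambda>z. \<Sum>\<omega>\<in>F. c \<omega> * exp (\<omega> * z))"
    using v unfolding exp_sum_def by blast
  define F' where "F' = F - {0}"
  define b where "b = (if 0 \<in> F then c 0 else 0)"
  define H where "H z = b * z + (\<Sum>\<omega>\<in>F'. c \<omega> / \<omega> * exp (\<omega> * z))" for z
  have dh: "deriv h z = b + (\<Sum>\<omega>\<in>F'. c \<omega> * exp (\<omega> * z))" for z
    unfolding F(2) F'_def b_def using F(1) by (simp add: sum.remove)
  have "(H has_field_derivative b + (\<Sum>\<omega>\<in>F'. c \<omega> * exp (\<omega> * z))) (at z)" for z
    unfolding H_def by (auto intro!: derivative_eq_intros sum.cong simp: F'_def)
  moreover have "(h has_field_derivative deriv h z) (at z)" for z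
    using holomorphic_derivI[OF h open_UNIV] by simp
  ultimately have "((\<lambda>z. h z - H z) has_field_derivative 0) (at z)" for z
    using DERIV_diff[of h "deriv h z" z UNIV H "deriv h z"] unfolding dh by simp
  hence "\<exists>a. \<forall>z\<in>UNIV. h z - H z = a"
    by (intro has_field_derivative_zero_constant) auto
  then obtain a where "\<And>z. h z - H z = a"
    by auto
  hence "h z = a + b * z + (\<Sum>\<omega>\<in>F'. c \<omega> / \<omega> * exp (\<omega> * z))" for z
    unfolding H_def by (simp add: algebra_simps)
  thus ?thesis
    using that[of F' a b "\<lambda>\<omega>. c \<omega> / \<omega>"] F(1) by (simp add: F'_def)
qed

section \<open>Functions of exponential type zero\<close>

definition zero_type :: "(complex \<Rightarrow> complex) \<Rightarrow> bool" where
  "zero_type g \<longleftrightarrow> g holomorphic_on UNIV \<and> (\<forall>\<delta>>0. \<exists>C>0. \<forall>z. norm (g z) \<le> C * exp (\<delta> * norm z))"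

lemma zero_type_deriv:
  assumes "zero_type g"
  shows "zero_type (deriv g)"
  unfolding zero_type_def
proof (intro conjI allI impI)
  have g: "g holomorphic_on UNIV"
    using assms by (simp add: zero_type_def)
  show "deriv g holomorphic_on UNIV"
    by (rule holomorphic_deriv[OF g open_UNIV])
  fix \<delta> :: real assume \<delta>: "\<delta> > 0"
  obtain C where C: "C > 0" "\<And>z. norm (g z) \<le> C * exp (\<delta> * norm z)"
    using assms \<delta> unfolding zero_type_def by blast
  have "norm (deriv g z) \<le> 2 * C * exp \<delta> * exp (\<delta> * norm z)" for z
  proof -
    have "norm ((deriv ^^ 1) g z) \<le> fact 1 * (2 * C * exp \<delta> * exp (\<delta> * norm z)) / 1 ^ 1"
    proof (rule Cauchy_higher_deriv_bound[where y = 0])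
      fix w assume "w \<in> ball z 1"
      hence "norm w \<le> 1 + norm z"
        using norm_triangle_sub[of w z] by (simp add: dist_norm norm_minus_commute)
      hence "\<delta> * norm w \<le> \<delta> * (1 + norm z)"
        using \<delta> by simp
      hence "C * exp (\<delta> * norm w) \<le> C * exp (\<delta> * (1 + norm z))"
        using C(1) by simp
      hence "norm (g w) \<le> C * exp (\<delta> * (1 + norm z))"
        using C(2)[of w] by linarith
      also have "\<dots> = C * exp \<delta> * exp (\<delta> * norm z)"
        by (simp add: algebra_simps exp_add)
      also have "\<dots> < 2 * C * exp \<delta> * exp (\<delta> * norm z)"
        using C(1) by simp
      finally show "g w \<in> ball 0 (2 * C * exp \<delta> * exp (\<delta> * norm z))"
        by simp
    qed (auto intro!: holomorphic_on_imp_continuous_on holomorphic_on_subset[OF g])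
    thus ?thesis
      by simp
  qed
  thus "\<exists>C>0. \<forall>z. norm (deriv g z) \<le> C * exp (\<delta> * norm z)"
    using C(1) by (intro exI[of _ "2 * C * exp \<delta>"]) simp
qed

text \<open>A factor exp (\<omega> z) with \<omega> d = \<delta> / 2 suits both sides: around
  \<open>d\<close> it uses up half of the decay at most, and around \<open>- d\<close> its own decay
  outweighs \<open>g\<close>, which has type zero. The product is bounded in both sectors, hence
  constant, and its limit is 0.\<close>

lemma zero_type_conic_decay_imp_zero:
  assumes g: "zero_type g" and d: "norm d = 1" and \<delta>: "\<delta> > 0"
    and decay: "eventually (\<lambda>z. norm (g z) \<le> C * exp (- \<delta> * norm z)) (conic d)"
  shows "g z = 0"
proof -
  define c where "c = \<delta> / 2"
  have c: "c > 0" "c < \<delta>"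
    using \<delta> by (auto simp: c_def)
  define \<omega> where "\<omega> = of_real c * cnj d"
  have "cnj d * d = 1"
    using d complex_norm_square[of d] by (simp add: mult.commute)
  hence \<omega>d: "\<omega> * d = of_real c"
    by (simp add: \<omega>_def mult.assoc)
  have n\<omega>: "norm \<omega> = c"
    using d c by (simp add: \<omega>_def norm_mult)
  define G where "G z = g z * exp (\<omega> * z)" for z
  have exp_le: "norm (exp (\<omega> * z)) \<le> exp (c * norm z)" for z
    using norm_exp[of "\<omega> * z"] by (simp add: norm_mult n\<omega>)
  have g_hol: "g holomorphic_on UNIV"
    using g by (simp add: zero_type_def)
  have G_decay: "eventually (\<lambda>z. norm (G z) \<le> C * exp (- c * norm z)) (conic d)"
    using decay
  proof eventually_elim
    case (elim z)
    have "norm (G z) \<le> (C * exp (- \<delta> * norm z)) * exp (c * norm z)"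
      unfolding G_def norm_mult using elim exp_le[of z]
      by (intro mult_mono) (auto intro: order_trans[OF norm_ge_zero])
    also have "\<dots> = C * exp (- c * norm z)"
      by (simp add: c_def field_simps flip: exp_add)
    finally show ?case .
  qed
  obtain C1 where C1: "C1 > 0" "\<And>z. norm (g z) \<le> C1 * exp (c / 2 * norm z)"
    using g c(1) unfolding zero_type_def by (meson half_gt_zero)
  have G_neg: "eventually (\<lambda>z. norm (G z) \<le> C1) (conic (- d))"
  proof -
    have "Re (\<omega> * (- d)) < - (c / 2)"
      using c by (simp only: mult_minus_right \<omega>d) simp
    from eventually_norm_exp_conic_le[OF this] show ?thesis
    proof (rule eventually_mono)
      fix z assume *: "norm (exp (\<omega> * z)) \<le> exp (- (c / 2) * norm z)"
      have "norm (G z) \<le> (C1 * exp (c / 2 * norm z)) * exp (- (c / 2) * norm z)"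
        unfolding G_def norm_mult using C1 * by (intro mult_mono) auto
      thus "norm (G z) \<le> C1"
        by (simp add: mult.assoc flip: exp_add)
    qed
  qed
  have lim: "((\<lambda>z. C * exp (- c * norm z)) \<longlongrightarrow> 0) (conic d)"
    by (rule tendsto_exp_decay_conic[OF c(1)])
  have "eventually (\<lambda>z. C * exp (- c * norm z) < 1) (conic d)"
    using lim by (rule order_tendstoD) simp
  with G_decay have G_pos: "eventually (\<lambda>z. norm (G z) \<le> 1) (conic d)"
    by eventually_elim simp
  define A where "A = max C1 (2 * c)"
  have G_type: "norm (G z) \<le> A * exp (A * norm z)" for z
  proof -
    have "norm (G z) \<le> (C1 * exp (c / 2 * norm z)) * exp (c * norm z)"
      unfolding G_def norm_mult using C1 exp_le by (intro mult_mono) auto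
    also have "\<dots> = C1 * exp ((3 / 2 * c) * norm z)"
      by (simp add: algebra_simps flip: exp_add)
    also have "\<dots> \<le> A * exp (A * norm z)"
    proof (intro mult_mono)
      have "3 / 2 * c \<le> A"
        using c by (auto simp: A_def)
      thus "exp (3 / 2 * c * norm z) \<le> exp (A * norm z)"
        by (simp only: exp_le_cancel_iff mult_right_mono[OF _ norm_ge_zero])
    qed (use C1 in \<open>auto simp: A_def\<close>)
    finally show ?thesis .
  qed
  have G_hol: "G holomorphic_on UNIV"
    unfolding G_def by (intro holomorphic_intros g_hol)
  obtain a where a: "\<And>z. G z = a"
    by (rule exp_type_bounded_conic_imp_const[OF G_hol G_type d G_pos G_neg]) (rule that, blast)
  have "(G \<longlongrightarrow> 0) (conic d)"
    by (rule Lim_null_comparison[OF G_decay lim])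
  moreover have "G = (\<lambda>_. a)"
    using a by auto
  ultimately have "((\<lambda>_::complex. a) \<longlongrightarrow> 0) (conic d)"
    by simp
  hence "a = 0"
    using conic_neq_bot[OF d] by (simp add: tendsto_const_iff)
  thus ?thesis
    using a[of z] by (simp add: G_def)
qed

lemma (in factored_solution) \<kappa>_zero_type: "zero_type \<kappa>"
  unfolding zero_type_def
proof (intro conjI allI impI \<kappa>)
  fix \<delta> :: real assume \<delta>: "\<delta> > 0"
  obtain C where C: "C > 0" "\<And>z. norm (canonical_product b z) \<le> C * exp (\<delta> / 2 * norm z)"
    using canonical_product_zero_type[OF summable_b, of "\<delta> / 2"] \<delta> by auto
  define q where "q = \<delta> / (2 * real (Suc m))"
  have q: "q > 0" "real m * q \<le> \<delta> / 2"
    using \<delta> by (auto simp: q_def field_simps)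
  have "norm (\<kappa> z) \<le> (1 / q) ^ m * C * exp (\<delta> * norm z)" for z
  proof -
    have "q * norm z \<le> exp (q * norm z)"
      using exp_ge_add_one_self[of "q * norm z"] by linarith
    hence "norm z \<le> 1 / q * exp (q * norm z)"
      using q(1) by (simp add: field_simps)
    hence "norm z ^ m \<le> (1 / q * exp (q * norm z)) ^ m"
      by (rule power_mono) simp
    also have "\<dots> = (1 / q) ^ m * exp (real m * q * norm z)"
      by (simp only: power_mult_distrib exp_of_nat_mult[symmetric] mult.assoc)
    also have "\<dots> \<le> (1 / q) ^ m * exp (\<delta> / 2 * norm z)"
      using q mult_right_mono[OF q(2), of "norm z"] by (intro mult_left_mono) auto
    finally have "norm (\<kappa> z) \<le> ((1 / q) ^ m * exp (\<delta> / 2 * norm z)) * (C * exp (\<delta> / 2 * norm z))"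
      unfolding \<kappa>_def norm_mult norm_power using C q by (intro mult_mono) auto
    also have "\<dots> = (1 / q) ^ m * C * (exp (\<delta> / 2 * norm z) * exp (\<delta> / 2 * norm z))"
      by (simp add: mult_ac)
    also have "exp (\<delta> / 2 * norm z) * exp (\<delta> / 2 * norm z) = exp (\<delta> * norm z)"
      by (simp flip: exp_add)
    finally show ?thesis .
  qed
  thus "\<exists>C>0. \<forall>z. norm (\<kappa> z) \<le> C * exp (\<delta> * norm z)"
    using C(1) q(1) by (intro exI[of _ "(1 / q) ^ m * C"]) simp
qed

section \<open>Joining the two sectors and removing the zeros\<close>

context leading_exponential
begin

lemma W_sum: "exp_sum G W"
proof -
  have "exp_sum G (\<lambda>z. \<beta> * exp (p * z) + Y z)"
    by (intro exp_sum_add exp_sum_single p_in_G exp_sum_mono[OF Y]) auto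
  thus ?thesis
    using W_eq by presburger
qed

text \<open>Neither approximation may be subtracted as it stands, since its other half can grow in
  the opposite sector. \<open>P1\<close> grows towards \<open>d\<close> and is bounded around
  \<open>- d\<close>, \<open>N2\<close> behaves the other way round, so \<open>v - (P1 + N2)\<close>
  is bounded in both sectors.\<close>

lemma v_exp_sum:
  assumes gen: "\<And>\<omega>. \<omega> \<in> G \<Longrightarrow> Re (\<omega> * d) = 0 \<Longrightarrow> \<omega> = 0"
    and S2: "exp_sum G S2" "eventually (\<lambda>z. norm (v z - S2 z) \<le> B2) (conic (- d))"
  shows "exp_sum G v"
proof -
  obtain S1 B1 where S1: "exp_sum G S1" "eventually (\<lambda>z. norm (v z - S1 z) \<le> B1) (conic d)"
    by (rule v_exp_sum_approx)
  obtain P1 N1 c1 where 1: "exp_sum {\<omega>\<in>G. Re (\<omega> * d) > 0} P1" "exp_sum {\<omega>\<in>G. Re (\<omega> * d) < 0} N1"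
    "\<And>z. S1 z = P1 z + N1 z + c1"
    by (rule exp_sum_split[OF S1(1)], erule (1) gen, rule that, assumption, assumption, blast)
  obtain P2 N2 c2 where 2: "exp_sum {\<omega>\<in>G. Re (\<omega> * d) > 0} P2" "exp_sum {\<omega>\<in>G. Re (\<omega> * d) < 0} N2"
    "\<And>z. S2 z = P2 z + N2 z + c2"
    by (rule exp_sum_split[OF S2(1)], erule (1) gen, rule that, assumption, assumption, blast)
  obtain b1 where b1: "eventually (\<lambda>z. norm (N1 z) \<le> b1) (conic d)"
    using 1(2) by (rule exp_sum_decay_bounded) auto
  obtain b2 where b2: "eventually (\<lambda>z. norm (N2 z) \<le> b2) (conic d)"
    using 2(2) by (rule exp_sum_decay_bounded) auto
  obtain b3 where b3: "eventually (\<lambda>z. norm (P1 z) \<le> b3) (conic (- d))"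
    using 1(1) by (rule exp_sum_decay_bounded) auto
  obtain b4 where b4: "eventually (\<lambda>z. norm (P2 z) \<le> b4) (conic (- d))"
    using 2(1) by (rule exp_sum_decay_bounded) auto
  define g where "g z = v z - (P1 z + N2 z)" for z
  have PN: "exp_sum G (\<lambda>z. P1 z + N2 z)"
    by (intro exp_sum_add exp_sum_mono[OF 1(1)] exp_sum_mono[OF 2(2)]) auto
  have pos: "eventually (\<lambda>z. norm (g z) \<le> B1 + b1 + norm c1 + b2) (conic d)"
    using S1(2) b1 b2
  proof eventually_elim
    case (elim z)
    have "g z = (v z - S1 z) + N1 z + c1 - N2 z"
      by (simp add: g_def 1(3))
    also have "norm \<dots> \<le> norm (v z - S1 z) + norm (N1 z) + norm c1 + norm (N2 z)"
      by (intro order_trans[OF norm_triangle_ineq4] order_trans[OF norm_triangle_ineq] add_mono order_refl)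
    finally show ?case
      using elim by linarith
  qed
  have neg: "eventually (\<lambda>z. norm (g z) \<le> B2 + b4 + norm c2 + b3) (conic (- d))"
    using S2(2) b3 b4
  proof eventually_elim
    case (elim z)
    have "g z = (v z - S2 z) + P2 z + c2 - P1 z"
      by (simp add: g_def 2(3))
    also have "norm \<dots> \<le> norm (v z - S2 z) + norm (P2 z) + norm c2 + norm (P1 z)"
      by (intro order_trans[OF norm_triangle_ineq4] order_trans[OF norm_triangle_ineq] add_mono order_refl)
    finally show ?case
      using elim by linarith
  qed
  have g_hol: "g holomorphic_on UNIV"
    unfolding g_def by (intro holomorphic_intros v exp_sum_holomorphic[OF 1(1)] exp_sum_holomorphic[OF 2(2)])
  obtain A where A: "A > 0" "\<And>z. norm (W z) \<le> A * exp (A * norm z)"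
    using exp_sum_exp_type[OF W_sum] by blast
  obtain C1 where C1: "C1 > 0" "\<And>z. norm (v z) \<le> C1 * exp (C1 * norm z)"
    using v_exp_type[OF A] by blast
  obtain C2 where C2: "C2 > 0" "\<And>z. norm (P1 z + N2 z) \<le> C2 * exp (C2 * norm z)"
    using exp_sum_exp_type[OF PN] by blast
  have type: "norm (g z) \<le> (C1 + C2) * exp ((C1 + C2) * norm z)" for z
  proof -
    have "exp (C1 * norm z) \<le> exp ((C1 + C2) * norm z)" "exp (C2 * norm z) \<le> exp ((C1 + C2) * norm z)"
      using C1(1) C2(1) by (simp_all add: mult_right_mono)
    hence "C1 * exp (C1 * norm z) \<le> C1 * exp ((C1 + C2) * norm z)"
        "C2 * exp (C2 * norm z) \<le> C2 * exp ((C1 + C2) * norm z)"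
      using C1(1) C2(1) by (simp_all only: mult_le_cancel_left_pos)
    moreover have "norm (g z) \<le> norm (v z) + norm (P1 z + N2 z)"
      unfolding g_def by (rule norm_triangle_ineq4)
    ultimately show ?thesis
      using C1(2)[of z] C2(2)[of z] by (simp only: distrib_right[of C1 C2 "exp _"])
  qed
  obtain a where a: "\<And>z. g z = a"
    by (rule exp_type_bounded_conic_imp_const[OF g_hol type d pos neg]) (rule that, blast)
  have "v = (\<lambda>z. (P1 z + N2 z) + a)"
    using a by (auto simp: g_def algebra_simps)
  thus ?thesis
    using exp_sum_add[OF PN exp_sum_const[OF G0, of a]] by simp
qed

lemma bell_exp_sum:
  assumes "exp_sum G v"
  shows "exp_sum G (bell i)"
proof (induction i)
  case 0
  show ?case
    unfolding bell_0[abs_def] by (rule exp_sum_const[OF G0])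
next
  case (Suc i)
  thus ?case
    unfolding bell_Suc[abs_def] by (intro exp_sum_add exp_sum_mult exp_sum_deriv assms G_add)
qed

lemma coef_exp_sum: "exp_sum G v \<Longrightarrow> exp_sum G (coef j)"
  unfolding coef_def[abs_def] by (intro exp_sum_sum exp_sum_cmult bell_exp_sum)

text \<open>Once \<open>v\<close> is an exponential sum, so is the normalised defect; mere
  convergence to 0 then excludes all frequencies that do not decay, and this upgrades to an
  exponential rate.\<close>

lemma defect_decay:
  assumes gen: "\<And>\<omega>. \<omega> \<in> G \<Longrightarrow> Re (\<omega> * d) = 0 \<Longrightarrow> \<omega> = 0" and v: "exp_sum G v"
  obtains \<delta> C where "\<delta> > 0" "C > 0"
    "eventually (\<lambda>z. norm ((coef 0 z - W z) / ex (n - 1) z) \<le> C * exp (- \<delta> * norm z)) (conic d)"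
proof -
  have eq: "(coef 0 z - W z) / ex (n - 1) z =
      (coef 0 z - W z) * (1 * exp (- (of_nat (n - 1) * (p / of_nat n)) * z))" for z
    by (simp add: ex_def exp_minus divide_inverse)
  have "exp_sum G (\<lambda>z. (coef 0 z - W z) / ex (n - 1) z)"
    unfolding eq
    by (intro exp_sum_mult exp_sum_diff exp_sum_single coef_exp_sum v W_sum G_minus G_mult p_G G_add)
  \<comment> \<open>Growth rates separate frequencies because differences stay in the group, where
    only 0 is neutral.\<close>
  moreover have "\<omega> = \<omega>'" if "\<omega> \<in> G" "\<omega>' \<in> G" "Re (\<omega> * d) = Re (\<omega>' * d)" for \<omega> \<omega>'
  proof -
    have "\<omega> + - \<omega>' \<in> G"
      using that G_add G_minus by blast
    moreover have "Re ((\<omega> + - \<omega>') * d) = 0"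
      using that(3) by (simp add: algebra_simps)
    ultimately show ?thesis
      using gen[of "\<omega> + - \<omega>'"] by simp
  qed
  ultimately have "exp_sum {\<omega>\<in>G. Re (\<omega> * d) < 0} (\<lambda>z. (coef 0 z - W z) / ex (n - 1) z)"
    using exp_sum_tendsto_0[OF _ d _ defect_tendsto_0] by blast
  thus ?thesis
    by (rule exp_sum_decay) (use that in auto)
qed

text \<open>The power n - 1 is the one in the leading term of \<open>coef 1\<close>. For r = |v / ex
  1|, closeness of (v / ex 1)^n to \<beta> gives r^n \<ge> |\<beta>| / 2; if r < 1 then r^(n-1)
  \<ge> r^n, and otherwise r^(n-1) \<ge> 1, whence the minimum in \<open>q\<close>.\<close>

lemma v_lower_bound:
  obtains c where "c > 0" "eventually (\<lambda>z. norm (v z) ^ (n - 1) \<ge> c * norm (ex (n - 1) z)) (conic d)"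
proof -
  have lim: "((\<lambda>z. norm (1 / ex 1 z)) \<longlongrightarrow> 0) (conic d)"
  proof -
    define P where "P = p / of_nat n"
    define q where "q = Re (P * d) / 2"
    have q: "q > 0" "q < Re (P * d)"
      using p_div_n by (simp_all add: q_def P_def)
    have ex1: "1 / ex 1 z = inverse (exp (P * z))" for z
      by (simp add: ex_def P_def inverse_eq_divide)
    have "eventually (\<lambda>z. norm (norm (1 / ex 1 z)) \<le> exp (- q * norm z)) (conic d)"
      using eventually_norm_exp_conic_ge[OF q(2)]
    proof (rule eventually_mono)
      fix z assume *: "exp (q * norm z) \<le> norm (exp (P * z))"
      have "norm (norm (1 / ex 1 z)) = inverse (norm (exp (P * z)))"
        unfolding ex1 norm_inverse by simp
      also have "\<dots> \<le> inverse (exp (q * norm z))"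
        using * by (rule le_imp_inverse_le) simp
      finally show "norm (norm (1 / ex 1 z)) \<le> exp (- q * norm z)"
        by (simp only: exp_minus mult_minus_left)
    qed
    moreover have "((\<lambda>z. exp (- q * norm z)) \<longlongrightarrow> 0) (conic d)"
      using tendsto_exp_decay_conic[OF q(1), of 1 d] by simp
    ultimately show ?thesis
      by (rule Lim_null_comparison)
  qed
  obtain c where c: "c > 0" "eventually (\<lambda>z. norm (v z ^ n - W z) \<le> c * norm (ex (n - 1) z)) (conic d)"
    using landau_o.bigE[OF v_power_approx] by blast
  have "Y z * exp (- p * z) = Y z / ex n z" for z
    by (simp add: ex_n exp_minus divide_inverse)
  hence "exp_sum {\<omega>\<in>G. Re (\<omega> * d) < 0} (\<lambda>z. Y z / ex n z)"
    using Y_quotient by simp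
  then obtain \<delta> C where Yd: "\<delta> > 0" "C > 0"
    "eventually (\<lambda>z. norm (Y z / ex n z) \<le> C * exp (- \<delta> * norm z)) (conic d)"
    by (rule exp_sum_decay) auto
  have "((\<lambda>z. C * exp (- \<delta> * norm z)) \<longlongrightarrow> 0) (conic d)"
    by (rule tendsto_exp_decay_conic[OF Yd(1)])
  hence Y_small: "eventually (\<lambda>z. C * exp (- \<delta> * norm z) < norm \<beta> / 4) (conic d)"
    by (rule order_tendstoD) (use \<beta> in simp)
  have "((\<lambda>z. c * norm (1 / ex 1 z)) \<longlongrightarrow> 0) (conic d)"
    by (rule tendsto_mult_right_zero[OF lim])
  hence c_small: "eventually (\<lambda>z. c * norm (1 / ex 1 z) < norm \<beta> / 4) (conic d)"
    by (rule order_tendstoD) (use \<beta> in simp)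
  define q where "q = min 1 (norm \<beta> / 2)"
  have q: "q > 0"
    using \<beta> by (simp add: q_def)
  have "eventually (\<lambda>z. norm (v z) ^ (n - 1) \<ge> q * norm (ex (n - 1) z)) (conic d)"
    using c(2) Yd(3) Y_small c_small
  proof eventually_elim
    case (elim z)
    define r where "r = norm (v z / ex 1 z)"
    have ex_pow: "ex 1 z ^ i = ex i z" for i
      by (simp add: ex_def mult.assoc flip: exp_of_nat_mult)
    have ex_n': "ex n z = ex (n - 1) z * ex 1 z"
      unfolding ex_mult using n by simp
    have "(v z / ex 1 z) ^ n - \<beta> = (v z ^ n - W z) / ex n z + Y z / ex n z"
    proof -
      have "(v z / ex 1 z) ^ n = v z ^ n / ex n z"
        by (simp only: power_divide ex_pow)
      moreover have "W z = \<beta> * ex n z + Y z"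
        by (simp only: W_eq ex_n)
      ultimately show ?thesis
        using ex_nonzero[of n z] by (simp add: field_simps)
    qed
    hence "norm ((v z / ex 1 z) ^ n - \<beta>) \<le> norm ((v z ^ n - W z) / ex n z) + norm (Y z / ex n z)"
      by (simp only: norm_triangle_ineq)
    also have "norm ((v z ^ n - W z) / ex n z) \<le> c * norm (1 / ex 1 z)"
    proof -
      have "norm ((v z ^ n - W z) / ex n z) \<le> c * norm (ex (n - 1) z) / norm (ex n z)"
        unfolding norm_divide using elim(1) by (rule divide_right_mono) simp
      also have "\<dots> = c * norm (1 / ex 1 z)"
        unfolding ex_n' using ex_nonzero[of "n - 1" z] by (simp add: norm_mult norm_divide)
      finally show ?thesis .
    qed
    finally have "norm ((v z / ex 1 z) ^ n - \<beta>) \<le> norm \<beta> / 2"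
      using elim by linarith
    moreover have "norm \<beta> - norm ((v z / ex 1 z) ^ n) \<le> norm ((v z / ex 1 z) ^ n - \<beta>)"
      by (metis norm_minus_commute norm_triangle_ineq2)
    ultimately have "r ^ n \<ge> norm \<beta> / 2"
      by (simp add: r_def norm_power norm_divide)
    have "r ^ (n - 1) \<ge> q"
    proof (cases "r \<ge> 1")
      case True
      hence "r ^ (n - 1) \<ge> 1"
        by (rule one_le_power)
      thus ?thesis
        by (simp add: q_def)
    next
      case False
      have "r ^ n \<le> r ^ (n - 1)"
        using False by (intro power_decreasing) (auto simp: r_def)
      thus ?thesis
        using \<open>r ^ n \<ge> norm \<beta> / 2\<close> by (simp add: q_def)
    qed
    moreover have "norm (v z) ^ (n - 1) = r ^ (n - 1) * norm (ex (n - 1) z)"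
    proof -
      have "norm (v z) = r * norm (ex 1 z)"
        using ex_nonzero[of 1 z] by (simp add: r_def norm_divide)
      thus ?thesis
        by (simp only: power_mult_distrib norm_power[symmetric] ex_pow)
    qed
    ultimately show ?case
      by (simp add: mult_right_mono)
  qed
  thus ?thesis
    using that q by blast
qed

end

context leading_exponential
begin

text \<open>The leading part is n v^(n-1), and the remainder is smaller by a factor of the order of
  \<open>ex 1\<close>.\<close>

lemma coef_1_lower_bound:
  assumes n2: "n \<ge> 2"
  obtains c where "c > 0" "eventually (\<lambda>z. norm (coef 1 z) \<ge> c * norm (ex (n - 1) z)) (conic d)"
proof -
  obtain c where c: "c > 0" "eventually (\<lambda>z. norm (v z) ^ (n - 1) \<ge> c * norm (ex (n - 1) z)) (conic d)"
    by (rule v_lower_bound)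
  have "(\<lambda>z. coef 1 z - of_nat (n choose 1) * v z ^ (n - 1)) \<in> O[conic d](ex (n - 1 - 1))"
    using coef_lead[of 1] n2 by simp
  then obtain K where K: "K > 0"
    "eventually (\<lambda>z. norm (coef 1 z - of_nat (n choose 1) * v z ^ (n - 1)) \<le> K * norm (ex (n - 1 - 1) z)) (conic d)"
    using landau_o.bigE by blast
  define P where "P = p / of_nat n"
  have "(\<lambda>z. of_real (norm z)) \<in> O[conic d](\<lambda>z. exp (P * z))"
    by (rule bigo_conic_norm_exp) (use p_div_n in \<open>simp add: P_def\<close>)
  then obtain L where L: "L > 0"
    "eventually (\<lambda>z. norm (of_real (norm z) :: complex) \<le> L * norm (exp (P * z))) (conic d)"
    using landau_o.bigE by blast
  \<comment> \<open>For |z| beyond \<open>2 * K * L / c\<close> the bound |z| \<le> L |ex 1| gives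
    |ex 1| > 2 K / c, so the remainder is at most half of the main term.\<close>
  have "eventually (\<lambda>z. norm (coef 1 z) \<ge> c / 2 * norm (ex (n - 1) z)) (conic d)"
    using c(2) K(2) L(2) eventually_norm_conic[of "2 * K * L / c" d]
  proof eventually_elim
    case (elim z)
    define e where "e = norm (ex (n - 1 - 1) z)"
    have e: "e > 0"
      using ex_nonzero[of "n - 1 - 1" z] by (simp add: e_def)
    have "n - 1 - 1 + 1 = n - 1"
      using n2 by simp
    hence "ex (n - 1) z = ex (n - 1 - 1) z * ex 1 z"
      by (simp only: ex_mult)
    hence ee: "norm (ex (n - 1) z) = e * norm (ex 1 z)"
      by (simp add: e_def norm_mult)
    have "norm z \<le> L * norm (ex 1 z)"
      using elim(3) by (simp add: ex_def P_def)
    hence "2 * K * L / c < L * norm (ex 1 z)"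
      using elim(4) by linarith
    hence "2 * K < c * norm (ex 1 z)"
      using L(1) c(1) by (simp add: field_simps)
    hence "2 * K * e \<le> c * norm (ex 1 z) * e"
      using e by (intro mult_right_mono) auto
    hence small: "K * e \<le> c / 2 * norm (ex (n - 1) z)"
      unfolding ee by (simp add: mult_ac)
    have "norm (v z) ^ (n - 1) \<le> norm (of_nat (n choose 1) * v z ^ (n - 1))"
      using n2 by (simp add: norm_mult norm_power mult_le_cancel_right1)
    also have "\<dots> \<le> norm (coef 1 z) + norm (coef 1 z - of_nat (n choose 1) * v z ^ (n - 1))"
      by (metis norm_minus_commute norm_triangle_sub)
    also have "\<dots> \<le> norm (coef 1 z) + K * e"
      using elim(2) by (simp add: e_def)
    finally show ?case
      using elim(1) small by linarith
  qed
  thus ?thesis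
    using that[of "c / 2"] c(1) by simp
qed

lemma \<kappa>_deriv_zero_type: "zero_type ((deriv ^^ j) \<kappa>)"
  by (induction j) (auto intro: zero_type_deriv \<kappa>_zero_type)

text \<open>The equation is solved for the derivative of \<open>\<kappa>\<close>. Its coefficient
  \<open>coef 1\<close> has size at least of order |ex (n - 1)|, each \<open>coef j\<close> with j
  \<ge> 2 is smaller by a factor |ex 1|, and the defect is exponentially smaller. Since all
  derivatives of \<open>\<kappa>\<close> have type zero, the right side decays exponentially around
  \<open>d\<close>.\<close>

lemma \<kappa>_constant:
  assumes n2: "n \<ge> 2" and gen: "\<And>\<omega>. \<omega> \<in> G \<Longrightarrow> Re (\<omega> * d) = 0 \<Longrightarrow> \<omega> = 0"
    and v: "exp_sum G v"
  shows "deriv \<kappa> z = 0"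
proof -
  obtain \<delta> C where \<delta>: "\<delta> > 0" "C > 0"
    "eventually (\<lambda>z. norm ((coef 0 z - W z) / ex (n - 1) z) \<le> C * exp (- \<delta> * norm z)) (conic d)"
    by (rule defect_decay[OF _ v], erule (1) gen)
  obtain c where c: "c > 0" "eventually (\<lambda>z. norm (coef 1 z) \<ge> c * norm (ex (n - 1) z)) (conic d)"
    by (rule coef_1_lower_bound[OF n2])
  have "\<exists>K. K > 0 \<and> eventually (\<lambda>z. norm (coef j z) \<le> K * norm (ex (n - 2) z)) (conic d)"
    if "j \<in> {2..n}" for j
  proof -
    have "coef j \<in> O[conic d](ex (n - 2))"
      using coef_big[of j] by (rule big_ex_mono) (use that in auto)
    thus ?thesis
      by (elim landau_o.bigE) auto
  qed
  then obtain K where K: "\<And>j. j \<in> {2..n} \<Longrightarrow> K j > 0"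
    "\<And>j. j \<in> {2..n} \<Longrightarrow> eventually (\<lambda>z. norm (coef j z) \<le> K j * norm (ex (n - 2) z)) (conic d)"
    by metis
  have evK: "eventually (\<lambda>z. \<forall>j\<in>{2..n}. norm (coef j z) \<le> K j * norm (ex (n - 2) z)) (conic d)"
    using K(2) by (intro eventually_ball_finite) auto
  define P where "P = p / of_nat n"
  define \<tau> where "\<tau> = Re (P * d) / 2"
  have \<tau>: "\<tau> > 0" "\<tau> < Re (P * d)"
    using p_div_n by (simp_all add: \<tau>_def P_def)
  \<comment> \<open>Half of the available decay: a rate \<open>2 * \<mu>\<close> is gained from the
    coefficients, \<open>\<mu>\<close> is spent on the growth of the derivatives of
    \<open>\<kappa>\<close>, and \<open>\<mu>\<close> remains.\<close>
  define \<mu> where "\<mu> = min \<delta> \<tau> / 2"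
  have \<mu>: "\<mu> > 0" "2 * \<mu> \<le> \<delta>" "2 * \<mu> \<le> \<tau>"
    using \<delta> \<tau> by (auto simp: \<mu>_def)
  have "\<exists>D>0. \<forall>z. norm ((deriv ^^ j) \<kappa> z) \<le> D * exp (\<mu> * norm z)" for j
    using \<kappa>_deriv_zero_type[of j] \<mu>(1) unfolding zero_type_def by blast
  then obtain D where D: "\<And>j. D j > 0" "\<And>j z. norm ((deriv ^^ j) \<kappa> z) \<le> D j * exp (\<mu> * norm z)"
    by metis
  define M where "M = (C * D 0 + (\<Sum>j=2..n. K j * D j)) / c"
  have "eventually (\<lambda>z. norm (deriv \<kappa> z) \<le> M * exp (- \<mu> * norm z)) (conic d)"
    using \<delta>(3) c(2) evK eventually_norm_exp_conic_ge[OF \<tau>(2)]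
  proof eventually_elim
    case (elim z)
    define e where "e = norm (ex (n - 1) z)"
    define E where "E = exp (- \<mu> * norm z)"
    have e: "e > 0"
      using ex_nonzero[of "n - 1" z] by (simp add: e_def)
    have EE: "exp (- (2 * \<mu>) * norm z) * exp (\<mu> * norm z) = E"
      by (simp add: E_def algebra_simps flip: exp_add)
    have ode1: "coef 1 z * deriv \<kappa> z = - ((coef 0 z - W z) * \<kappa> z + (\<Sum>j=2..n. coef j z * (deriv ^^ j) \<kappa> z))"
    proof -
      have "(\<Sum>j=0..n. coef j z * (deriv ^^ j) \<kappa> z) =
          coef 0 z * \<kappa> z + (coef 1 z * deriv \<kappa> z + (\<Sum>j=2..n. coef j z * (deriv ^^ j) \<kappa> z))"
        using n2 by (simp add: sum.atLeast_Suc_atMost numeral_2_eq_2)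
      thus ?thesis
        using ode_\<kappa>[of z] by (simp add: algebra_simps add_eq_0_iff)
    qed
    have 1: "norm ((coef 0 z - W z) * \<kappa> z) \<le> (C * D 0) * E * e"
    proof -
      have "norm (coef 0 z - W z) \<le> C * exp (- \<delta> * norm z) * e"
        using elim(1) e by (simp add: norm_divide e_def divide_le_eq)
      also have "\<dots> \<le> C * exp (- (2 * \<mu>) * norm z) * e"
        using \<delta>(2) e mult_right_mono[OF \<mu>(2), of "norm z"] by (intro mult_right_mono mult_left_mono) auto
      finally have "norm ((coef 0 z - W z) * \<kappa> z) \<le>
          (C * exp (- (2 * \<mu>) * norm z) * e) * (D 0 * exp (\<mu> * norm z))"
        unfolding norm_mult using D(2)[of 0 z] \<delta>(2) e by (intro mult_mono) auto
      also have "\<dots> = (C * D 0) * (exp (- (2 * \<mu>) * norm z) * exp (\<mu> * norm z)) * e"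
        by (simp only: mult_ac)
      finally show ?thesis
        unfolding EE .
    qed
    have 2: "norm (\<Sum>j=2..n. coef j z * (deriv ^^ j) \<kappa> z) \<le> (\<Sum>j=2..n. (K j * D j) * E * e)"
    proof (rule sum_norm_le)
      fix j assume j: "j \<in> {2..n}"
      have "ex (n - 1) z = ex (n - 2) z * ex 1 z"
        unfolding ex_mult using n2 by (simp add: Suc_diff_Suc numeral_2_eq_2)
      hence "norm (ex (n - 2) z) * norm (ex 1 z) = e"
        by (simp add: e_def norm_mult)
      moreover have "norm (ex (n - 2) z) * exp (\<tau> * norm z) \<le> norm (ex (n - 2) z) * norm (ex 1 z)"
        using elim(4) by (intro mult_left_mono) (auto simp: ex_def P_def)
      ultimately have "norm (ex (n - 2) z) \<le> e * exp (- \<tau> * norm z)"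
        by (simp add: exp_minus field_simps)
      also have "\<dots> \<le> e * exp (- (2 * \<mu>) * norm z)"
        using e mult_right_mono[OF \<mu>(3), of "norm z"] by (intro mult_left_mono) auto
      finally have "norm (coef j z) \<le> K j * (e * exp (- (2 * \<mu>) * norm z))"
        using elim(3) j K(1)[OF j] by (meson less_imp_le mult_left_mono order_trans)
      hence "norm (coef j z * (deriv ^^ j) \<kappa> z) \<le>
          (K j * (e * exp (- (2 * \<mu>) * norm z))) * (D j * exp (\<mu> * norm z))"
        unfolding norm_mult using D(2)[of j z] K(1)[OF j] e by (intro mult_mono) auto
      also have "\<dots> = (K j * D j) * (exp (- (2 * \<mu>) * norm z) * exp (\<mu> * norm z)) * e"
        by (simp only: mult_ac)
      finally show "norm (coef j z * (deriv ^^ j) \<kappa> z) \<le> (K j * D j) * E * e"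
        unfolding EE .
    qed
    have "c * e * norm (deriv \<kappa> z) \<le> norm (coef 1 z) * norm (deriv \<kappa> z)"
      using elim(2) by (intro mult_right_mono) (auto simp: e_def)
    also have "\<dots> = norm ((coef 0 z - W z) * \<kappa> z + (\<Sum>j=2..n. coef j z * (deriv ^^ j) \<kappa> z))"
      by (simp only: norm_mult[symmetric] ode1 norm_minus_cancel)
    also have "\<dots> \<le> (C * D 0) * E * e + (\<Sum>j=2..n. (K j * D j) * E * e)"
      using 1 2 by (rule norm_triangle_mono)
    also have "\<dots> = (c * e) * (M * E)"
      using c(1) by (simp add: M_def sum_distrib_right[symmetric] distrib_right) (simp add: algebra_simps)
    finally show ?case
      using c(1) e by (simp add: E_def)
  qed
  from zero_type_conic_decay_imp_zero[OF \<kappa>_deriv_zero_type[of 1, simplified] d \<mu>(1) this]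
  show ?thesis .
qed

lemma solution_form:
  assumes n2: "n \<ge> 2" and gen: "\<And>\<omega>. \<omega> \<in> G \<Longrightarrow> Re (\<omega> * d) = 0 \<Longrightarrow> \<omega> = 0"
    and S2: "exp_sum G S2" "eventually (\<lambda>z. norm (v z - S2 z) \<le> B2) (conic (- d))"
  obtains a0 e F c where "a0 \<noteq> 0" "finite F"
    "\<And>z. f z = a0 * exp (e * z) * exp (\<Sum>\<omega>\<in>F. c \<omega> * exp (\<omega> * z))"
proof -
  have v: "exp_sum G v"
    by (rule v_exp_sum[OF _ S2], erule (1) gen)
  have "deriv \<kappa> z = 0" for z
    by (rule \<kappa>_constant[OF n2 _ v], erule (1) gen)
  hence "(\<kappa> has_field_derivative 0) (at z)" for z
    using holomorphic_derivI[OF \<kappa>[of UNIV] open_UNIV UNIV_I, of z] by simp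
  hence "\<exists>k. \<forall>z\<in>UNIV. \<kappa> z = k"
    by (intro has_field_derivative_zero_constant) auto
  then obtain k where k: "\<And>z. \<kappa> z = k"
    by auto
  have "k \<noteq> 0"
  proof
    assume "k = 0"
    hence "f z = 0" for z
      using k by (simp add: f_eq_\<kappa>)
    thus False
      using not_zero_on_ball[of 1 0] by auto
  qed
  obtain F c e e0 where F: "finite F" "\<And>z. h z = e0 + e * z + (\<Sum>\<omega>\<in>F. c \<omega> * exp (\<omega> * z))"
  proof (rule exp_sum_primitive[OF h v])
    fix F c e e0 assume 1: "finite F" and 2: "\<And>z. h z = e0 + e * z + (\<Sum>\<omega>\<in>F. c \<omega> * exp (\<omega> * z))"
    show thesis
      by (rule that[OF 1 2])
  qed
  show ?thesis
  proof (rule that)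
    show "k * exp e0 \<noteq> 0"
      using \<open>k \<noteq> 0\<close> by simp
    show "f z = k * exp e0 * exp (e * z) * exp (\<Sum>\<omega>\<in>F. c \<omega> * exp (\<omega> * z))" for z
      unfolding f_eq_\<kappa> k F(2) by (simp add: exp_add mult.assoc)
  qed (rule F(1))
qed

end

section \<open>Assembling the required representation\<close>

text \<open>Every \<omega> equals (q - \<sigma>) / n for \<sigma> = q - n \<omega>, so the
  prescribed shape accommodates any finite exponential sum. Index 0 is a dummy term with coefficient
  0 that secures \<sigma> 0 = 0.\<close>

lemma exp_sum_reindex:
  fixes F :: "complex set" and c :: "complex \<Rightarrow> complex" and q :: complex and n :: nat
  assumes F: "finite F" and n: "n \<ge> 1"
  obtains M :: nat and k \<sigma> :: "nat \<Rightarrow> complex" where "\<sigma> 0 = 0"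
    "\<And>z. (\<Sum>\<omega>\<in>F. c \<omega> * exp (\<omega> * z)) = (\<Sum>i=0..M. k i * exp ((q - \<sigma> i) / of_nat n * z))"
proof -
  obtain g where g: "bij_betw g {0..<card F} F"
    using ex_bij_betw_nat_finite[OF F] by blast
  define k where "k i = (if i = 0 then 0 else c (g (i - 1)))" for i
  define \<sigma> where "\<sigma> i = (if i = 0 then 0 else q - of_nat n * g (i - 1))" for i
  have "(\<Sum>i=0..card F. k i * exp ((q - \<sigma> i) / of_nat n * z)) = (\<Sum>\<omega>\<in>F. c \<omega> * exp (\<omega> * z))" for z
  proof -
    have "(\<Sum>i=0..card F. k i * exp ((q - \<sigma> i) / of_nat n * z)) =
        (\<Sum>i<Suc (card F). k i * exp ((q - \<sigma> i) / of_nat n * z))"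
      by (simp only: atLeast0AtMost lessThan_Suc_atMost)
    also have "\<dots> = (\<Sum>i<card F. c (g i) * exp (g i * z))"
      unfolding sum.lessThan_Suc_shift using n by (simp add: k_def \<sigma>_def)
    also have "\<dots> = (\<Sum>\<omega>\<in>F. c \<omega> * exp (\<omega> * z))"
      using sum.reindex_bij_betw[OF g, of "\<lambda>\<omega>. c \<omega> * exp (\<omega> * z)"] by (simp add: atLeast0LessThan)
    finally show ?thesis .
  qed
  thus ?thesis
    using that[of \<sigma> k "card F"] by (simp add: \<sigma>_def)
qed

lemma arg_in_right_sector_Re_pos: "arg_in_right_sector w \<Longrightarrow> Re w > 0"
  using Arg_Re_pos[of w] by (auto simp: arg_in_right_sector_def abs_less_iff)

text \<open>The comparisons are given between neighbours only; they are chained from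
  \<open>i\<close> up to \<open>k - 1\<close> and completed by the strict last step.\<close>

lemma Re_dominated:
  fixes \<mu> :: "nat \<Rightarrow> complex" and \<tau> :: real
  assumes last: "k \<ge> 2 \<Longrightarrow> Re (\<mu> (k - 1)) < Re (\<mu> k)"
    and mono: "\<And>i. 1 \<le> i \<Longrightarrow> i + 1 \<le> k - 1 \<Longrightarrow> Re (\<mu> i) \<le> Re (\<mu> (i + 1))"
    and i: "1 \<le> i" "i < k"
  shows "Re (\<mu> i) < Re (\<mu> k)"
proof -
  have le: "1 \<le> i \<longrightarrow> Re (\<mu> i) \<le> Re (\<mu> (k - 1))" if "i \<le> k - 1" for i
    using that
  proof (induction i rule: inc_induct)
    case (step i)
    thus ?case
      using mono[of i] by auto
  qed simp
  have "Re (\<mu> i) \<le> Re (\<mu> (k - 1))"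
    using le[of i] i by simp
  also have "\<dots> < Re (\<mu> k)"
    by (rule last) (use i in simp)
  finally show ?thesis .
qed

theorem theorem4p1:
  fixes n k l :: nat
    and \<alpha> \<beta> \<mu> \<gamma> \<nu> :: "nat \<Rightarrow> complex"
    and f :: "complex \<Rightarrow> complex"
  assumes "n \<ge> 2" and "k \<ge> 1" and "l \<ge> 1"
    and "\<forall>i\<in>{1..k}. \<beta> i \<noteq> 0"
    and "inj_on \<mu> {1..k}"
    and "\<forall>i\<in>{1..k}. arg_in_right_sector (\<mu> i)"
    and "(\<forall>j\<in>{1..l}. \<gamma> j = 0) \<or> (\<forall>j\<in>{1..l}. \<gamma> j \<noteq> 0)"
    and "inj_on \<nu> {1..l}"
    and "\<forall>j\<in>{1..l}. arg_in_right_sector (\<nu> j)"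
    and "k \<ge> 2 \<Longrightarrow> \<forall>x::real. x > 0 \<longrightarrow>
           norm (exp (\<mu> k * of_real x)) > norm (exp (\<mu> (k-1) * of_real x))"
    and "\<forall>i. 1 \<le> i \<and> i + 1 \<le> k - 1 \<longrightarrow> (\<forall>x::real. x > 0 \<longrightarrow>
           norm (exp (\<mu> (i+1) * of_real x)) \<ge> norm (exp (\<mu> i * of_real x)))"
    and "l \<ge> 2 \<Longrightarrow> \<forall>x::real. x < 0 \<longrightarrow>
           norm (exp (- \<nu> l * of_real x)) > norm (exp (- \<nu> (l-1) * of_real x))"
    and "\<forall>j. 1 \<le> j \<and> j + 1 \<le> l - 1 \<longrightarrow> (\<forall>x::real. x < 0 \<longrightarrow>
           norm (exp (- \<nu> (j+1) * of_real x)) \<ge> norm (exp (- \<nu> j * of_real x)))"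
    and "f holomorphic_on UNIV"
    and "\<exists>z. f z \<noteq> 0"
    and "\<forall>z. (deriv ^^ n) f z + (\<Sum>j=1..n-1. \<alpha> j * (deriv ^^ j) f z)
             - (exp_polynomial k \<beta> \<mu> l \<gamma> \<nu> z + \<beta> 0) * f z = 0"
    and "exponent_of_convergence f < 1"
  shows "\<exists>(M::nat) (N::nat) (a\<^sub>0::complex) (b::complex)
            (c::nat \<Rightarrow> complex) (\<sigma>::nat \<Rightarrow> complex) (d::nat \<Rightarrow> complex) (\<tau>::nat \<Rightarrow> complex).
           a\<^sub>0 \<noteq> 0 \<and> \<sigma> 0 = 0 \<and> \<tau> 0 = 0 \<and>
           (\<forall>z. f z = a\<^sub>0 * exp (b * z) *
              exp ((\<Sum>i=0..M. c i * exp ((\<mu> k - \<sigma> i) / of_nat n * z)) +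
                   (\<Sum>j=0..N. d j * exp (- ((\<nu> l - \<tau> j) / of_nat n) * z))))"
proof -
  have \<mu>_pos: "Re (\<mu> i) > 0" if "i \<in> {1..k}" for i
    using assms(6) that arg_in_right_sector_Re_pos by blast
  have \<nu>_pos: "Re (\<nu> j) > 0" if "j \<in> {1..l}" for j
    using assms(9) that arg_in_right_sector_Re_pos by blast
  \<comment> \<open>The comparisons of norms on the two half-axes become comparisons of real parts
    when evaluated at 1 and -1.\<close>
  have \<mu>_lt: "Re (\<mu> i) < Re (\<mu> k)" if "1 \<le> i" "i < k" for i
  proof (rule Re_dominated[OF _ _ that])
    show "Re (\<mu> (k - 1)) < Re (\<mu> k)" if "k \<ge> 2"
      using assms(10)[OF that, rule_format, of 1] by simp
    show "Re (\<mu> i) \<le> Re (\<mu> (i + 1))" if "1 \<le> i" "i + 1 \<le> k - 1" for i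
      using assms(11)[rule_format, of i 1] that by simp
  qed
  have \<nu>_lt: "Re (\<nu> j) < Re (\<nu> l)" if "1 \<le> j" "j < l" for j
  proof (rule Re_dominated[OF _ _ that])
    show "Re (\<nu> (l - 1)) < Re (\<nu> l)" if "l \<ge> 2"
      using assms(12)[OF that, rule_format, of "- 1"] by simp
    show "Re (\<nu> j) \<le> Re (\<nu> (j + 1))" if "1 \<le> j" "j + 1 \<le> l - 1" for j
      using assms(13)[rule_format, of j "- 1"] that by simp
  qed
  \<comment> \<open>The n-th parts of the two leading frequencies are included because the
    expansions of \<open>v\<close> start with them.\<close>
  define \<Lambda> where "\<Lambda> = {\<mu> k / of_nat n, \<nu> l / of_nat n} \<union> \<mu> ` {1..k} \<union> \<nu> ` {1..l}"
  have "countable \<Lambda>"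
    by (simp add: \<Lambda>_def)
  then obtain G where G: "countable G" "\<Lambda> \<subseteq> G" "0 \<in> G"
      "\<And>x y. x \<in> G \<Longrightarrow> y \<in> G \<Longrightarrow> x + y \<in> G" "\<And>x. x \<in> G \<Longrightarrow> - x \<in> G"
    by (rule countable_additive_subgroup) blast
  \<comment> \<open>The numbers whose positive real part must survive the turn of the axis to
    \<open>d\<close>: the frequencies, and the gaps by which the leading ones dominate.\<close>
  define X where "X = \<mu> ` {1..k} \<union> \<nu> ` {1..l} \<union> (\<lambda>i. \<mu> k - \<mu> i) ` {1..<k} \<union> (\<lambda>j. \<nu> l - \<nu> j) ` {1..<l}"
  have "finite X" "\<And>x. x \<in> X \<Longrightarrow> Re x > 0"
    using \<mu>_pos \<nu>_pos \<mu>_lt \<nu>_lt by (auto simp: X_def)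
  then obtain d where d: "norm d = 1" and d_pos: "\<And>x. x \<in> X \<Longrightarrow> Re (x * d) > 0"
    and gen: "\<And>\<omega>. \<omega> \<in> G \<Longrightarrow> Re (\<omega> * d) = 0 \<Longrightarrow> \<omega> = 0"
  proof (rule generic_direction[OF _ _ G(1)])
    fix d assume 1: "norm d = 1" and 2: "\<And>x. x \<in> X \<Longrightarrow> Re (x * d) > 0"
      and 3: "\<And>\<omega>. \<omega> \<in> G \<Longrightarrow> Re (\<omega> * d) = 0 \<Longrightarrow> \<omega> = 0"
    show thesis
      by (rule that[OF 1 2 3])
  qed
  have \<mu>_d: "Re (\<mu> i * d) > 0" if "i \<in> {1..k}" for i
    by (rule d_pos) (use that in \<open>simp add: X_def\<close>)
  have \<nu>_d: "Re (\<nu> j * d) > 0" if "j \<in> {1..l}" for j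
    by (rule d_pos) (use that in \<open>simp add: X_def\<close>)
  have \<mu>_d_lt: "Re (\<mu> i * d) < Re (\<mu> k * d)" if "i \<in> {1..<k}" for i
    using d_pos[of "\<mu> k - \<mu> i"] that by (simp add: X_def left_diff_distrib)
  have \<nu>_d_lt: "Re (\<nu> j * d) < Re (\<nu> l * d)" if "j \<in> {1..<l}" for j
    using d_pos[of "\<nu> l - \<nu> j"] that by (simp add: X_def left_diff_distrib)
  have G_mem: "\<mu> i \<in> G" "\<nu> j \<in> G" "\<mu> k / of_nat n \<in> G" "\<nu> l / of_nat n \<in> G"
    if "i \<in> {1..k}" "j \<in> {1..l}" for i j
    using G(2) that by (auto simp: \<Lambda>_def)
  define W where "W z = exp_polynomial k \<beta> \<mu> l \<gamma> \<nu> z + \<beta> 0" for z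
  define A where "A z = (\<Sum>i=1..k-1. \<beta> (k - i) * exp (\<mu> (k - i) * z))" for z
  define A' where "A' z = (\<Sum>j=1..l-1. \<gamma> (l - j) * exp (- \<nu> (l - j) * z))" for z
  have W_eq: "W z = \<beta> k * exp (\<mu> k * z) + A z + \<gamma> l * exp (- \<nu> l * z) + A' z + \<beta> 0" for z
    by (simp add: W_def exp_polynomial_def A_def A'_def sum.atLeast_Suc_atMost)
  obtain s b m h where s: "0 < s" "s < 1" "summable (\<lambda>n. norm (b n) powr s)"
    and h: "h holomorphic_on UNIV" and f_eq: "\<And>z. f z = z ^ m * canonical_product b z * exp (h z)"
    by (rule hadamard_factorization_genus_0[OF assms(14,15,17)]) blast
  interpret factored_solution n \<alpha> W f h b m s
  proof
    show "W holomorphic_on UNIV"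
      unfolding W_def exp_polynomial_def by (intro holomorphic_intros)
    show "(deriv ^^ n) f z + (\<Sum>j=1..n-1. \<alpha> j * (deriv ^^ j) f z) - W z * f z = 0" for z
      using assms(16) by (simp add: W_def)
  qed (use assms(1) s h f_eq in auto)
  \<comment> \<open>The constant is written as a term of frequency 0, so that it counts as part of
    the exponential sum.\<close>
  define Yp where "Yp z = A z + (\<gamma> l * exp (- \<nu> l * z) + A' z) + \<beta> 0 * exp (0 * z)" for z
  have Yp: "exp_sum {\<omega>\<in>G. Re (\<omega> * d) < Re (\<mu> k * d)} Yp"
  proof -
    have neg: "- \<nu> j \<in> {\<omega>\<in>G. Re (\<omega> * d) < Re (\<mu> k * d)}" if "j \<in> {1..l}" for j
      using \<nu>_d[OF that] \<mu>_d[of k] G_mem(2)[OF _ that, of k] G(5) assms(2) by (auto simp del: times_complex.sel)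
    have low: "\<mu> i \<in> {\<omega>\<in>G. Re (\<omega> * d) < Re (\<mu> k * d)}" if "i \<in> {1..<k}" for i
      using \<mu>_d_lt[OF that] G_mem(1)[of i l] assms(3) that by (auto simp del: times_complex.sel)
    show ?thesis
      unfolding Yp_def[abs_def] A_def A'_def
      by (intro exp_sum_add exp_sum_sum exp_sum_single neg low)
        (use assms(2,3) \<mu>_d[of k] G(3) in auto)
  qed
  interpret R: leading_exponential n \<alpha> W f h b m s d "\<mu> k" G "\<beta> k" Yp
  proof
    show "norm d = 1"
      by (rule d)
    show "Re (\<mu> k * d) > 0"
      using \<mu>_d[of k] assms(2) by simp
    show W_Yp: "W z = \<beta> k * exp (\<mu> k * z) + Yp z" for z
      by (simp add: W_eq Yp_def)
    show "W \<in> O[conic d](\<lambda>z. exp (\<mu> k * z))"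
      unfolding W_Yp[abs_def] by (intro sum_in_bigo exp_sum_lower_bigo[OF Yp]) simp
  qed (use G Yp G_mem[of k l] assms(2-4) in auto)
  \<comment> \<open>If all \<open>\<gamma> j\<close> vanish, nothing grows towards
    \<open>- d\<close>: \<open>W\<close> and hence \<open>v\<close> are bounded there, and the zero
    sum serves. Otherwise \<open>- \<nu> l\<close> leads in direction \<open>- d\<close> and the
    same expansion of the root applies.\<close>
  have "\<exists>S B. exp_sum G S \<and> eventually (\<lambda>z. norm (v z - S z) \<le> B) (conic (- d))"
  proof (cases "\<forall>j\<in>{1..l}. \<gamma> j = 0")
    case True
    have "A' z = 0" for z
      unfolding A'_def using True by (intro sum.neutral) auto
    hence W_eq': "W z = \<beta> k * exp (\<mu> k * z) + A z + \<beta> 0" for z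
      using True assms(3) by (simp add: W_eq)
    have "exp_sum {\<omega>. Re (\<omega> * (- d)) < 0} (\<lambda>z. \<beta> k * exp (\<mu> k * z) + A z)"
    proof -
      have "\<mu> i \<in> {\<omega>. Re (\<omega> * (- d)) < 0}" if "i \<in> {1..k}" for i
        using \<mu>_d[OF that] by simp
      thus ?thesis
        unfolding A_def using assms(2) by (intro exp_sum_add exp_sum_sum exp_sum_single) auto
    qed
    then obtain B where B: "eventually (\<lambda>z. norm (\<beta> k * exp (\<mu> k * z) + A z) \<le> B) (conic (- d))"
      by (rule exp_sum_decay_bounded) auto
    have "eventually (\<lambda>z. norm (W z) \<le> B + norm (\<beta> 0)) (conic (- d))"
      using B by (rule eventually_mono) (simp only: W_eq', rule norm_triangle_mono, auto)
    then obtain B' where "eventually (\<lambda>z. norm (v z) \<le> B') (conic (- d))"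
      by (rule v_bounded_conic)
    thus ?thesis
      by (intro exI[of _ "\<lambda>_. 0"] exI[of _ B']) (simp add: exp_sum_zero)
  next
    case False
    hence \<gamma>: "\<gamma> l \<noteq> 0"
      using assms(3,7) by auto
    define Yn where "Yn z = (\<beta> k * exp (\<mu> k * z) + A z) + A' z + \<beta> 0 * exp (0 * z)" for z
    have Yn: "exp_sum {\<omega>\<in>G. Re (\<omega> * (- d)) < Re (- \<nu> l * (- d))} Yn"
    proof -
      have pos: "\<mu> i \<in> {\<omega>\<in>G. Re (\<omega> * (- d)) < Re (- \<nu> l * (- d))}" if "i \<in> {1..k}" for i
        using \<mu>_d[OF that] \<nu>_d[of l] G_mem(1)[OF that, of l] assms(3) by (auto simp del: times_complex.sel)
      have low: "- \<nu> j \<in> {\<omega>\<in>G. Re (\<omega> * (- d)) < Re (- \<nu> l * (- d))}" if "j \<in> {1..<l}" for j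
        using \<nu>_d_lt[OF that] G_mem(2)[of k j] G(5) assms(2) that by (auto simp del: times_complex.sel)
      show ?thesis
        unfolding Yn_def[abs_def] A_def A'_def
        by (intro exp_sum_add exp_sum_sum exp_sum_single pos low)
          (use assms(2,3) \<nu>_d[of l] G(3) in auto)
    qed
    interpret L: leading_exponential n \<alpha> W f h b m s "- d" "- \<nu> l" G "\<gamma> l" Yn
    proof
      show "norm (- d) = 1"
        using d by simp
      show "Re (- \<nu> l * - d) > 0"
        using \<nu>_d[of l] assms(3) by simp
      show W_Yn: "W z = \<gamma> l * exp (- \<nu> l * z) + Yn z" for z
        by (simp add: W_eq Yn_def)
      show "W \<in> O[conic (- d)](\<lambda>z. exp (- \<nu> l * z))"
        unfolding W_Yn[abs_def] by (intro sum_in_bigo exp_sum_lower_bigo[OF Yn]) simp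
      show "- \<nu> l / of_nat n \<in> G"
        using G(5)[OF G_mem(4)[of k l]] assms(2,3) by simp
    qed (use G Yn \<gamma> in auto)
    show ?thesis
      by (rule L.v_exp_sum_approx) blast
  qed
  then obtain S2 B2 where S2: "exp_sum G S2" "eventually (\<lambda>z. norm (v z - S2 z) \<le> B2) (conic (- d))"
    by blast
  obtain a0 b' F c where form: "a0 \<noteq> 0" "finite F"
      "\<And>z. f z = a0 * exp (b' * z) * exp (\<Sum>\<omega>\<in>F. c \<omega> * exp (\<omega> * z))"
  proof (rule R.solution_form[OF assms(1) gen S2])
    fix a0 b' F c assume 1: "a0 \<noteq> 0" and 2: "finite F"
      and 3: "\<And>z. f z = a0 * exp (b' * z) * exp (\<Sum>\<omega>\<in>F. c \<omega> * exp (\<omega> * z))"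
    show thesis
      by (rule that[OF 1 2 3])
  qed
  obtain M and c' \<sigma> :: "nat \<Rightarrow> complex" where \<sigma>: "\<sigma> 0 = 0"
      "\<And>z. (\<Sum>\<omega>\<in>F. c \<omega> * exp (\<omega> * z)) = (\<Sum>i=0..M. c' i * exp ((\<mu> k - \<sigma> i) / of_nat n * z))"
  proof (rule exp_sum_reindex[OF form(2) n, of c "\<mu> k"])
    fix M and c' \<sigma> :: "nat \<Rightarrow> complex" assume 1: "\<sigma> 0 = 0"
      and 2: "\<And>z. (\<Sum>\<omega>\<in>F. c \<omega> * exp (\<omega> * z)) = (\<Sum>i=0..M. c' i * exp ((\<mu> k - \<sigma> i) / of_nat n * z))"
    show thesis
      by (rule that[OF 1 2])
  qed
  show ?thesis
  proof (intro exI conjI allI)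
    \<comment> \<open>The first sum already carries all frequencies, those of negative real part
      included, so the second one is a single term with coefficient 0.\<close>
    show "f z = a0 * exp (b' * z) * exp ((\<Sum>i=0..M. c' i * exp ((\<mu> k - \<sigma> i) / of_nat n * z)) +
        (\<Sum>j=0..0. (\<lambda>_. 0) j * exp (- ((\<nu> l - (\<lambda>_. 0) j) / of_nat n) * z)))" for z
      unfolding form(3) \<sigma>(2) by simp
  qed (use form(1) \<sigma>(1) in simp_all)
qed

end
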